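(* Let $\mu\in X_*(T)$ be dominant, i.e. $(G,\mu)\in\mathcal{C}_G$. Then in the free abelian group $\mathbb{Z}\langle\mathcal{C}_G\rangle$ on the set of cocharacter pairs of $G$, \[ \sum_{b\in\mathbf{B}(G,\mu)}\mathcal{M}_{G,b,\mu}=(G,\mu). \]
   Context: Let $G$ be a connected quasisplit reductive group over $\mathbb{Q}_p$, $\Gamma=\mathrm{Gal}(\overline{\mathbb{Q}_p}/\mathbb{Q}_p)$. Fix a maximal $\mathbb{Q}_p$-split torus $A$, and a maximal torus $T$ and Borel subgroup $B$ defined over $\mathbb{Q}_p$ with $A\subset T\subset B$. Let $\Delta$ be the set of simple relative roots of $(G,A)$ determined by $B$. For $S\subset\Delta$, $P_S$ is the standard parabolic subgroup attached to $S$ and $M_S$ its unique Levi factor containing $T$ (a standard Levi subgroup). Put $\mathfrak{A}_{\mathbb{Q}}=X_*(A)\otimes\mathbb{Q}=X_*(T)^\Gamma\otimes\mathbb{Q}$. For $x,y\in\mathfrak{A}_{\mathbb{Q}}$, $x\preceq y$ means $y-x$ is a non-negative rational combination of simple relative coroots, and $x\prec y$ means $x\preceq y$, $x\neq y$. Let $\mathfrak{A}_{M_S,\mathbb{Q}}=\{x:\langle x,\alpha\rangle=0\ (\alpha\in S),\ \langle x,\alpha\rangle\ne0\ (\alpha\in\Delta\setminus S)\}$ and $\mathfrak{A}^+_{M_S,\mathbb{Q}}=\{x:\langle x,\alpha\rangle=0\ (\alpha\in S),\ \langle x,\alpha\rangle>0\ (\alpha\in\Delta\setminus S)\}$. Let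 $W^{\mathrm{rel}}_{M_S}$ be the subgroup of the relative Weyl group generated by the reflections for $\alpha\in S$. For $\mu\in X_*(T)$ let $\mu^\Gamma$ be the average of the $\Gamma$-orbit of $\mu$, and $\theta_{M_S}(\mu)=\frac{1}{|W^{\mathrm{rel}}_{M_S}|}\sum_{\sigma\in W^{\mathrm{rel}}_{M_S}}\sigma(\mu^\Gamma)\in\mathfrak{A}_{\mathbb{Q}}$. A cocharacter pair is $(M_S,\mu_S)$ with $M_S$ a standard Levi and $\mu_S\in X_*(T)$ with $\langle\mu_S,\alpha\rangle\ge0$ for every $B$-positive absolute root $\alpha$ of $T$ in $\mathrm{Lie}(M_S)$; $\mathcal{C}_G$ is the set of these. Partial order $\le$ on $\mathcal{C}_G$: if $S_2\subset S_1$ with $|S_1\setminus S_2|=1$, $(M_{S_2},\mu_{S_2})\le(M_{S_1},\mu_{S_1})$ iff $\mu_{S_2},\mu_{S_1}$ are conjugate under $M_{S_1}(\overline{\mathbb{Q}_p})$ and $\theta_{M_{S_2}}(\mu_{S_2})\succ\theta_{M_{S_1}}(\mu_{S_1})$; $\le$ is the reflexive transitive closure of this. $(M_S,\mu_S)$ is strictly decreasing if $\theta_{M_S}(\mu_S)\in\mathfrak{A}^+_{M_S,\mathbb{Q}}$; $\mathcal{SD}_\mu$ is the set of strictly decreasing pairs $\le(G,\mu)$. $\mathbf{B}(G)$ is Kottwitz's set of isocrystals with $G$-structure, with Newton map $\nu$ (valued in dominant elements of $\mathfrak{A}_{\mathbb{Q}}$) and Kottwitz map $\kappa:\mathbf{B}(G)\to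 X^*(Z(\widehat G)^\Gamma)$; $b$ is determined by $(\nu(b),\kappa(b))$. Via $X_*(T)=X^*(\widehat T)$, $\mu|_{Z(\widehat G)^\Gamma}$ is the restriction. $M_b$ (with simple-root set $S_b$) is the standard Levi with $\nu(b)\in\mathfrak{A}_{M_b,\mathbb{Q}}$. $\mathbf{B}(G,\mu)=\{b:\nu(b)\preceq\mu^\Gamma,\ \kappa(b)=\mu|_{Z(\widehat G)^\Gamma}\}$. For strictly decreasing $(M_S,\mu_S)$ there is a unique $b=:\mathcal{T}(M_S,\mu_S)\in\mathbf{B}(G)$ with $\kappa(b)=\mu_S|_{Z(\widehat G)^\Gamma}$ and $\nu(b)=\theta_{M_S}(\mu_S)$. For $b\in\mathbf{B}(G,\mu)$: $\mathcal{T}_{G,b,\mu}=\mathcal{T}^{-1}(b)\cap\mathcal{SD}_\mu$; $\mathcal{R}_{G,b,\mu}=\{(M_{S_1},\mu_{S_1})\in\mathcal{C}_G:(M_{S_1},\mu_{S_1})\le(M_{S_2},\mu_{S_2})$ for some $(M_{S_2},\mu_{S_2})\in\mathcal{T}_{G,b,\mu}\}$; and $\mathcal{M}_{G,b,\mu}=\sum_{(M_S,\mu_S)\in\mathcal{R}_{G,b,\mu}}(-1)^{|S_b\setminus S|}(M_S,\mu_S)\in\mathbb{Z}\langle\mathcal{C}_G\rangle$. *)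

theory Defs
  imports Complex_Main "HOL-Algebra.Bij" "HOL-Algebra.Free_Abelian_Groups"
begin

text \<open>
  Reductive groups are not available in the libraries. A connected quasisplit reductive group
  \<open>G\<close> over \<open>\<rat>\<^sub>p\<close> with a Borel pair \<open>T \<subseteq> B\<close> over \<open>\<rat>\<^sub>p\<close> is represented by its based root
  datum with Galois action, and by the group \<open>G(L)\<close>, where \<open>L\<close> is the completion of the maximal
  unramified extension of \<open>\<rat>\<^sub>p\<close>, with its Frobenius, Newton map and Kottwitz map.
  The type \<open>'v\<close> is \<open>X\<^sub>*(T) \<otimes> \<rat>\<close>; a character of \<open>T\<close> is the linear form that it
  induces on \<open>'v\<close> by the pairing, so that \<open>\<langle>x, \<chi>\<rangle>\<close> is the application \<open>\<chi> x\<close>.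
\<close>

record ('v, 'g, 'l) reductive_data =
  scaleQ :: "rat \<Rightarrow> 'v \<Rightarrow> 'v"
  zbasis :: "'v set"  \<comment> \<open>a \<open>\<int>\<close>-basis of \<open>X\<^sub>*(T)\<close>\<close>
  abs_roots :: "('v \<Rightarrow> rat) set"
  coroot :: "('v \<Rightarrow> rat) \<Rightarrow> 'v"
  abs_simple_roots :: "('v \<Rightarrow> rat) set"  \<comment> \<open>determined by \<open>B\<close>\<close>
  Gal :: "'g monoid"
  act :: "'g \<Rightarrow> 'v \<Rightarrow> 'v"
  points :: "'l monoid"  \<comment> \<open>\<open>G(L)\<close>\<close>
  frob :: "'l \<Rightarrow> 'l"
  newton :: "'l set \<Rightarrow> 'v"
  kottwitz :: "'l set \<Rightarrow> ('v \<Rightarrow> complex) \<Rightarrow> complex"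


subsection \<open>The absolute root datum\<close>

definition cocharacters :: "('v::ab_group_add, 'g, 'l) reductive_data \<Rightarrow> 'v set" where
  "cocharacters G = range (\<lambda>c :: 'v \<Rightarrow> int. \<Sum>b\<in>zbasis G. scaleQ G (of_int (c b)) b)"

definition characters :: "('v::ab_group_add, 'g, 'l) reductive_data \<Rightarrow> ('v \<Rightarrow> rat) set" where
  "characters G = {\<chi>. Vector_Spaces.linear (scaleQ G) (*) \<chi> \<and> \<chi> ` cocharacters G \<subseteq> \<int>}"

definition abs_reflection ::
    "('v::ab_group_add, 'g, 'l) reductive_data \<Rightarrow> ('v \<Rightarrow> rat) \<Rightarrow> 'v \<Rightarrow> 'v" where
  "abs_reflection G \<alpha> = (\<lambda>x. x - scaleQ G (\<alpha> x) (coroot G \<alpha>))"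

definition abs_pos_roots :: "('v::ab_group_add, 'g, 'l) reductive_data \<Rightarrow> ('v \<Rightarrow> rat) set" where
  "abs_pos_roots G = {\<alpha> \<in> abs_roots G.
     \<exists>n :: ('v \<Rightarrow> rat) \<Rightarrow> nat. \<alpha> = (\<lambda>x. \<Sum>\<beta>\<in>abs_simple_roots G. of_nat (n \<beta>) * \<beta> x)}"

definition abs_weyl_group :: "('v::ab_group_add, 'g, 'l) reductive_data \<Rightarrow> ('v \<Rightarrow> 'v) set" where
  "abs_weyl_group G = generate (BijGroup UNIV) (abs_reflection G ` abs_roots G)"

locale based_root_datum =
  fixes G :: "('v::ab_group_add, 'g, 'l) reductive_data"
  assumes cocharacter_space: "finite_dimensional_vector_space (scaleQ G) (zbasis G)"
    and finite_abs_roots: "finite (abs_roots G)"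
    and abs_roots_characters: "abs_roots G \<subseteq> characters G"
    and coroot_cocharacter: "\<alpha> \<in> abs_roots G \<Longrightarrow> coroot G \<alpha> \<in> cocharacters G"
    and inj_coroot: "inj_on (coroot G) (abs_roots G)"
    and root_coroot: "\<alpha> \<in> abs_roots G \<Longrightarrow> \<alpha> (coroot G \<alpha>) = 2"
    and reflection_root: "\<lbrakk>\<alpha> \<in> abs_roots G; \<beta> \<in> abs_roots G\<rbrakk>
          \<Longrightarrow> (\<lambda>x. \<beta> x - \<beta> (coroot G \<alpha>) * \<alpha> x) \<in> abs_roots G"
    and reflection_coroot: "\<lbrakk>\<alpha> \<in> abs_roots G; \<beta> \<in> abs_roots G\<rbrakk>
          \<Longrightarrow> abs_reflection G \<alpha> (coroot G \<beta>) \<in> coroot G ` abs_roots G"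
    and reduced: "\<alpha> \<in> abs_roots G \<Longrightarrow> (\<lambda>x. 2 * \<alpha> x) \<notin> abs_roots G"
    and abs_simple_roots: "abs_simple_roots G \<subseteq> abs_roots G"
    and abs_simple_roots_independent:
          "\<lbrakk>\<And>x. (\<Sum>\<beta>\<in>abs_simple_roots G. c \<beta> * \<beta> x) = 0; \<beta> \<in> abs_simple_roots G\<rbrakk> \<Longrightarrow> c \<beta> = 0"
    and abs_roots_pos_or_neg: "\<alpha> \<in> abs_roots G
          \<Longrightarrow> \<alpha> \<in> abs_pos_roots G \<or> (\<lambda>x. - \<alpha> x) \<in> abs_pos_roots G"


subsection \<open>The Galois action\<close>

text \<open>
  \<open>\<Gamma>\<close> acts on \<open>X\<^sub>*(T)\<close> through a finite quotient and on \<open>X\<^sup>*(T)\<close> by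
  \<open>\<gamma>\<chi> = \<chi> \<circ> \<gamma>\<inverse>\<close>. As \<open>B\<close> is defined over \<open>\<rat>\<^sub>p\<close>, the absolute simple roots are stable.
\<close>

locale quasisplit_root_datum = based_root_datum G
  for G :: "('v::ab_group_add, 'g, 'l) reductive_data" +
  assumes Gal_group: "group (Gal G)"
    and act_one: "act G \<one>\<^bsub>Gal G\<^esub> x = x"
    and act_mult: "\<lbrakk>\<gamma> \<in> carrier (Gal G); \<delta> \<in> carrier (Gal G)\<rbrakk>
          \<Longrightarrow> act G (\<gamma> \<otimes>\<^bsub>Gal G\<^esub> \<delta>) x = act G \<gamma> (act G \<delta> x)"
    and act_linear: "\<gamma> \<in> carrier (Gal G) \<Longrightarrow> Vector_Spaces.linear (scaleQ G) (scaleQ G) (act G \<gamma>)"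
    and act_cocharacters: "\<lbrakk>\<gamma> \<in> carrier (Gal G); x \<in> cocharacters G\<rbrakk> \<Longrightarrow> act G \<gamma> x \<in> cocharacters G"
    and act_finite: "finite (act G ` carrier (Gal G))"
    and act_roots: "\<lbrakk>\<gamma> \<in> carrier (Gal G); \<alpha> \<in> abs_roots G\<rbrakk>
          \<Longrightarrow> \<alpha> \<circ> act G (inv\<^bsub>Gal G\<^esub> \<gamma>) \<in> abs_roots G"
    and act_coroots: "\<lbrakk>\<gamma> \<in> carrier (Gal G); \<alpha> \<in> abs_roots G\<rbrakk>
          \<Longrightarrow> coroot G (\<alpha> \<circ> act G (inv\<^bsub>Gal G\<^esub> \<gamma>)) = act G \<gamma> (coroot G \<alpha>)"
    and act_simple_roots: "\<lbrakk>\<gamma> \<in> carrier (Gal G); \<alpha> \<in> abs_simple_roots G\<rbrakk>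
          \<Longrightarrow> \<alpha> \<circ> act G (inv\<^bsub>Gal G\<^esub> \<gamma>) \<in> abs_simple_roots G"

definition Gal_average :: "('v::ab_group_add, 'g, 'l) reductive_data \<Rightarrow> 'v \<Rightarrow> 'v" where
  "Gal_average G \<mu> =
     (let orbit = (\<lambda>\<gamma>. act G \<gamma> \<mu>) ` carrier (Gal G)
      in scaleQ G (1 / of_nat (card orbit)) (\<Sum>x\<in>orbit. x))"


subsection \<open>The relative root system\<close>

definition frakA :: "('v::ab_group_add, 'g, 'l) reductive_data \<Rightarrow> 'v set" where
  "frakA G = {x. \<forall>\<gamma>\<in>carrier (Gal G). act G \<gamma> x = x}"

text \<open>A relative root is a linear form on \<open>frakA G\<close>, extended by \<open>undefined\<close> outside.\<close>

definition rel_pos_roots :: "('v::ab_group_add, 'g, 'l) reductive_data \<Rightarrow> ('v \<Rightarrow> rat) set" where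
  "rel_pos_roots G = {restrict \<alpha> (frakA G) | \<alpha>. \<alpha> \<in> abs_pos_roots G \<and> (\<exists>x\<in>frakA G. \<alpha> x \<noteq> 0)}"

definition Delta :: "('v::ab_group_add, 'g, 'l) reductive_data \<Rightarrow> ('v \<Rightarrow> rat) set" where
  "Delta G = {\<alpha> \<in> rel_pos_roots G.
     \<not> (\<exists>\<beta>\<in>rel_pos_roots G. \<exists>\<gamma>\<in>rel_pos_roots G. \<alpha> = (\<lambda>x\<in>frakA G. \<beta> x + \<gamma> x))}"

text \<open>
  \<open>N\<^sub>G(A) / Z\<^sub>G(A)\<close>: since \<open>Z\<^sub>G(A) = T\<close>, the group \<open>N\<^sub>G(A)\<close> normalizes \<open>T\<close>, so its elements
  act on \<open>X\<^sub>*(A)\<close> as the elements of the absolute Weyl group stabilizing it.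
\<close>

definition rel_weyl_group :: "('v::ab_group_add, 'g, 'l) reductive_data \<Rightarrow> ('v \<Rightarrow> 'v) set" where
  "rel_weyl_group G = {restrict w (frakA G) | w. w \<in> abs_weyl_group G \<and> w ` frakA G = frakA G}"

definition rel_coroot :: "('v::ab_group_add, 'g, 'l) reductive_data \<Rightarrow> ('v \<Rightarrow> rat) \<Rightarrow> 'v" where
  "rel_coroot G \<alpha> = (THE c. c \<in> frakA G \<and> \<alpha> c = 2 \<and>
     (\<lambda>x\<in>frakA G. x - scaleQ G (\<alpha> x) c) \<in> rel_weyl_group G)"

definition rel_reflection ::
    "('v::ab_group_add, 'g, 'l) reductive_data \<Rightarrow> ('v \<Rightarrow> rat) \<Rightarrow> 'v \<Rightarrow> 'v" where
  "rel_reflection G \<alpha> = (\<lambda>x\<in>frakA G. x - scaleQ G (\<alpha> x) (rel_coroot G \<alpha>))"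

definition prec_eq :: "('v::ab_group_add, 'g, 'l) reductive_data \<Rightarrow> 'v \<Rightarrow> 'v \<Rightarrow> bool" where
  "prec_eq G x y \<longleftrightarrow> (\<exists>c :: ('v \<Rightarrow> rat) \<Rightarrow> rat.
     (\<forall>\<alpha>\<in>Delta G. 0 \<le> c \<alpha>) \<and> y - x = (\<Sum>\<alpha>\<in>Delta G. scaleQ G (c \<alpha>) (rel_coroot G \<alpha>)))"

definition prec :: "('v::ab_group_add, 'g, 'l) reductive_data \<Rightarrow> 'v \<Rightarrow> 'v \<Rightarrow> bool" where
  "prec G x y \<longleftrightarrow> prec_eq G x y \<and> x \<noteq> y"


subsection \<open>Standard Levi subgroups\<close>

text \<open>The standard Levi subgroup \<open>M\<^sub>S\<close> is represented by the set \<open>S \<subseteq> Delta G\<close>.\<close>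

definition frakA_Levi ::
    "('v::ab_group_add, 'g, 'l) reductive_data \<Rightarrow> ('v \<Rightarrow> rat) set \<Rightarrow> 'v set" where
  "frakA_Levi G S =
     {x \<in> frakA G. (\<forall>\<alpha>\<in>S. \<alpha> x = 0) \<and> (\<forall>\<alpha>\<in>Delta G - S. \<alpha> x \<noteq> 0)}"

definition frakA_Levi_pos ::
    "('v::ab_group_add, 'g, 'l) reductive_data \<Rightarrow> ('v \<Rightarrow> rat) set \<Rightarrow> 'v set" where
  "frakA_Levi_pos G S =
     {x \<in> frakA G. (\<forall>\<alpha>\<in>S. \<alpha> x = 0) \<and> (\<forall>\<alpha>\<in>Delta G - S. \<alpha> x > 0)}"

text \<open>
  The roots of \<open>T\<close> in \<open>Lie(M\<^sub>S)\<close>: \<open>M\<^sub>S\<close> is the centralizer of the identity component of the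
  intersection in \<open>A\<close> of the kernels of the elements of \<open>S\<close>.
\<close>

definition Levi_roots ::
    "('v::ab_group_add, 'g, 'l) reductive_data \<Rightarrow> ('v \<Rightarrow> rat) set \<Rightarrow> ('v \<Rightarrow> rat) set" where
  "Levi_roots G S =
     {\<alpha> \<in> abs_roots G. \<forall>x\<in>frakA G. (\<forall>\<beta>\<in>S. \<beta> x = 0) \<longrightarrow> \<alpha> x = 0}"

definition Levi_weyl_group ::
    "('v::ab_group_add, 'g, 'l) reductive_data \<Rightarrow> ('v \<Rightarrow> rat) set \<Rightarrow> ('v \<Rightarrow> 'v) set" where
  "Levi_weyl_group G S = generate (BijGroup UNIV) (abs_reflection G ` Levi_roots G S)"

text \<open>
  Two cocharacters of the maximal torus \<open>T\<close> are conjugate under the points of \<open>M\<^sub>S\<close> over the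
  algebraic closure iff they are conjugate under the absolute Weyl group of \<open>M\<^sub>S\<close>.
\<close>

definition Levi_conjugate ::
    "('v::ab_group_add, 'g, 'l) reductive_data \<Rightarrow> ('v \<Rightarrow> rat) set \<Rightarrow> 'v \<Rightarrow> 'v \<Rightarrow> bool" where
  "Levi_conjugate G S \<mu> \<mu>' \<longleftrightarrow> (\<exists>w\<in>Levi_weyl_group G S. w \<mu> = \<mu>')"

definition rel_Levi_weyl_group ::
    "('v::ab_group_add, 'g, 'l) reductive_data \<Rightarrow> ('v \<Rightarrow> rat) set \<Rightarrow> ('v \<Rightarrow> 'v) set" where
  "rel_Levi_weyl_group G S = generate (BijGroup (frakA G)) (rel_reflection G ` S)"

definition theta ::
    "('v::ab_group_add, 'g, 'l) reductive_data \<Rightarrow> ('v \<Rightarrow> rat) set \<Rightarrow> 'v \<Rightarrow> 'v" where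
  "theta G S \<mu> = scaleQ G (1 / of_nat (card (rel_Levi_weyl_group G S)))
     (\<Sum>\<sigma>\<in>rel_Levi_weyl_group G S. \<sigma> (Gal_average G \<mu>))"


subsection \<open>Cocharacter pairs\<close>

type_synonym 'v cochar_pair = "('v \<Rightarrow> rat) set \<times> 'v"

definition cochar_pairs ::
    "('v::ab_group_add, 'g, 'l) reductive_data \<Rightarrow> 'v cochar_pair set" where
  "cochar_pairs G = {(S, \<mu>). S \<subseteq> Delta G \<and> \<mu> \<in> cocharacters G \<and>
     (\<forall>\<alpha> \<in> Levi_roots G S \<inter> abs_pos_roots G. 0 \<le> \<alpha> \<mu>)}"

text \<open>The pair \<open>((S\<^sub>2, \<mu>\<^sub>2), (S\<^sub>1, \<mu>\<^sub>1))\<close> is in the relation if the first component is the smaller.\<close>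

definition elementary_step ::
    "('v::ab_group_add, 'g, 'l) reductive_data \<Rightarrow> 'v cochar_pair rel" where
  "elementary_step G = {((S2, \<mu>2), (S1, \<mu>1)).
     (S2, \<mu>2) \<in> cochar_pairs G \<and> (S1, \<mu>1) \<in> cochar_pairs G \<and>
     S2 \<subseteq> S1 \<and> card (S1 - S2) = 1 \<and>
     Levi_conjugate G S1 \<mu>2 \<mu>1 \<and> prec G (theta G S1 \<mu>1) (theta G S2 \<mu>2)}"

definition cochar_le ::
    "('v::ab_group_add, 'g, 'l) reductive_data \<Rightarrow> 'v cochar_pair \<Rightarrow> 'v cochar_pair \<Rightarrow> bool" where
  "cochar_le G p q \<longleftrightarrow>
     p \<in> cochar_pairs G \<and> q \<in> cochar_pairs G \<and> (p, q) \<in> (elementary_step G)\<^sup>*"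

definition strictly_decreasing ::
    "('v::ab_group_add, 'g, 'l) reductive_data \<Rightarrow> 'v cochar_pair \<Rightarrow> bool" where
  "strictly_decreasing G p \<longleftrightarrow>
     p \<in> cochar_pairs G \<and> theta G (fst p) (snd p) \<in> frakA_Levi_pos G (fst p)"

definition SD :: "('v::ab_group_add, 'g, 'l) reductive_data \<Rightarrow> 'v \<Rightarrow> 'v cochar_pair set" where
  "SD G \<mu> = {p. strictly_decreasing G p \<and> cochar_le G p (Delta G, \<mu>)}"


subsection \<open>The dual group\<close>

text \<open>
  The complex points of the dual torus are the homomorphisms from \<open>X\<^sub>*(T)\<close> to the
  multiplicative group, and a cocharacter of \<open>T\<close> is a character of the dual torus by
  evaluation. The roots of the dual group are the coroots of \<open>G\<close>, and its center is the common
  kernel of its roots in the dual torus.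
\<close>

definition dual_torus :: "('v::ab_group_add, 'g, 'l) reductive_data \<Rightarrow> ('v \<Rightarrow> complex) set" where
  "dual_torus G = {t \<in> extensional (cocharacters G).
     (\<forall>x\<in>cocharacters G. t x \<noteq> 0) \<and>
     (\<forall>x\<in>cocharacters G. \<forall>y\<in>cocharacters G. t (x + y) = t x * t y)}"

definition dual_center_inv ::
    "('v::ab_group_add, 'g, 'l) reductive_data \<Rightarrow> ('v \<Rightarrow> complex) set" where
  "dual_center_inv G = {t \<in> dual_torus G. (\<forall>\<alpha>\<in>abs_roots G. t (coroot G \<alpha>) = 1) \<and>
     (\<forall>\<gamma>\<in>carrier (Gal G). \<forall>x\<in>cocharacters G. t (act G \<gamma> x) = t x)}"

definition dual_restrict ::
    "('v::ab_group_add, 'g, 'l) reductive_data \<Rightarrow> 'v \<Rightarrow> ('v \<Rightarrow> complex) \<Rightarrow> complex" where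
  "dual_restrict G \<mu> = (\<lambda>t\<in>dual_center_inv G. t \<mu>)"


subsection \<open>Isocrystals with additional structure\<close>

definition sigma_class :: "('v::ab_group_add, 'g, 'l) reductive_data \<Rightarrow> 'l \<Rightarrow> 'l set" where
  "sigma_class G b =
     {g \<otimes>\<^bsub>points G\<^esub> b \<otimes>\<^bsub>points G\<^esub> inv\<^bsub>points G\<^esub> (frob G g) | g. g \<in> carrier (points G)}"

definition Kottwitz_set :: "('v::ab_group_add, 'g, 'l) reductive_data \<Rightarrow> 'l set set" where
  "Kottwitz_set G = sigma_class G ` carrier (points G)"

text \<open>
  The last two assumptions are Kottwitz's description of the image of \<open>(\<nu>, \<kappa>)\<close>: each \<open>b\<close> comes
  from a basic element of its Levi subgroup \<open>M\<^sub>b\<close>, whose class is given by a character of the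
  Galois invariants of the center of the dual group of \<open>M\<^sub>b\<close>. Such a character is the
  restriction of a cocharacter of \<open>T\<close>, which can be taken dominant for \<open>M\<^sub>b\<close>.
\<close>

locale quasisplit_group = quasisplit_root_datum G
  for G :: "('v::ab_group_add, 'g, 'l) reductive_data" +
  assumes points_group: "group (points G)"
    and frob_automorphism: "frob G \<in> iso (points G) (points G)"
    and newton_dominant: "b \<in> Kottwitz_set G
          \<Longrightarrow> newton G b \<in> frakA G \<and> (\<forall>\<alpha>\<in>Delta G. 0 \<le> \<alpha> (newton G b))"
    and kottwitz_character: "b \<in> Kottwitz_set G
          \<Longrightarrow> kottwitz G b \<in> dual_restrict G ` cocharacters G"
    and newton_kottwitz_inj: "\<lbrakk>b \<in> Kottwitz_set G; b' \<in> Kottwitz_set G;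
          newton G b = newton G b'; kottwitz G b = kottwitz G b'\<rbrakk> \<Longrightarrow> b = b'"
    and newton_kottwitz_exists: "strictly_decreasing G (S, \<mu>)
          \<Longrightarrow> \<exists>b\<in>Kottwitz_set G. newton G b = theta G S \<mu> \<and> kottwitz G b = dual_restrict G \<mu>"
    and newton_kottwitz_image: "b \<in> Kottwitz_set G
          \<Longrightarrow> \<exists>S \<mu>. strictly_decreasing G (S, \<mu>) \<and>
                newton G b = theta G S \<mu> \<and> kottwitz G b = dual_restrict G \<mu>"

definition BGmu :: "('v::ab_group_add, 'g, 'l) reductive_data \<Rightarrow> 'v \<Rightarrow> 'l set set" where
  "BGmu G \<mu> = {b \<in> Kottwitz_set G.
     prec_eq G (newton G b) (Gal_average G \<mu>) \<and> kottwitz G b = dual_restrict G \<mu>}"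

definition Levi_of ::
    "('v::ab_group_add, 'g, 'l) reductive_data \<Rightarrow> 'l set \<Rightarrow> ('v \<Rightarrow> rat) set" where
  "Levi_of G b = (THE S. S \<subseteq> Delta G \<and> newton G b \<in> frakA_Levi G S)"

definition Tmap :: "('v::ab_group_add, 'g, 'l) reductive_data \<Rightarrow> 'v cochar_pair \<Rightarrow> 'l set" where
  "Tmap G p = (THE b. b \<in> Kottwitz_set G \<and>
     kottwitz G b = dual_restrict G (snd p) \<and> newton G b = theta G (fst p) (snd p))"

definition Tset ::
    "('v::ab_group_add, 'g, 'l) reductive_data \<Rightarrow> 'l set \<Rightarrow> 'v \<Rightarrow> 'v cochar_pair set" where
  "Tset G b \<mu> = {p \<in> SD G \<mu>. Tmap G p = b}"

definition Rset ::
    "('v::ab_group_add, 'g, 'l) reductive_data \<Rightarrow> 'l set \<Rightarrow> 'v \<Rightarrow> 'v cochar_pair set" where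
  "Rset G b \<mu> = {p \<in> cochar_pairs G. \<exists>q\<in>Tset G b \<mu>. cochar_le G p q}"

definition Msum ::
    "('v::ab_group_add, 'g, 'l) reductive_data \<Rightarrow> 'l set \<Rightarrow> 'v \<Rightarrow> 'v cochar_pair \<Rightarrow>\<^sub>0 int" where
  "Msum G b \<mu> =
     (\<Sum>(S, \<mu>S)\<in>Rset G b \<mu>. frag_cmul ((-1) ^ card (Levi_of G b - S)) (frag_of (S, \<mu>S)))"

end

theory Submission
  imports Defs
begin

text \<open>
  Fix a pair \<open>(M\<^sub>S, \<nu>)\<close> and put \<open>x = \<nu>\<^sup>\<Gamma>\<close>. Every pair above it with first component \<open>M\<^sub>T\<close> has second
  component the \<open>M\<^sub>T\<close>-dominant conjugate of \<open>\<nu>\<close>, and its \<open>\<theta>\<close> is the projection \<open>x\<^sub>T\<close> of \<open>x\<close> along the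
  coroots in \<open>T\<close>. So the pairs above \<open>(M\<^sub>S, \<nu>)\<close> are the sets reachable from \<open>S\<close> by the steps
  \<open>T \<rightarrow> T \<union> {\<alpha>}\<close> with \<open>\<langle>x\<^sub>T, \<alpha>\<rangle> > 0\<close>. Since distinct simple roots pair non-positively with each other's
  coroots, adding one allowed root leaves the others allowed: the reachable sets form an
  antimatroid. A pair is strictly decreasing iff every root outside it is allowed, and the
  alternating sum over these free sets vanishes unless \<open>S = \<Delta>\<close>. The coefficient of \<open>(M\<^sub>S, \<nu>)\<close> in the
  theorem is this sum, because \<open>\<T>\<close> is injective on the strictly decreasing pairs above \<open>(M\<^sub>S, \<nu>)\<close>.
\<close>

section \<open>Root systems with a base\<close>

lemma (in vector_space) prescribed_functionals:
  fixes D :: "('b \<Rightarrow> 'a) set"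
  assumes "finite D"
    and add: "\<And>\<beta> x y. \<beta> \<in> D \<Longrightarrow> \<beta> (x + y) = \<beta> x + \<beta> y"
    and scale: "\<And>\<beta> c x. \<beta> \<in> D \<Longrightarrow> \<beta> (c *s x) = c * \<beta> x"
    and independent: "\<And>c \<beta>. \<lbrakk>\<And>x. (\<Sum>\<beta>\<in>D. c \<beta> * \<beta> x) = 0; \<beta> \<in> D\<rbrakk> \<Longrightarrow> c \<beta> = 0"
  shows "\<exists>x. \<forall>\<beta>\<in>D. \<beta> x = f \<beta>"
  using assms
proof (induction D arbitrary: f rule: finite_induct)
  case (insert \<beta> D)
  have IH: "\<exists>x. \<forall>\<beta>\<in>D. \<beta> x = f \<beta>" for f
  proof (rule insert.IH)
    fix c \<gamma>
    assume c: "\<And>x. (\<Sum>\<beta>\<in>D. c \<beta> * \<beta> x) = 0" and \<gamma>: "\<gamma> \<in> D"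
    have "(\<Sum>\<beta>'\<in>insert \<beta> D. (c(\<beta> := 0)) \<beta>' * \<beta>' x) = 0" for x
    proof -
      have "(\<Sum>\<beta>'\<in>D. (c(\<beta> := 0)) \<beta>' * \<beta>' x) = (\<Sum>\<beta>\<in>D. c \<beta> * \<beta> x)"
        using insert.hyps by (intro sum.cong) auto
      then show ?thesis using insert.hyps c by simp
    qed
    from insert.prems(3)[OF this, of \<gamma>] \<gamma> insert.hyps show "c \<gamma> = 0" by (auto split: if_splits)
  qed (use insert.prems in auto)
  then have "\<forall>\<gamma>. \<exists>x. \<forall>\<delta>\<in>D. \<delta> x = (if \<delta> = \<gamma> then 1 else 0)" by (intro allI)
  from choice[OF this] obtain e where e: "\<forall>\<gamma>. \<forall>\<delta>\<in>D. \<delta> (e \<gamma>) = (if \<delta> = \<gamma> then 1 else 0)" by blast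
  have sum: "\<gamma> (\<Sum>i\<in>I. g i) = (\<Sum>i\<in>I. \<gamma> (g i))" if "\<gamma> \<in> insert \<beta> D" "finite I"
    for \<gamma> and g :: "('b \<Rightarrow> 'a) \<Rightarrow> 'b" and I
  proof -
    have "\<gamma> 0 + 0 = \<gamma> 0 + \<gamma> 0" using insert.prems(1)[OF that(1), of 0 0] by (simp only: add_0_left add_0_right)
    then have z: "\<gamma> 0 = 0" by (simp only: add_left_cancel)
    show ?thesis using that(2) by induction (auto simp: z insert.prems(1)[OF that(1)])
  qed
  have diff: "\<gamma> (x - y) = \<gamma> x - \<gamma> y" if "\<gamma> \<in> insert \<beta> D" for \<gamma> x y
    using insert.prems(1)[OF that, of "x - y" y] by simp
  have "\<exists>x. \<beta> x \<noteq> (\<Sum>\<gamma>\<in>D. \<beta> (e \<gamma>) * \<gamma> x)"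
  proof (rule ccontr)
    assume *: "\<not> ?thesis"
    define c where "c = (\<lambda>\<gamma>. if \<gamma> = \<beta> then 1 else - \<beta> (e \<gamma>))"
    have "(\<Sum>\<gamma>\<in>insert \<beta> D. c \<gamma> * \<gamma> x) = 0" for x
    proof -
      have "(\<Sum>\<gamma>\<in>D. c \<gamma> * \<gamma> x) = (\<Sum>\<gamma>\<in>D. - \<beta> (e \<gamma>) * \<gamma> x)"
        using insert.hyps by (intro sum.cong) (auto simp: c_def)
      moreover have "(\<Sum>\<gamma>\<in>D. \<beta> (e \<gamma>) * \<gamma> x) = \<beta> x" using * by metis
      ultimately show ?thesis using insert.hyps by (simp add: c_def sum_negf)
    qed
    from insert.prems(3)[OF this, of \<beta>] show False by (simp add: c_def)
  qed
  then obtain x where x: "\<beta> x \<noteq> (\<Sum>\<gamma>\<in>D. \<beta> (e \<gamma>) * \<gamma> x)" by blast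
  define y where "y = x - (\<Sum>\<gamma>\<in>D. \<gamma> x *s e \<gamma>)"
  have yD: "\<gamma> y = 0" if "\<gamma> \<in> D" for \<gamma>
  proof -
    have "\<gamma> y = \<gamma> x - (\<Sum>\<delta>\<in>D. \<delta> x * \<gamma> (e \<delta>))"
      using that insert.hyps insert.prems(2) by (simp add: y_def diff sum)
    also have "(\<Sum>\<delta>\<in>D. \<delta> x * \<gamma> (e \<delta>)) = (\<Sum>\<delta>\<in>D. if \<delta> = \<gamma> then \<gamma> x else 0)"
      using bspec[OF spec[OF e] that] by (intro sum.cong) simp_all
    finally show ?thesis using that insert.hyps by simp
  qed
  have yb: "\<beta> y \<noteq> 0"
    using x insert.hyps insert.prems(2) by (simp add: y_def diff sum mult.commute)
  obtain z where z: "\<forall>\<beta>\<in>D. \<beta> z = f \<beta>" using IH by blast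
  have "\<gamma> (z + ((f \<beta> - \<beta> z) / \<beta> y) *s y) = f \<gamma>" if \<gamma>: "\<gamma> \<in> insert \<beta> D" for \<gamma>
    using \<gamma> bspec[OF z, of \<gamma>] yD[of \<gamma>] yb insert.prems(1)[OF \<gamma>] insert.prems(2)[OF \<gamma>]
    by (cases "\<gamma> = \<beta>") auto
  then show ?case by blast
qed simp

lemma (in vector_space) finite_progression:
  assumes "finite S" "\<And>n. c + of_nat n *s d \<in> S" and "inj (of_nat :: nat \<Rightarrow> 'a)"
  shows "d = 0"
proof -
  have "\<not> inj (\<lambda>n. c + of_nat n *s d)"
    using range_inj_infinite[of "\<lambda>n. c + of_nat n *s d"] finite_subset[OF image_subsetI assms(1)] assms(2) by metis
  then obtain m n where "m \<noteq> n" "of_nat m *s d = of_nat n *s d" by (auto simp: inj_def)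
  then show ?thesis using injD[OF assms(3)] by (auto simp: scale_cancel_right)
qed

definition positive_roots :: "('v \<Rightarrow> rat) set \<Rightarrow> ('v \<Rightarrow> rat) set \<Rightarrow> ('v \<Rightarrow> rat) set" where
  "positive_roots \<Phi> \<Delta> =
     {\<alpha> \<in> \<Phi>. \<exists>n :: ('v \<Rightarrow> rat) \<Rightarrow> nat. \<alpha> = (\<lambda>x. \<Sum>\<beta>\<in>\<Delta>. of_nat (n \<beta>) * \<beta> x)}"

locale root_base = vector_space scale
  for scale :: "rat \<Rightarrow> 'v::ab_group_add \<Rightarrow> 'v" (infixr \<open>*s\<close> 75) +
  fixes \<Phi> :: "('v \<Rightarrow> rat) set" and cr :: "('v \<Rightarrow> rat) \<Rightarrow> 'v" and \<Delta> :: "('v \<Rightarrow> rat) set"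
  assumes finite_roots: "finite \<Phi>"
    and root_add: "\<alpha> \<in> \<Phi> \<Longrightarrow> \<alpha> (x + y) = \<alpha> x + \<alpha> y"
    and root_scale: "\<alpha> \<in> \<Phi> \<Longrightarrow> \<alpha> (a *s x) = a * \<alpha> x"
    and root_integral: "\<lbrakk>\<alpha> \<in> \<Phi>; \<beta> \<in> \<Phi>\<rbrakk> \<Longrightarrow> \<alpha> (cr \<beta>) \<in> \<int>"
    and root_two: "\<alpha> \<in> \<Phi> \<Longrightarrow> \<alpha> (cr \<alpha>) = 2"
    and root_reflect: "\<lbrakk>\<alpha> \<in> \<Phi>; \<beta> \<in> \<Phi>\<rbrakk> \<Longrightarrow> (\<lambda>x. \<beta> x - \<beta> (cr \<alpha>) * \<alpha> x) \<in> \<Phi>"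
    and coroot_reflect: "\<lbrakk>\<alpha> \<in> \<Phi>; \<beta> \<in> \<Phi>\<rbrakk>
          \<Longrightarrow> cr (\<lambda>x. \<beta> x - \<beta> (cr \<alpha>) * \<alpha> x) = cr \<beta> - \<alpha> (cr \<beta>) *s cr \<alpha>"
    and root_reduced: "\<alpha> \<in> \<Phi> \<Longrightarrow> (\<lambda>x. 2 * \<alpha> x) \<notin> \<Phi>"
    and base_roots: "\<Delta> \<subseteq> \<Phi>"
    and base_independent: "\<lbrakk>\<And>x. (\<Sum>\<beta>\<in>\<Delta>. c \<beta> * \<beta> x) = 0; \<beta> \<in> \<Delta>\<rbrakk> \<Longrightarrow> c \<beta> = 0"
    and root_sign: "\<alpha> \<in> \<Phi>
          \<Longrightarrow> \<alpha> \<in> positive_roots \<Phi> \<Delta> \<or> (\<lambda>x. - \<alpha> x) \<in> positive_roots \<Phi> \<Delta>"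
begin

abbreviation pos :: "('v \<Rightarrow> rat) set" where "pos \<equiv> positive_roots \<Phi> \<Delta>"

definition refl :: "('v \<Rightarrow> rat) \<Rightarrow> 'v \<Rightarrow> 'v" where
  "refl \<alpha> x = x - \<alpha> x *s cr \<alpha>"

definition word :: "('v \<Rightarrow> rat) list \<Rightarrow> 'v \<Rightarrow> 'v" where
  "word bs = foldr (\<lambda>\<beta> f. refl \<beta> \<circ> f) bs id"

definition weyl :: "('v \<Rightarrow> 'v) set" where "weyl = word ` lists \<Delta>"

definition dominant :: "'v \<Rightarrow> bool" where "dominant x \<longleftrightarrow> (\<forall>\<beta>\<in>\<Delta>. 0 \<le> \<beta> x)"

definition coroot_cone :: "'v set" where
  "coroot_cone = {y. \<exists>c. (\<forall>\<beta>\<in>\<Delta>. (0::rat) \<le> c \<beta>) \<and> y = (\<Sum>\<beta>\<in>\<Delta>. c \<beta> *s cr \<beta>)}"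

lemma finite_base: "finite \<Delta>"
  using base_roots finite_roots finite_subset by blast

lemma base_root: "\<beta> \<in> \<Delta> \<Longrightarrow> \<beta> \<in> \<Phi>"
  using base_roots by blast

lemma pos_root: "\<alpha> \<in> pos \<Longrightarrow> \<alpha> \<in> \<Phi>"
  by (simp add: positive_roots_def)

lemma root_zero: "\<alpha> \<in> \<Phi> \<Longrightarrow> \<alpha> 0 = 0"
  using root_add[of \<alpha> 0 0] by simp

lemma root_diff: "\<alpha> \<in> \<Phi> \<Longrightarrow> \<alpha> (x - y) = \<alpha> x - \<alpha> y"
  using root_add[of \<alpha> "x - y" y] by simp

lemma root_minus: "\<alpha> \<in> \<Phi> \<Longrightarrow> \<alpha> (- x) = - \<alpha> x"
  using root_diff[of \<alpha> 0 x] root_zero[of \<alpha>] by simp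

lemma root_sum: "\<alpha> \<in> \<Phi> \<Longrightarrow> \<alpha> (\<Sum>i\<in>I. f i) = (\<Sum>i\<in>I. \<alpha> (f i))"
  by (induction I rule: infinite_finite_induct) (auto simp: root_zero root_add)

lemma refl_add: "\<alpha> \<in> \<Phi> \<Longrightarrow> refl \<alpha> (x + y) = refl \<alpha> x + refl \<alpha> y"
  by (simp add: refl_def root_add scale_left_distrib)

lemma refl_scale: "\<alpha> \<in> \<Phi> \<Longrightarrow> refl \<alpha> (c *s x) = c *s refl \<alpha> x"
  by (simp add: refl_def root_scale scale_right_diff_distrib)

lemma refl_refl: "\<alpha> \<in> \<Phi> \<Longrightarrow> refl \<alpha> (refl \<alpha> x) = x"
  by (simp add: refl_def root_diff root_scale root_two scale_left_diff_distrib)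

lemma refl_o_refl: "\<alpha> \<in> \<Phi> \<Longrightarrow> refl \<alpha> \<circ> refl \<alpha> = id"
  by (auto simp: refl_refl)

lemma root_o_refl: "\<lbrakk>\<alpha> \<in> \<Phi>; \<beta> \<in> \<Phi>\<rbrakk> \<Longrightarrow> \<beta> \<circ> refl \<alpha> = (\<lambda>x. \<beta> x - \<beta> (cr \<alpha>) * \<alpha> x)"
  by (auto simp: refl_def root_diff root_scale)

lemma root_refl: "\<lbrakk>\<alpha> \<in> \<Phi>; \<beta> \<in> \<Phi>\<rbrakk> \<Longrightarrow> \<beta> \<circ> refl \<alpha> \<in> \<Phi>"
  by (simp add: root_o_refl root_reflect)

lemma coroot_refl: "\<lbrakk>\<alpha> \<in> \<Phi>; \<beta> \<in> \<Phi>\<rbrakk> \<Longrightarrow> cr (\<beta> \<circ> refl \<alpha>) = refl \<alpha> (cr \<beta>)"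
  by (simp add: root_o_refl coroot_reflect refl_def)

lemma refl_diff: "\<alpha> \<in> \<Phi> \<Longrightarrow> refl \<alpha> (x - y) = refl \<alpha> x - refl \<alpha> y"
  using refl_add[of \<alpha> "x - y" y] by simp

lemma refl_conj:
  assumes "\<alpha> \<in> \<Phi>" "\<beta> \<in> \<Phi>"
  shows "refl (\<beta> \<circ> refl \<alpha>) = refl \<alpha> \<circ> refl \<beta> \<circ> refl \<alpha>"
proof
  fix x
  have "refl \<alpha> (refl \<beta> (refl \<alpha> x)) = refl \<alpha> (refl \<alpha> x - \<beta> (refl \<alpha> x) *s cr \<beta>)"
    by (simp add: refl_def)
  also have "\<dots> = x - \<beta> (refl \<alpha> x) *s refl \<alpha> (cr \<beta>)"
    using assms by (simp add: refl_diff refl_scale refl_refl)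
  also have "\<dots> = refl (\<beta> \<circ> refl \<alpha>) x"
    unfolding refl_def[of "\<beta> \<circ> refl \<alpha>"] using assms by (simp add: coroot_refl)
  finally show "refl (\<beta> \<circ> refl \<alpha>) x = (refl \<alpha> \<circ> refl \<beta> \<circ> refl \<alpha>) x" by simp
qed

lemma refl_coroot: "\<alpha> \<in> \<Phi> \<Longrightarrow> refl \<alpha> (cr \<alpha>) = - cr \<alpha>"
proof -
  assume "\<alpha> \<in> \<Phi>"
  then have "refl \<alpha> (cr \<alpha>) = cr \<alpha> - (1 + 1) *s cr \<alpha>" by (simp add: refl_def root_two)
  then show ?thesis by (simp only: scale_left_distrib scale_one) simp
qed

lemma root_neg: "\<alpha> \<in> \<Phi> \<Longrightarrow> (\<lambda>x. - \<alpha> x) \<in> \<Phi>"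
  using root_reflect[of \<alpha> \<alpha>] by (simp add: root_two)

subsection \<open>Positivity\<close>

lemma prescribed_values: "\<exists>x. \<forall>\<beta>\<in>\<Delta>. \<beta> x = f \<beta>"
proof (rule prescribed_functionals[OF finite_base])
  show "c \<beta> = 0" if "\<And>x. (\<Sum>\<beta>\<in>\<Delta>. c \<beta> * \<beta> x) = 0" "\<beta> \<in> \<Delta>" for c \<beta>
    using base_independent[OF that] .
qed (simp_all add: base_root root_add root_scale)

lemma dual_base:
  assumes "\<beta> \<in> \<Delta>"
  obtains x where "\<beta> x = 1" "\<forall>\<gamma>\<in>\<Delta> - {\<beta>}. \<gamma> x = 0" "dominant x"
proof -
  obtain x where x: "\<forall>\<gamma>\<in>\<Delta>. \<gamma> x = (if \<gamma> = \<beta> then 1 else 0)"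
    using prescribed_values[of "\<lambda>\<gamma>. if \<gamma> = \<beta> then 1 else 0"] by blast
  have "\<beta> x = 1" using bspec[OF x assms] by simp
  moreover have "\<gamma> x = 0" if "\<gamma> \<in> \<Delta> - {\<beta>}" for \<gamma> using bspec[OF x, of \<gamma>] that by simp
  moreover have "0 \<le> \<gamma> x" if "\<gamma> \<in> \<Delta>" for \<gamma> using bspec[OF x that] by simp
  ultimately show ?thesis using that[of x] unfolding dominant_def by blast
qed

lemma pos_nonneg: "\<lbrakk>\<alpha> \<in> pos; dominant x\<rbrakk> \<Longrightarrow> 0 \<le> \<alpha> x"
  by (auto simp: positive_roots_def dominant_def intro!: sum_nonneg)

lemma root_nonzero: "\<alpha> \<in> \<Phi> \<Longrightarrow> \<alpha> \<noteq> (\<lambda>x. 0)"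
  using root_two by force

lemma pos_strict:
  assumes "\<alpha> \<in> pos" "\<And>\<beta>. \<beta> \<in> \<Delta> \<Longrightarrow> 0 < \<beta> x"
  shows "0 < \<alpha> x"
proof -
  obtain n :: "_ \<Rightarrow> nat" where n: "\<alpha> = (\<lambda>x. \<Sum>\<beta>\<in>\<Delta>. of_nat (n \<beta>) * \<beta> x)"
    using assms(1) by (auto simp: positive_roots_def)
  have "\<exists>\<beta>\<in>\<Delta>. n \<beta> \<noteq> 0"
    using root_nonzero[OF pos_root[OF assms(1)]] n by (auto intro!: ext)
  then obtain \<beta> where \<beta>: "\<beta> \<in> \<Delta>" "n \<beta> \<noteq> 0" by blast
  have "0 < of_nat (n \<beta>) * \<beta> x" using \<beta> assms(2) by simp
  also have "\<dots> \<le> (\<Sum>\<beta>\<in>\<Delta>. of_nat (n \<beta>) * \<beta> x)"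
    using \<beta> assms(2) finite_base by (intro member_le_sum) (auto simp: less_imp_le)
  finally show ?thesis by (simp add: n)
qed

lemma regular_exists:
  obtains h where "\<And>\<beta>. \<beta> \<in> \<Delta> \<Longrightarrow> \<beta> h = 1" "\<And>\<beta>. \<beta> \<in> \<Delta> \<Longrightarrow> 0 < \<beta> h"
proof -
  obtain h where "\<forall>\<beta>\<in>\<Delta>. \<beta> h = 1" using prescribed_values[of "\<lambda>_. 1"] by blast
  moreover from this have "0 < \<beta> h" if "\<beta> \<in> \<Delta>" for \<beta> using that by auto
  ultimately show ?thesis using that[of h] by blast
qed

lemma pos_iff:
  assumes "\<alpha> \<in> \<Phi>" "\<And>\<beta>. \<beta> \<in> \<Delta> \<Longrightarrow> 0 < \<beta> h"
  shows "\<alpha> \<in> pos \<longleftrightarrow> 0 < \<alpha> h"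
proof -
  have "0 < \<alpha> h" if "\<alpha> \<in> pos" using pos_strict[OF that, of h] assms(2) by blast
  moreover have "\<alpha> h < 0" if "(\<lambda>x. - \<alpha> x) \<in> pos" using pos_strict[OF that, of h] assms(2) by simp
  ultimately show ?thesis using root_sign[OF assms(1)] by fastforce
qed

lemma not_pos_neg: "\<lbrakk>\<alpha> \<in> \<Phi>; \<alpha> \<notin> pos\<rbrakk> \<Longrightarrow> (\<lambda>x. - \<alpha> x) \<in> pos"
  using root_sign by blast

lemma pos_neg_not: "\<alpha> \<in> pos \<Longrightarrow> (\<lambda>x. - \<alpha> x) \<notin> pos"
proof
  assume a: "\<alpha> \<in> pos" "(\<lambda>x. - \<alpha> x) \<in> pos"
  obtain h where h: "\<And>\<beta>. \<beta> \<in> \<Delta> \<Longrightarrow> \<beta> h = 1" and hp: "\<And>\<beta>. \<beta> \<in> \<Delta> \<Longrightarrow> 0 < \<beta> h"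
    using regular_exists by blast
  show False using pos_strict[OF a(1), of h] pos_strict[OF a(2), of h] hp by simp
qed

lemma base_pos: "\<beta> \<in> \<Delta> \<Longrightarrow> \<beta> \<in> pos"
proof -
  assume b: "\<beta> \<in> \<Delta>"
  obtain h where h: "\<And>\<beta>. \<beta> \<in> \<Delta> \<Longrightarrow> \<beta> h = 1" and hp: "\<And>\<beta>. \<beta> \<in> \<Delta> \<Longrightarrow> 0 < \<beta> h"
    using regular_exists by blast
  show ?thesis using pos_iff[OF base_root[OF b] hp] hp[OF b] by simp
qed

lemma pos_multiple_base:
  assumes "\<gamma> \<in> pos" "\<beta> \<in> \<Delta>" "\<gamma> = (\<lambda>x. of_nat n * \<beta> x)"
  shows "\<gamma> = \<beta>"
proof -
  have \<gamma>: "\<gamma> \<in> \<Phi>" "\<beta> \<in> \<Phi>" using assms pos_root base_root by auto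
  obtain k where k: "\<beta> (cr \<gamma>) = of_int k" using root_integral[OF \<gamma>(2,1)] Ints_cases by blast
  have "(of_nat n :: rat) * of_int k = 2" using root_two[OF \<gamma>(1)] fun_cong[OF assms(3), of "cr \<gamma>"] k by simp
  then have "(of_int (int n * k) :: rat) = of_int 2" by simp
  then have nk: "int n * k = 2" by (simp only: of_int_eq_iff)
  then have "int n dvd 2" by (metis dvd_triv_left)
  then have "int n \<le> 2" by (rule zdvd_imp_le) simp
  moreover have "n \<noteq> 0" using nk by (intro notI) simp
  moreover have "n \<noteq> 2" using root_reduced[OF \<gamma>(2)] assms(3) \<gamma>(1) by auto
  ultimately have "n = 1" by linarith
  then show ?thesis using assms(3) by simp
qed

lemma pos_expansion:
  assumes "\<alpha> \<in> pos"
  obtains n :: "('v \<Rightarrow> rat) \<Rightarrow> nat" where "\<alpha> = (\<lambda>x. \<Sum>\<beta>\<in>\<Delta>. of_nat (n \<beta>) * \<beta> x)"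
    and "\<And>\<delta> x. \<lbrakk>\<delta> \<in> \<Delta>; \<delta> x = 1; \<forall>\<gamma>\<in>\<Delta> - {\<delta>}. \<gamma> x = 0\<rbrakk> \<Longrightarrow> \<alpha> x = of_nat (n \<delta>)"
proof -
  obtain n :: "_ \<Rightarrow> nat" where n: "\<alpha> = (\<lambda>x. \<Sum>\<beta>\<in>\<Delta>. of_nat (n \<beta>) * \<beta> x)"
    using assms(1) by (auto simp: positive_roots_def)
  have "\<alpha> x = of_nat (n \<delta>)"
    if "\<delta> \<in> \<Delta>" "\<delta> x = 1" "\<forall>\<gamma>\<in>\<Delta> - {\<delta>}. \<gamma> x = 0" for \<delta> x
  proof -
    have "\<alpha> x = (\<Sum>\<beta>\<in>\<Delta>. if \<beta> = \<delta> then of_nat (n \<delta>) else 0)"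
      unfolding n using that by (intro sum.cong) auto
    then show ?thesis using that finite_base by simp
  qed
  then show ?thesis using that n by blast
qed

lemma pos_eq_simple:
  assumes "\<alpha> \<in> pos" "\<beta> \<in> \<Delta>"
    and le: "\<And>\<delta> x. \<lbrakk>\<delta> \<in> \<Delta>; \<delta> \<noteq> \<beta>; dominant x; \<beta> x = 0\<rbrakk> \<Longrightarrow> \<alpha> x \<le> 0"
  shows "\<alpha> = \<beta>"
proof -
  obtain n :: "_ \<Rightarrow> nat" where n: "\<alpha> = (\<lambda>x. \<Sum>\<beta>\<in>\<Delta>. of_nat (n \<beta>) * \<beta> x)"
    and val: "\<And>\<delta> x. \<lbrakk>\<delta> \<in> \<Delta>; \<delta> x = 1; \<forall>\<gamma>\<in>\<Delta> - {\<delta>}. \<gamma> x = 0\<rbrakk> \<Longrightarrow> \<alpha> x = of_nat (n \<delta>)"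
    using pos_expansion[OF assms(1)] by blast
  have "n \<delta> = 0" if \<delta>: "\<delta> \<in> \<Delta>" "\<delta> \<noteq> \<beta>" for \<delta>
  proof -
    obtain x where x: "\<delta> x = 1" "\<forall>\<gamma>\<in>\<Delta> - {\<delta>}. \<gamma> x = 0" "dominant x"
      using dual_base[OF \<delta>(1)] .
    have "\<alpha> x = of_nat (n \<delta>)" by (rule val[OF \<delta>(1) x(1,2)])
    moreover have "\<beta> x = 0" using bspec[OF x(2), of \<beta>] assms(2) \<delta> by auto
    ultimately show ?thesis using le[OF \<delta> x(3)] by simp
  qed
  then have "(\<Sum>\<delta>\<in>\<Delta>. of_nat (n \<delta>) * \<delta> x) = (\<Sum>\<delta>\<in>\<Delta>. if \<delta> = \<beta> then of_nat (n \<beta>) * \<beta> x else 0)" for x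
    by (intro sum.cong) auto
  then have "\<alpha> = (\<lambda>x. of_nat (n \<beta>) * \<beta> x)"
    unfolding n using assms(2) finite_base by (intro ext) simp
  then show ?thesis by (rule pos_multiple_base[OF assms(1,2)])
qed

lemma pos_refl_simple:
  assumes "\<gamma> \<in> pos" "\<beta> \<in> \<Delta>" "\<gamma> \<noteq> \<beta>"
  shows "\<gamma> \<circ> refl \<beta> \<in> pos"
proof (rule ccontr)
  assume neg: "\<gamma> \<circ> refl \<beta> \<notin> pos"
  have r: "\<gamma> \<in> \<Phi>" "\<beta> \<in> \<Phi>" using assms pos_root base_root by auto
  have "\<gamma> x \<le> 0" if "dominant x" "\<beta> x = 0" for x
    using pos_nonneg[OF not_pos_neg[OF root_refl[OF r(2,1)] neg] that(1)] that(2)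
    by (simp add: refl_def)
  then have "\<gamma> = \<beta>" by (intro pos_eq_simple[OF assms(1,2)]) auto
  with assms(3) show False by simp
qed

lemma base_coroot_nonpos:
  assumes "\<beta> \<in> \<Delta>" "\<gamma> \<in> \<Delta>" "\<gamma> \<noteq> \<beta>"
  shows "\<gamma> (cr \<beta>) \<le> 0"
proof -
  have r: "\<gamma> \<in> \<Phi>" "\<beta> \<in> \<Phi>" using assms base_root by auto
  obtain x where x: "\<beta> x = 1" "\<forall>\<gamma>\<in>\<Delta> - {\<beta>}. \<gamma> x = 0" "dominant x"
    using dual_base[OF assms(1)] .
  from pos_nonneg[OF pos_refl_simple[OF base_pos[OF assms(2)] assms(1,3)] x(3)]
  show ?thesis using x(1) bspec[OF x(2), of \<gamma>] assms(2,3) r by (simp add: root_o_refl)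
qed

subsection \<open>Words in the simple reflections\<close>

lemma word_Nil [simp]: "word [] = id"
  by (simp add: word_def)

lemma word_Cons [simp]: "word (\<beta> # bs) = refl \<beta> \<circ> word bs"
  by (simp add: word_def)

lemma word_append: "word (as @ bs) = word as \<circ> word bs"
  by (induction as) (auto simp: comp_assoc)

lemma word_root: "\<lbrakk>bs \<in> lists \<Delta>; \<alpha> \<in> \<Phi>\<rbrakk> \<Longrightarrow> \<alpha> \<circ> word bs \<in> \<Phi>"
proof (induction bs arbitrary: \<alpha>)
  case (Cons \<beta> bs)
  then have "\<alpha> \<circ> refl \<beta> \<in> \<Phi>" "bs \<in> lists \<Delta>" using root_refl base_root by auto
  from Cons.IH[OF this(2,1)] have "(\<alpha> \<circ> refl \<beta>) \<circ> word bs \<in> \<Phi>" .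
  then show ?case by (simp only: word_Cons comp_assoc)
qed simp

lemma word_rev: "bs \<in> lists \<Delta> \<Longrightarrow> word bs \<circ> word (rev bs) = id"
proof (induction bs)
  case (Cons \<beta> bs)
  have "word (\<beta> # bs) \<circ> word (rev (\<beta> # bs)) = refl \<beta> \<circ> (word bs \<circ> word (rev bs)) \<circ> refl \<beta>"
    by (simp add: word_append comp_assoc)
  moreover have "word bs \<circ> word (rev bs) = id" by (rule Cons.IH) (use Cons.prems in simp)
  moreover have "refl \<beta> \<circ> refl \<beta> = id" by (rule refl_o_refl[OF base_root]) (use Cons.prems in simp)
  ultimately show ?case by (simp only: comp_id)
qed simp

lemma exchange:
  assumes "bs \<in> lists \<Delta>" "\<beta> \<in> pos" "\<beta> \<circ> word bs \<notin> pos"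
  shows "\<exists>cs\<in>lists \<Delta>. length cs < length bs \<and> refl \<beta> \<circ> word bs = word cs"
  using assms
proof (induction bs arbitrary: \<beta>)
  case (Cons b bs)
  have b: "b \<in> \<Delta>" and bs: "bs \<in> lists \<Delta>" using Cons.hyps by auto
  have b': "b \<in> \<Phi>" using base_root[OF b] .
  show ?case
  proof (cases "\<beta> = b")
    case True
    have "refl \<beta> \<circ> word (b # bs) = (refl b \<circ> refl b) \<circ> word bs" by (simp add: True comp_assoc)
    also have "\<dots> = word bs" using b' by (simp add: refl_o_refl)
    finally show ?thesis using bs by (metis length_Cons lessI)
  next
    case False
    define \<gamma> where "\<gamma> = \<beta> \<circ> refl b"
    have \<gamma>: "\<gamma> \<in> pos" using pos_refl_simple[OF Cons.prems(1) b False] by (simp add: \<gamma>_def)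
    have "\<gamma> \<circ> word bs \<notin> pos" using Cons.prems(2) by (simp only: \<gamma>_def comp_assoc word_Cons not_False_eq_True)
    from Cons.IH[OF \<gamma> this] obtain cs where cs: "cs \<in> lists \<Delta>" "length cs < length bs"
      and eq: "refl \<gamma> \<circ> word bs = word cs" by blast
    have "refl b \<circ> refl \<gamma> = (refl b \<circ> refl b) \<circ> refl \<beta> \<circ> refl b"
      using refl_conj[OF b' pos_root[OF Cons.prems(1)]] by (simp add: \<gamma>_def comp_assoc)
    then have "refl b \<circ> refl \<gamma> = refl \<beta> \<circ> refl b" using b' by (simp add: refl_o_refl)
    then have "refl \<beta> \<circ> word (b # bs) = refl b \<circ> (refl \<gamma> \<circ> word bs)"
      by (metis comp_assoc word_Cons)
    then have "refl \<beta> \<circ> word (b # bs) = word (b # cs)" by (simp only: eq word_Cons)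
    moreover have "b # cs \<in> lists \<Delta>" "length (b # cs) < length (b # bs)" using cs b by auto
    ultimately show ?thesis by blast
  qed
qed auto

lemma word_id:
  assumes "bs \<in> lists \<Delta>" "\<And>\<beta>. \<beta> \<in> \<Delta> \<Longrightarrow> \<beta> \<circ> word bs \<in> pos"
  shows "word bs = id"
  using assms
proof (induction "length bs" arbitrary: bs rule: less_induct)
  case less
  show ?case
  proof (cases bs)
    case (Cons b us)
    have b: "b \<in> \<Delta>" "b \<in> \<Phi>" and us: "us \<in> lists \<Delta>" using less.prems(1) base_root Cons by auto
    have "b \<circ> word bs = (\<lambda>x. - (b \<circ> word us) x)"
      using b by (auto simp: Cons refl_def root_diff root_scale root_two)
    then have "b \<circ> word us \<notin> pos" using less.prems(2)[OF b(1)] pos_neg_not by force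
    from exchange[OF us base_pos[OF b(1)] this] obtain cs
      where "cs \<in> lists \<Delta>" "length cs < length us" "word bs = word cs" by (auto simp: Cons)
    then show ?thesis using less.hyps[of cs] less.prems(2) by (simp add: Cons)
  qed simp
qed

lemma word_dominant_unique:
  assumes "bs \<in> lists \<Delta>" "dominant x" "dominant (word bs x)"
  shows "word bs x = x"
  using assms
proof (induction "length bs" arbitrary: bs rule: less_induct)
  case less
  show ?case
  proof (cases "\<exists>\<beta>\<in>\<Delta>. \<beta> \<circ> word bs \<notin> pos")
    case True
    then obtain \<beta> where \<beta>: "\<beta> \<in> \<Delta>" "\<beta> \<circ> word bs \<notin> pos" by blast
    obtain cs where cs: "cs \<in> lists \<Delta>" "length cs < length bs" "refl \<beta> \<circ> word bs = word cs"
      using exchange[OF less.prems(1) base_pos[OF \<beta>(1)] \<beta>(2)] by blast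
    have "0 \<le> - (\<beta> \<circ> word bs) x"
      using pos_nonneg[OF not_pos_neg[OF word_root[OF less.prems(1) base_root[OF \<beta>(1)]] \<beta>(2)] less.prems(2)]
      by simp
    moreover have "0 \<le> \<beta> (word bs x)" using less.prems(3) \<beta>(1) by (simp add: dominant_def)
    ultimately have "refl \<beta> (word bs x) = word bs x" by (simp add: refl_def)
    then have "word cs x = word bs x" using fun_cong[OF cs(3), of x] by simp
    then show ?thesis using less.hyps[OF cs(2,1) less.prems(2)] less.prems(3) by simp
  next
    case False
    then show ?thesis using word_id[OF less.prems(1)] by auto
  qed
qed

subsection \<open>The Weyl group\<close>

lemma weyl_id: "id \<in> weyl"
  unfolding weyl_def by (rule image_eqI[of _ _ "[]"]) auto

lemma weyl_comp: "\<lbrakk>v \<in> weyl; w \<in> weyl\<rbrakk> \<Longrightarrow> v \<circ> w \<in> weyl"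
  unfolding weyl_def by (auto simp: word_append[symmetric] intro!: imageI)

lemma weyl_simple: "\<beta> \<in> \<Delta> \<Longrightarrow> refl \<beta> \<in> weyl"
  unfolding weyl_def by (rule image_eqI[of _ _ "[\<beta>]"]) auto

lemma weyl_induct [consumes 1, case_names id refl]:
  assumes "w \<in> weyl" "P id" "\<And>\<beta> w. \<lbrakk>\<beta> \<in> \<Delta>; w \<in> weyl; P w\<rbrakk> \<Longrightarrow> P (refl \<beta> \<circ> w)"
  shows "P w"
proof -
  obtain bs where bs: "bs \<in> lists \<Delta>" "w = word bs" using assms(1) by (auto simp: weyl_def)
  have "P (word bs)" using bs(1)
  proof (induction bs)
    case (Cons b bs)
    then have "P (refl b \<circ> word bs)" by (intro assms(3)) (auto simp: weyl_def)
    then show ?case by (simp only: word_Cons)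
  qed (simp only: word_Nil assms(2))
  then show ?thesis by (simp only: bs)
qed

lemma weyl_inverse: "w \<in> weyl \<Longrightarrow> \<exists>v\<in>weyl. v \<circ> w = id \<and> w \<circ> v = id"
proof -
  assume "w \<in> weyl"
  then obtain bs where bs: "bs \<in> lists \<Delta>" "w = word bs" by (auto simp: weyl_def)
  then have "word (rev bs) \<in> weyl" "rev bs \<in> lists \<Delta>" by (auto simp: weyl_def)
  moreover have "word (rev bs) \<circ> w = id" using word_rev[OF calculation(2)] bs by simp
  ultimately show ?thesis using word_rev[of bs] bs by auto
qed

lemma weyl_root: "\<lbrakk>w \<in> weyl; \<alpha> \<in> \<Phi>\<rbrakk> \<Longrightarrow> \<alpha> \<circ> w \<in> \<Phi>"
  by (auto simp: weyl_def intro: word_root)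

lemma weyl_add: "w \<in> weyl \<Longrightarrow> w (x + y) = w x + w y"
  by (induction rule: weyl_induct) (auto simp: refl_add base_root)

lemma weyl_scale: "w \<in> weyl \<Longrightarrow> w (c *s x) = c *s w x"
  by (induction rule: weyl_induct) (auto simp: refl_scale base_root)

lemma weyl_diff: "w \<in> weyl \<Longrightarrow> w (x - y) = w x - w y"
  using weyl_add[of w "x - y" y] by simp

lemma weyl_zero: "w \<in> weyl \<Longrightarrow> w 0 = 0"
  using weyl_diff[of w 0 0] by simp

lemma weyl_positive_id: "\<lbrakk>w \<in> weyl; \<And>\<beta>. \<beta> \<in> \<Delta> \<Longrightarrow> \<beta> \<circ> w \<in> pos\<rbrakk> \<Longrightarrow> w = id"
  by (auto simp: weyl_def intro!: word_id)

lemma weyl_dominant_unique: "\<lbrakk>w \<in> weyl; dominant x; dominant (w x)\<rbrakk> \<Longrightarrow> w x = x"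
  by (auto simp: weyl_def intro!: word_dominant_unique)

lemma finite_weyl: "finite weyl"
proof (rule inj_on_finite)
  let ?f = "\<lambda>w. \<lambda>\<alpha>\<in>\<Phi>. \<alpha> \<circ> w"
  show "?f ` weyl \<subseteq> (\<Phi> \<rightarrow>\<^sub>E \<Phi>)" using weyl_root by auto
  show "finite (\<Phi> \<rightarrow>\<^sub>E \<Phi>)" using finite_roots by (rule finite_PiE) (rule finite_roots)
  show "inj_on ?f weyl"
  proof (rule inj_onI)
    fix v w assume v: "v \<in> weyl" and w: "w \<in> weyl" and eq: "?f v = ?f w"
    obtain u where u: "u \<in> weyl" "w \<circ> u = id" "u \<circ> w = id" using weyl_inverse[OF w] by blast
    have "\<beta> \<circ> (v \<circ> u) \<in> pos" if "\<beta> \<in> \<Delta>" for \<beta>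
    proof -
      have "\<beta> \<circ> v = \<beta> \<circ> w" using fun_cong[OF eq, of \<beta>] base_root[OF that] by simp
      then have "\<beta> \<circ> (v \<circ> u) = \<beta> \<circ> (w \<circ> u)" by (simp add: comp_assoc[symmetric])
      then show ?thesis using base_pos[OF that] u by simp
    qed
    then have "v \<circ> u = id" using weyl_positive_id weyl_comp v u by blast
    then have "v \<circ> (u \<circ> w) = w" by (simp add: comp_assoc[symmetric])
    then show "v = w" using u by simp
  qed
qed

subsection \<open>The invariant form\<close>

definition form :: "'v \<Rightarrow> 'v \<Rightarrow> rat" where "form x y = (\<Sum>\<alpha>\<in>\<Phi>. \<alpha> x * \<alpha> y)"

lemma form_sym: "form x y = form y x"
  by (simp add: form_def mult.commute)

lemma form_add: "form (x + y) z = form x z + form y z"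
  by (simp add: form_def root_add distrib_right sum.distrib)

lemma form_scale: "form (c *s x) z = c * form x z"
  by (simp add: form_def root_scale sum_distrib_left mult.assoc)

lemma form_nonneg: "0 \<le> form x x"
  by (simp add: form_def sum_nonneg)

lemma form_null: "\<lbrakk>form x x \<le> 0; \<alpha> \<in> \<Phi>\<rbrakk> \<Longrightarrow> \<alpha> x = 0"
  using form_nonneg[of x] finite_roots sum_nonneg_eq_0_iff[of \<Phi> "\<lambda>\<alpha>. \<alpha> x * \<alpha> x"]
  by (auto simp: form_def)

lemma form_diff: "form (x - y) z = form x z - form y z"
  using form_add[of "x - y" y z] by simp

lemma form_zero: "form 0 z = 0"
  using form_diff[of 0 0 z] by simp

lemma form_minus: "form (- x) z = - form x z"
  using form_diff[of 0 x z] form_zero by simp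

lemma form_add_right: "form z (x + y) = form z x + form z y"
  using form_add form_sym by metis

lemma form_diff_right: "form z (x - y) = form z x - form z y"
  using form_diff form_sym by metis

lemma form_scale_right: "form z (a *s x) = a * form z x"
  using form_scale form_sym by metis

lemma form_sum: "form (\<Sum>i\<in>I. f i) z = (\<Sum>i\<in>I. form (f i) z)"
  by (induction I rule: infinite_finite_induct) (auto simp: form_zero form_add)

lemma form_refl:
  assumes "\<alpha> \<in> \<Phi>" shows "form (refl \<alpha> x) (refl \<alpha> y) = form x y"
proof -
  have "bij_betw (\<lambda>\<beta>. \<beta> \<circ> refl \<alpha>) \<Phi> \<Phi>"
    by (rule bij_betw_byWitness[where f' = "\<lambda>\<beta>. \<beta> \<circ> refl \<alpha>"])
      (auto simp: comp_assoc refl_o_refl assms root_refl)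
  from sum.reindex_bij_betw[OF this, of "\<lambda>\<beta>. \<beta> x * \<beta> y"] show ?thesis
    by (simp add: form_def)
qed

lemma form_coroot:
  assumes "\<alpha> \<in> \<Phi>" shows "2 * form (cr \<alpha>) y = form (cr \<alpha>) (cr \<alpha>) * \<alpha> y"
proof -
  have "form (cr \<alpha>) y = form (refl \<alpha> (cr \<alpha>)) (refl \<alpha> y)" using form_refl[OF assms] by simp
  also have "\<dots> = - form (cr \<alpha>) (y - \<alpha> y *s cr \<alpha>)"
    unfolding refl_coroot[OF assms] by (simp add: refl_def form_minus)
  also have "\<dots> = \<alpha> y * form (cr \<alpha>) (cr \<alpha>) - form (cr \<alpha>) y"
    by (simp add: form_diff_right form_scale_right)
  finally show ?thesis by simp
qed

lemma form_coroot_pos: "\<alpha> \<in> \<Phi> \<Longrightarrow> 0 < form (cr \<alpha>) (cr \<alpha>)"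
  using form_null[of "cr \<alpha>" \<alpha>] root_two[of \<alpha>] by (auto simp: not_le[symmetric])

lemma form_coroot': "\<alpha> \<in> \<Phi> \<Longrightarrow> form (cr \<alpha>) y = form (cr \<alpha>) (cr \<alpha>) / 2 * \<alpha> y"
  using form_coroot[of \<alpha> y] by simp

lemma cartan_sign:
  assumes "\<alpha> \<in> \<Phi>" "\<beta> \<in> \<Phi>" "0 < \<beta> (cr \<alpha>)" shows "0 < \<alpha> (cr \<beta>)"
proof -
  have "0 < form (cr \<beta>) (cr \<beta>) / 2 * \<beta> (cr \<alpha>)"
    using form_coroot_pos[OF assms(2)] assms(3) by simp
  then have "0 < form (cr \<beta>) (cr \<alpha>)" using form_coroot'[OF assms(2)] by metis
  then have "0 < form (cr \<alpha>) (cr \<alpha>) / 2 * \<alpha> (cr \<beta>)"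
    using form_coroot'[OF assms(1), of "cr \<beta>"] form_sym by metis
  then show ?thesis using form_coroot_pos[OF assms(1)] by (simp add: zero_less_mult_iff)
qed

lemma cartan_product_le:
  assumes "\<alpha> \<in> \<Phi>" "\<beta> \<in> \<Phi>" shows "\<alpha> (cr \<beta>) * \<beta> (cr \<alpha>) \<le> 4"
proof -
  define a b c where "a = form (cr \<alpha>) (cr \<alpha>)" and "b = form (cr \<beta>) (cr \<beta>)" and "c = form (cr \<alpha>) (cr \<beta>)"
  have pos: "0 < a" "0 < b" using form_coroot_pos assms by (auto simp: a_def b_def)
  have "0 \<le> form (b *s cr \<alpha> - c *s cr \<beta>) (b *s cr \<alpha> - c *s cr \<beta>)" by (rule form_nonneg)
  also have "\<dots> = b * (a * b - c * c)"
    by (simp add: form_diff form_scale form_diff_right form_scale_right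
        a_def[symmetric] b_def[symmetric] c_def[symmetric] form_sym[of "cr \<beta>" "cr \<alpha>"] algebra_simps)
  finally have "c * c \<le> a * b" using pos by (simp add: zero_le_mult_iff)
  moreover have "2 * c = a * \<alpha> (cr \<beta>)" "2 * c = b * \<beta> (cr \<alpha>)"
    using form_coroot[OF assms(1), of "cr \<beta>"] form_coroot[OF assms(2), of "cr \<alpha>"]
    by (auto simp: a_def b_def c_def form_sym[of "cr \<beta>" "cr \<alpha>"])
  then have "4 * (c * c) = (a * b) * (\<alpha> (cr \<beta>) * \<beta> (cr \<alpha>))" by algebra
  ultimately have "(a * b) * (\<alpha> (cr \<beta>) * \<beta> (cr \<alpha>)) \<le> (a * b) * 4" by simp
  then show ?thesis using pos by (simp add: mult_le_cancel_left)
qed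

lemma pos_simple_summand:
  assumes "\<alpha> \<in> pos" shows "\<exists>\<beta>\<in>\<Delta>. 0 < \<alpha> (cr \<beta>) \<and> 0 < \<beta> (cr \<alpha>)"
proof -
  obtain n :: "_ \<Rightarrow> nat" where n: "\<alpha> = (\<lambda>x. \<Sum>\<beta>\<in>\<Delta>. of_nat (n \<beta>) * \<beta> x)"
    using assms by (auto simp: positive_roots_def)
  have "\<exists>\<beta>\<in>\<Delta>. 0 < \<beta> (cr \<alpha>)"
  proof (rule ccontr)
    assume "\<not> ?thesis"
    then have "(\<Sum>\<beta>\<in>\<Delta>. of_nat (n \<beta>) * \<beta> (cr \<alpha>)) \<le> 0"
      by (intro sum_nonpos) (auto simp: not_less mult_nonneg_nonpos)
    then show False using root_two[OF pos_root[OF assms]] fun_cong[OF n, of "cr \<alpha>"] by simp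
  qed
  then show ?thesis using cartan_sign[OF pos_root[OF assms] base_root] by blast
qed

lemma weyl_refl_pos:
  assumes "\<alpha> \<in> pos" shows "refl \<alpha> \<in> weyl"
proof -
  obtain h where h: "\<And>\<beta>. \<beta> \<in> \<Delta> \<Longrightarrow> \<beta> h = 1"
    using regular_exists by blast
  have int: "\<exists>k::nat. \<alpha> h = of_nat k" if a: "\<alpha> \<in> pos" for \<alpha>
  proof -
    obtain n :: "_ \<Rightarrow> nat" where "\<alpha> = (\<lambda>x. \<Sum>\<beta>\<in>\<Delta>. of_nat (n \<beta>) * \<beta> x)"
      using a by (auto simp: positive_roots_def)
    then have "\<alpha> h = (\<Sum>\<beta>\<in>\<Delta>. of_nat (n \<beta>) * \<beta> h)" by simp
    also have "\<dots> = (\<Sum>\<beta>\<in>\<Delta>. of_nat (n \<beta>))" by (intro sum.cong) (auto simp: h)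
    finally have "\<alpha> h = of_nat (\<Sum>\<beta>\<in>\<Delta>. n \<beta>)" by simp
    then show ?thesis by blast
  qed
  obtain k :: nat where "\<alpha> h = of_nat k" using int[OF assms] by blast
  then show ?thesis using assms
  proof (induction k arbitrary: \<alpha> rule: less_induct)
    case (less k)
    show ?case
    proof (cases "\<alpha> \<in> \<Delta>")
      case True then show ?thesis by (rule weyl_simple)
    next
      case False
      obtain \<beta> where \<beta>: "\<beta> \<in> \<Delta>" "0 < \<alpha> (cr \<beta>)" using pos_simple_summand[OF less.prems(2)] by blast
      have r: "\<alpha> \<in> \<Phi>" "\<beta> \<in> \<Phi>" using less.prems \<beta> pos_root base_root by auto
      define \<gamma> where "\<gamma> = \<alpha> \<circ> refl \<beta>"
      have \<gamma>: "\<gamma> \<in> pos" using pos_refl_simple[OF less.prems(2) \<beta>(1)] False \<beta> by (auto simp: \<gamma>_def)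
      obtain j :: nat where j: "\<gamma> h = of_nat j" using int[OF \<gamma>] by blast
      have "\<gamma> h = \<alpha> h - \<alpha> (cr \<beta>)" using r \<beta> h by (simp add: \<gamma>_def root_o_refl)
      then have "j < k" using j less.prems(1) \<beta>(2) by simp
      then have "refl \<gamma> \<in> weyl" using less.IH j \<gamma> by blast
      moreover have "refl \<alpha> = refl \<beta> \<circ> refl \<gamma> \<circ> refl \<beta>"
      proof -
        have "\<alpha> = \<gamma> \<circ> refl \<beta>" using refl_o_refl[OF r(2)] by (simp add: \<gamma>_def comp_assoc)
        then show ?thesis using refl_conj[OF r(2) pos_root[OF \<gamma>]] by simp
      qed
      ultimately show ?thesis using weyl_simple[OF \<beta>(1)] weyl_comp by metis
    qed
  qed
qed

lemma coroot_neg: "\<alpha> \<in> \<Phi> \<Longrightarrow> cr (\<lambda>x. - \<alpha> x) = - cr \<alpha>"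
proof -
  assume a: "\<alpha> \<in> \<Phi>"
  have "\<alpha> \<circ> refl \<alpha> = (\<lambda>x. - \<alpha> x)" using a by (auto simp: root_o_refl root_two)
  then show ?thesis using coroot_refl[OF a a] refl_coroot[OF a] by simp
qed

lemma weyl_refl: assumes "\<alpha> \<in> \<Phi>" shows "refl \<alpha> \<in> weyl"
proof (cases "\<alpha> \<in> pos")
  case False
  have "refl (\<lambda>x. - \<alpha> x) = refl \<alpha>" using coroot_neg[OF assms] by (auto simp: refl_def)
  then show ?thesis using weyl_refl_pos[OF not_pos_neg[OF assms False]] by simp
qed (rule weyl_refl_pos)

lemma coroot_cone_zero: "0 \<in> coroot_cone"
  unfolding coroot_cone_def by (rule CollectI, rule exI[of _ "\<lambda>_. 0"]) simp

lemma coroot_cone_add: assumes "x \<in> coroot_cone" "\<beta> \<in> \<Delta>" "0 \<le> a" shows "x + a *s cr \<beta> \<in> coroot_cone"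
proof -
  obtain c where c: "\<And>\<beta>. \<beta> \<in> \<Delta> \<Longrightarrow> (0::rat) \<le> c \<beta>" "x = (\<Sum>\<beta>\<in>\<Delta>. c \<beta> *s cr \<beta>)"
    using assms(1) by (auto simp: coroot_cone_def)
  have "(\<Sum>\<gamma>\<in>\<Delta>. (c(\<beta> := c \<beta> + a)) \<gamma> *s cr \<gamma>)
      = (\<Sum>\<gamma>\<in>\<Delta>. c \<gamma> *s cr \<gamma> + (if \<gamma> = \<beta> then a *s cr \<beta> else 0))"
    by (intro sum.cong) (auto simp: scale_left_distrib)
  also have "\<dots> = x + a *s cr \<beta>" using assms(2) finite_base by (simp add: sum.distrib c(2))
  finally show ?thesis
    unfolding coroot_cone_def using c(1) assms by (intro CollectI exI[of _ "c(\<beta> := c \<beta> + a)"]) auto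
qed

lemma dominant_conjugate: "\<exists>w\<in>weyl. dominant (w x) \<and> w x - x \<in> coroot_cone"
proof -
  obtain h where h: "\<And>\<beta>. \<beta> \<in> \<Delta> \<Longrightarrow> \<beta> h = 1"
    using regular_exists by blast
  define N where "N = {w \<in> weyl. w x - x \<in> coroot_cone}"
  have N: "finite N" "id \<in> N" using finite_weyl weyl_id coroot_cone_zero by (auto simp: N_def)
  let ?f = "\<lambda>v. form (v x) h"
  have "Max (?f ` N) \<in> ?f ` N" using N by (intro Max_in) auto
  then obtain w where w: "w \<in> N" "Max (?f ` N) = form (w x) h" by (rule imageE)
  have max: "form (v x) h \<le> form (w x) h" if "v \<in> N" for v
    using N that unfolding w(2)[symmetric] by (intro Max_ge) auto
  have "0 \<le> \<beta> (w x)" if \<beta>: "\<beta> \<in> \<Delta>" for \<beta>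
  proof (rule ccontr)
    assume neg: "\<not> ?thesis"
    have r: "\<beta> \<in> \<Phi>" using \<beta> base_root by blast
    define v where "v = refl \<beta> \<circ> w"
    have vx: "v x - x = (w x - x) + (- \<beta> (w x)) *s cr \<beta>" by (simp add: v_def refl_def)
    have "v x - x \<in> coroot_cone"
      unfolding vx using w(1) neg \<beta> by (intro coroot_cone_add) (auto simp: N_def)
    moreover have "v \<in> weyl" using w(1) weyl_comp[OF weyl_simple[OF \<beta>]] by (simp add: N_def v_def)
    ultimately have "v \<in> N" unfolding N_def by simp
    moreover have "form (v x) h = form (w x) h - \<beta> (w x) * (form (cr \<beta>) (cr \<beta>) / 2)"
      using form_coroot'[OF r, of h] h[OF \<beta>] by (simp add: v_def refl_def form_diff form_scale)
    moreover have "\<beta> (w x) * (form (cr \<beta>) (cr \<beta>) / 2) < 0"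
      using neg form_coroot_pos[OF r] by (intro mult_neg_pos) auto
    ultimately show False using max[of v] by simp
  qed
  then show ?thesis using w(1) by (auto simp: N_def dominant_def)
qed

lemma dominant_weyl_le:
  assumes "dominant x" "w \<in> weyl" shows "x - w x \<in> coroot_cone"
proof -
  obtain v where v: "v \<in> weyl" "dominant (v (w x))" "v (w x) - w x \<in> coroot_cone"
    using dominant_conjugate[of "w x"] by blast
  have "(v \<circ> w) x = x" using weyl_dominant_unique[OF weyl_comp[OF v(1) assms(2)] assms(1)] v by simp
  then show ?thesis using v by simp
qed

lemma pos_minus_simple:
  assumes "\<alpha> \<in> pos" "\<alpha> \<notin> \<Delta>"
  shows "\<exists>\<beta>\<in>\<Delta>. (\<lambda>x. \<alpha> x - \<beta> x) \<in> pos"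
proof -
  obtain \<beta> where \<beta>: "\<beta> \<in> \<Delta>" "0 < \<alpha> (cr \<beta>)" "0 < \<beta> (cr \<alpha>)"
    using pos_simple_summand[OF assms(1)] by blast
  have r: "\<alpha> \<in> \<Phi>" "\<beta> \<in> \<Phi>" using assms \<beta> pos_root base_root by auto
  have ne: "\<alpha> \<noteq> \<beta>" using assms \<beta> by auto
  obtain p q where pq: "\<alpha> (cr \<beta>) = of_int p" "\<beta> (cr \<alpha>) = of_int q"
    using root_integral[OF r] root_integral[OF r(2,1)] by (meson Ints_cases)
  have pq_pos: "1 \<le> p" "1 \<le> q" using \<beta> pq by auto
  have root: "(\<lambda>x. \<alpha> x - \<beta> x) \<in> \<Phi>"
  proof (cases "p = 1 \<or> q = 1")
    case True
    then show ?thesis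
    proof
      assume "p = 1"
      then show ?thesis using root_reflect[OF r(2,1)] pq by simp
    next
      assume "q = 1"
      then show ?thesis using root_neg[OF root_reflect[OF r]] pq by simp
    qed
  next
    case False
    have "of_int (p * q) \<le> (of_int 4 :: rat)" using cartan_product_le[OF r] pq by simp
    then have le: "p * q \<le> 4" by (simp only: of_int_le_iff)
    have ge: "2 \<le> p" "2 \<le> q" using False pq_pos by auto
    have "2 * p \<le> 4" using mult_left_mono[OF ge(2), of p] ge le by linarith
    moreover have "2 * q \<le> 4" using mult_right_mono[OF ge(1), of q] ge le by linarith
    ultimately have two: "\<alpha> (cr \<beta>) = 2" "\<beta> (cr \<alpha>) = 2" using ge pq by auto
    have "(\<lambda>x. \<alpha> x + of_nat (2 * k) * (\<alpha> x - \<beta> x)) \<in> \<Phi>" for k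
    proof (induction k)
      case (Suc k)
      let ?\<gamma> = "\<lambda>x. \<alpha> x + of_nat (2 * k) * (\<alpha> x - \<beta> x)"
      have "?\<gamma> \<circ> refl \<beta> \<circ> refl \<alpha> \<in> \<Phi>" using Suc r root_refl by blast
      moreover have "?\<gamma> \<circ> refl \<beta> \<circ> refl \<alpha> = (\<lambda>x. \<alpha> x + of_nat (2 * Suc k) * (\<alpha> x - \<beta> x))"
      proof
        fix x
        have *: "\<alpha> (refl \<beta> (refl \<alpha> x)) = 3 * \<alpha> x - 2 * \<beta> x"
          "\<beta> (refl \<beta> (refl \<alpha> x)) = 2 * \<alpha> x - \<beta> x"
          using r by (auto simp: refl_def root_diff root_scale root_two two)
        show "(?\<gamma> \<circ> refl \<beta> \<circ> refl \<alpha>) x = \<alpha> x + of_nat (2 * Suc k) * (\<alpha> x - \<beta> x)"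
          unfolding comp_apply * by (simp add: algebra_simps)
      qed
      ultimately show ?case by simp
    qed (use r in simp)
    then have "range (\<lambda>k::nat. (\<lambda>x. \<alpha> x + of_nat (2 * k) * (\<alpha> x - \<beta> x))) \<subseteq> \<Phi>" by auto
    then have "\<not> inj (\<lambda>k::nat. (\<lambda>x. \<alpha> x + of_nat (2 * k) * (\<alpha> x - \<beta> x)))"
      using finite_roots finite_subset finite_imageD infinite_UNIV_nat by blast
    then obtain j k :: nat where jk: "j \<noteq> k"
      "(\<lambda>x. \<alpha> x + of_nat (2 * j) * (\<alpha> x - \<beta> x)) = (\<lambda>x. \<alpha> x + of_nat (2 * k) * (\<alpha> x - \<beta> x))"
      by (auto simp: inj_def)
    have "\<alpha> x = \<beta> x" for x using fun_cong[OF jk(2), of x] jk(1) by auto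
    then show ?thesis using ne by auto
  qed
  moreover have "(\<lambda>x. \<alpha> x - \<beta> x) \<in> pos"
  proof (rule ccontr)
    assume "(\<lambda>x. \<alpha> x - \<beta> x) \<notin> pos"
    then have neg: "(\<lambda>x. \<beta> x - \<alpha> x) \<in> pos" using not_pos_neg[OF root] by simp
    have "\<alpha> x \<le> 0" if "dominant x" "\<beta> x = 0" for x using pos_nonneg[OF neg that(1)] that(2) by simp
    then have "\<alpha> = \<beta>" by (intro pos_eq_simple[OF assms(1) \<beta>(1)]) auto
    with ne show False by simp
  qed
  ultimately show ?thesis using \<beta>(1) by blast
qed

lemma weyl_Bij: "w \<in> weyl \<Longrightarrow> w \<in> Bij UNIV"
proof -
  assume "w \<in> weyl"
  then obtain v where "v \<circ> w = id" "w \<circ> v = id" using weyl_inverse by blast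
  then show ?thesis by (simp add: Bij_def o_bij)
qed

lemma refl_inverse: "\<alpha> \<in> \<Phi> \<Longrightarrow> inv\<^bsub>BijGroup UNIV\<^esub> (refl \<alpha>) = refl \<alpha>"
  using inv_BijGroup[OF weyl_Bij[OF weyl_refl], of \<alpha>] inv_unique_comp[OF refl_o_refl refl_o_refl, of \<alpha>]
  by (simp add: restrict_UNIV)

lemma generate_refl: "generate (BijGroup UNIV) (refl ` \<Phi>) = weyl"
proof (intro equalityI subsetI)
  fix w assume "w \<in> generate (BijGroup UNIV) (refl ` \<Phi>)"
  then show "w \<in> weyl"
  proof (induction rule: generate.induct)
    case one
    show ?case using weyl_id by (simp add: BijGroup_def id_def)
  next
    case (incl h)
    then show ?case using weyl_refl by auto
  next
    case (inv h)
    then show ?case using weyl_refl refl_inverse by auto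
  next
    case (eng v w)
    then show ?case using weyl_comp[of v w] weyl_Bij
      by (simp add: BijGroup_def compose_def comp_def restrict_UNIV)
  qed
next
  fix w assume "w \<in> weyl"
  then show "w \<in> generate (BijGroup UNIV) (refl ` \<Phi>)"
  proof (induction rule: weyl_induct)
    case id
    have "\<one>\<^bsub>BijGroup UNIV\<^esub> = (id :: 'v \<Rightarrow> 'v)" by (simp add: BijGroup_def id_def restrict_UNIV)
    then show ?case using generate.one[of "BijGroup UNIV" "refl ` \<Phi>"] by metis
  next
    case (refl \<beta> w)
    have "refl \<beta> \<otimes>\<^bsub>BijGroup UNIV\<^esub> w = refl \<beta> \<circ> w"
      using weyl_Bij[OF refl(2)] weyl_Bij[OF weyl_simple[OF refl(1)]]
      by (simp add: BijGroup_def compose_def comp_def restrict_UNIV)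
    moreover have "refl \<beta> \<otimes>\<^bsub>BijGroup UNIV\<^esub> w \<in> generate (BijGroup UNIV) (refl ` \<Phi>)"
      using base_root[OF refl(1)] by (intro generate.eng generate.incl refl(3)) blast
    ultimately show ?case by (simp only:)
  qed
qed

lemma coroot_cone_diff_weyl: "w \<in> weyl \<Longrightarrow> \<exists>c. x - w x = (\<Sum>\<beta>\<in>\<Delta>. c \<beta> *s cr \<beta>)"
proof (induction rule: weyl_induct)
  case id
  show ?case by (rule exI[of _ "\<lambda>_. 0"]) simp
next
  case (refl \<beta> w)
  then obtain c where c: "x - w x = (\<Sum>\<beta>\<in>\<Delta>. c \<beta> *s cr \<beta>)" by blast
  have "(\<Sum>\<gamma>\<in>\<Delta>. (c(\<beta> := c \<beta> + \<beta> (w x))) \<gamma> *s cr \<gamma>)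
      = (\<Sum>\<gamma>\<in>\<Delta>. c \<gamma> *s cr \<gamma> + (if \<gamma> = \<beta> then \<beta> (w x) *s cr \<beta> else 0))"
    by (intro sum.cong) (auto simp: scale_left_distrib)
  also have "\<dots> = (x - w x) + \<beta> (w x) *s cr \<beta>" using refl(1) finite_base by (simp add: sum.distrib c)
  also have "\<dots> = x - (refl \<beta> \<circ> w) x" by (simp add: local.refl_def)
  finally show ?case by (intro exI[of _ "c(\<beta> := c \<beta> + \<beta> (w x))"]) simp
qed

definition flips :: "('v \<Rightarrow> 'v) \<Rightarrow> bool" where "flips w \<longleftrightarrow> (\<forall>\<alpha>\<in>pos. \<alpha> \<circ> w \<notin> pos)"

lemma flips_neg: "\<lbrakk>w \<in> weyl; flips w; \<alpha> \<in> pos\<rbrakk> \<Longrightarrow> (\<lambda>x. - (\<alpha> \<circ> w) x) \<in> pos"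
  using not_pos_neg[OF weyl_root[OF _ pos_root]] by (auto simp: flips_def)

lemma flips_unique:
  assumes "u \<in> weyl" "v \<in> weyl" "flips u" "flips v" shows "u = v"
proof -
  obtain v' where v': "v' \<in> weyl" "v' \<circ> v = id" "v \<circ> v' = id" using weyl_inverse[OF assms(2)] by blast
  have "\<beta> \<circ> (u \<circ> v') \<in> pos" if \<beta>: "\<beta> \<in> \<Delta>" for \<beta>
  proof (rule ccontr)
    assume "\<beta> \<circ> (u \<circ> v') \<notin> pos"
    then have "(\<lambda>x. - (\<beta> \<circ> (u \<circ> v')) x) \<in> pos"
      by (rule not_pos_neg[OF weyl_root[OF weyl_comp[OF assms(1) v'(1)] base_root[OF \<beta>]]])
    then have "(\<lambda>x. - (\<beta> \<circ> (u \<circ> v')) x) \<circ> v \<notin> pos" using assms(4) unfolding flips_def by blast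
    moreover have "(\<lambda>x. - (\<beta> \<circ> (u \<circ> v')) x) \<circ> v = (\<lambda>x. - (\<beta> \<circ> u) x)"
      using fun_cong[OF v'(2)] by auto
    ultimately show False using flips_neg[OF assms(1,3) base_pos[OF \<beta>]] by simp
  qed
  then have "u \<circ> v' = id" using weyl_positive_id[OF weyl_comp[OF assms(1) v'(1)]] by blast
  then have "u \<circ> (v' \<circ> v) = v" by (simp only: comp_assoc[symmetric] id_comp)
  then show ?thesis by (simp only: v' comp_id)
qed

lemma flips_involution: assumes "u \<in> weyl" "flips u" shows "u \<circ> u = id"
proof (rule weyl_positive_id[OF weyl_comp[OF assms(1,1)]])
  fix \<beta> assume \<beta>: "\<beta> \<in> \<Delta>"
  from flips_neg[OF assms flips_neg[OF assms base_pos[OF this]]]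
  show "\<beta> \<circ> (u \<circ> u) \<in> pos" by (simp add: comp_def)
qed

subsection \<open>Parabolic subsystems\<close>

definition sub_roots :: "('v \<Rightarrow> rat) set \<Rightarrow> ('v \<Rightarrow> rat) set" where
  "sub_roots J = {\<alpha> \<in> \<Phi>. \<forall>x. (\<forall>\<beta>\<in>J. \<beta> x = 0) \<longrightarrow> \<alpha> x = 0}"

lemma pos_sub_roots:
  assumes "J \<subseteq> \<Delta>" "\<alpha> \<in> pos" "\<alpha> \<in> sub_roots J"
  shows "\<alpha> \<in> positive_roots (sub_roots J) J"
proof -
  obtain n :: "_ \<Rightarrow> nat" where n: "\<alpha> = (\<lambda>x. \<Sum>\<beta>\<in>\<Delta>. of_nat (n \<beta>) * \<beta> x)"
    and val: "\<And>\<delta> x. \<lbrakk>\<delta> \<in> \<Delta>; \<delta> x = 1; \<forall>\<gamma>\<in>\<Delta> - {\<delta>}. \<gamma> x = 0\<rbrakk> \<Longrightarrow> \<alpha> x = of_nat (n \<delta>)"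
    using pos_expansion[OF assms(2)] by blast
  have "n \<delta> = 0" if "\<delta> \<in> \<Delta> - J" for \<delta>
  proof -
    have \<delta>: "\<delta> \<in> \<Delta>" "\<delta> \<notin> J" using that by auto
    obtain x where x: "\<delta> x = 1" "\<forall>\<gamma>\<in>\<Delta> - {\<delta>}. \<gamma> x = 0" "dominant x"
      using dual_base[OF \<delta>(1)] .
    have "\<alpha> x = of_nat (n \<delta>)" by (rule val[OF \<delta>(1) x(1,2)])
    moreover have "\<beta> x = 0" if "\<beta> \<in> J" for \<beta> using bspec[OF x(2), of \<beta>] \<delta> that assms(1) by auto
    ultimately show ?thesis using assms(3) by (auto simp: sub_roots_def)
  qed
  then have "\<alpha> = (\<lambda>x. \<Sum>\<beta>\<in>J. of_nat (n \<beta>) * \<beta> x)"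
    unfolding n using finite_base assms(1) by (intro ext sum.mono_neutral_right) auto
  then show ?thesis using assms(3) by (auto simp: positive_roots_def)
qed

lemma root_base_sub_roots:
  assumes J: "J \<subseteq> \<Delta>"
  shows "root_base scale (sub_roots J) cr J"
proof (rule root_base.intro[OF vector_space_axioms root_base_axioms.intro])
  have sub: "\<alpha> \<in> \<Phi>" if "\<alpha> \<in> sub_roots J" for \<alpha> using that by (simp add: sub_roots_def)
  show "finite (sub_roots J)" using finite_roots by (simp add: sub_roots_def)
  show "J \<subseteq> sub_roots J" using J base_root by (auto simp: sub_roots_def)
  fix \<alpha> assume \<alpha>: "\<alpha> \<in> sub_roots J"
  show "\<alpha> (x + y) = \<alpha> x + \<alpha> y" for x y using root_add[OF sub[OF \<alpha>]] .
  show "\<alpha> (c *s x) = c * \<alpha> x" for c x using root_scale[OF sub[OF \<alpha>]] .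
  show "\<alpha> (cr \<alpha>) = 2" using root_two[OF sub[OF \<alpha>]] .
  show "(\<lambda>x. 2 * \<alpha> x) \<notin> sub_roots J" using root_reduced[OF sub[OF \<alpha>]] sub by blast
  show "\<alpha> \<in> positive_roots (sub_roots J) J \<or> (\<lambda>x. - \<alpha> x) \<in> positive_roots (sub_roots J) J"
  proof (cases "\<alpha> \<in> pos")
    case True
    then show ?thesis using pos_sub_roots[OF J True \<alpha>] by blast
  next
    case False
    have "(\<lambda>x. - \<alpha> x) \<in> sub_roots J" using \<alpha> root_neg by (auto simp: sub_roots_def)
    then show ?thesis using pos_sub_roots[OF J not_pos_neg[OF sub[OF \<alpha>] False]] by blast
  qed
  fix \<beta> assume \<beta>: "\<beta> \<in> sub_roots J"
  show "\<alpha> (cr \<beta>) \<in> \<int>" using root_integral[OF sub[OF \<alpha>] sub[OF \<beta>]] .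
  show "(\<lambda>x. \<beta> x - \<beta> (cr \<alpha>) * \<alpha> x) \<in> sub_roots J"
    using \<alpha> \<beta> root_reflect by (auto simp: sub_roots_def)
  show "cr (\<lambda>x. \<beta> x - \<beta> (cr \<alpha>) * \<alpha> x) = cr \<beta> - \<alpha> (cr \<beta>) *s cr \<alpha>"
    using coroot_reflect[OF sub[OF \<alpha>] sub[OF \<beta>]] .
next
  fix c :: "('v \<Rightarrow> rat) \<Rightarrow> rat" and \<beta>
  assume c: "\<And>x. (\<Sum>\<beta>\<in>J. c \<beta> * \<beta> x) = 0" and \<beta>: "\<beta> \<in> J"
  have "(\<Sum>\<beta>\<in>\<Delta>. (if \<beta> \<in> J then c \<beta> else 0) * \<beta> x) = 0" for x
  proof -
    have "(\<Sum>\<beta>\<in>\<Delta>. (if \<beta> \<in> J then c \<beta> else 0) * \<beta> x) = (\<Sum>\<beta>\<in>J. c \<beta> * \<beta> x)"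
      using finite_base J by (intro sum.mono_neutral_cong_right) auto
    then show ?thesis using c by simp
  qed
  from base_independent[of "\<lambda>\<beta>. if \<beta> \<in> J then c \<beta> else 0", OF this, of \<beta>] \<beta> J
  show "c \<beta> = 0" by auto
qed

end

section \<open>Free sets of an antimatroid\<close>

inductive reachable :: "('a set \<Rightarrow> 'a set) \<Rightarrow> 'a set \<Rightarrow> 'a set \<Rightarrow> 'a set \<Rightarrow> bool" for A E S where
  base: "reachable A E S S"
| step: "\<lbrakk>reachable A E S T; a \<in> E; a \<notin> T; a \<in> A T\<rbrakk> \<Longrightarrow> reachable A E S (insert a T)"

lemma reachable_bounds: "reachable A E S T \<Longrightarrow> S \<subseteq> T \<and> T \<subseteq> S \<union> E"
  by (induction rule: reachable.induct) auto

lemma reachable_trans: "\<lbrakk>reachable A E T U; reachable A E S T\<rbrakk> \<Longrightarrow> reachable A E S U"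
  by (induction rule: reachable.induct) (auto intro: reachable.intros)

lemma reachable_remove:
  assumes "a \<notin> T" shows "reachable A (E - {a}) S T \<longleftrightarrow> reachable A E S T"
proof
  show "reachable A (E - {a}) S T \<Longrightarrow> reachable A E S T"
    by (induction rule: reachable.induct) (auto intro: reachable.intros)
  assume "reachable A E S T"
  then show "reachable A (E - {a}) S T" using assms
    by (induction rule: reachable.induct) (auto intro: reachable.intros)
qed

locale locally_free =
  fixes A :: "'a set \<Rightarrow> 'a set" and D :: "'a set"
  assumes finite_ground: "finite D"
    and allowed_insert: "\<lbrakk>S \<subseteq> D; a \<in> D - S; b \<in> D - S; a \<noteq> b; a \<in> A S; b \<in> A S\<rbrakk> \<Longrightarrow> b \<in> A (insert a S)"
begin

lemma allowed_persists:
  assumes "reachable A E S T" "S \<subseteq> D" "E \<subseteq> D" "a \<in> D - S" "a \<in> A S"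
  shows "a \<in> T \<or> a \<in> A T"
  using assms
proof (induction rule: reachable.induct)
  case (step T b)
  have "T \<subseteq> D" using reachable_bounds[OF step.hyps(1)] step.prems by blast
  with step show ?case using allowed_insert[of T b a] by blast
qed auto

lemma reachable_insert:
  assumes "reachable A E S T" "S \<subseteq> D" "E \<subseteq> D" "a \<in> D - S" "a \<in> A S"
  shows "reachable A E (insert a S) (insert a T)"
  using assms
proof (induction rule: reachable.induct)
  case (step T b)
  have IH: "reachable A E (insert a S) (insert a T)" using step by blast
  have T: "T \<subseteq> D" using reachable_bounds[OF step.hyps(1)] step.prems by blast
  show ?case
  proof (cases "a = b \<or> a \<in> T")
    case True
    then show ?thesis using IH step.hyps reachable.step[OF IH, of b]
      by (metis insert_absorb insert_iff)
  next
    case False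
    then have "a \<in> A T" using allowed_persists[OF step.hyps(1) step.prems] by blast
    then have "b \<in> A (insert a T)" using allowed_insert[of T a b] False T step by blast
    then have "reachable A E (insert a S) (insert b (insert a T))"
      using reachable.step[OF IH, of b] False step.hyps by blast
    then show ?thesis by (simp add: insert_commute)
  qed
qed (auto intro: reachable.base)

text \<open>Induction by deletion and contraction of an allowed element.\<close>

lemma free_sum:
  assumes "E \<subseteq> D" "S \<subseteq> E"
  shows "(\<Sum>T | reachable A E S T \<and> E - T \<subseteq> A T. (-1) ^ card (T - S)) = (if S = E then 1 else 0 :: int)"
  using assms
proof (induction "card (E - S)" arbitrary: E S rule: less_induct)
  case less
  have fin: "finite E" using less.prems finite_ground finite_subset by blast
  have bd: "S \<subseteq> T \<and> T \<subseteq> E" if "reachable A E S T" for T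
    using reachable_bounds[OF that] less.prems by blast
  show ?case
  proof (cases "(E - S) \<inter> A S = {}")
    case none: True
    have only: "T = S" if "reachable A E S T" for T
      using that by (induction rule: reachable.induct) (use none in auto)
    have "{T. reachable A E S T \<and> E - T \<subseteq> A T} = (if S = E then {S} else {})"
      using only reachable.base[of A E S] none less.prems by auto
    then show ?thesis by simp
  next
    case False
    then obtain a where a: "a \<in> E - S" "a \<in> A S" by blast
    have aD: "a \<in> D - S" and SD: "S \<subseteq> D" using a less.prems by auto
    let ?F = "{T. reachable A E S T \<and> E - T \<subseteq> A T}"
    let ?F1 = "{T. reachable A E (insert a S) T \<and> E - T \<subseteq> A T}"
    let ?F2 = "{T. reachable A (E - {a}) S T \<and> (E - {a}) - T \<subseteq> A T}"
    have "?F \<inter> {T. a \<in> T} = ?F1"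
    proof (intro equalityI subsetI)
      fix T assume T: "T \<in> ?F \<inter> {T. a \<in> T}"
      then have "reachable A E (insert a S) (insert a T)"
        by (intro reachable_insert SD less.prems(1) aD a(2)) simp
      moreover have "insert a T = T" using T by auto
      ultimately show "T \<in> ?F1" using T by simp
    next
      fix T assume T: "T \<in> ?F1"
      have "reachable A E S (insert a S)" using a by (auto intro: reachable.intros)
      moreover have "reachable A E (insert a S) T" using T by simp
      ultimately have "reachable A E S T" "a \<in> T"
        using reachable_trans[of A E "insert a S" T S] reachable_bounds[of A E "insert a S" T] by blast+
      then show "T \<in> ?F \<inter> {T. a \<in> T}" using T by simp
    qed
    moreover have "?F \<inter> {T. a \<notin> T} = ?F2"
    proof (intro equalityI subsetI)
      fix T assume T: "T \<in> ?F \<inter> {T. a \<notin> T}"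
      then have "reachable A (E - {a}) S T" using reachable_remove[of a T A E S] by simp
      then show "T \<in> ?F2" using T by auto
    next
      fix T assume T: "T \<in> ?F2"
      then have "reachable A (E - {a}) S T" by simp
      moreover from this have aT: "a \<notin> T" using reachable_bounds[of A "E - {a}" S T] a by blast
      ultimately have "reachable A E S T" using reachable_remove[of a T A E S] by simp
      moreover from this have "a \<in> A T" using allowed_persists[of E S T a] SD less.prems(1) aD a(2) aT by blast
      ultimately show "T \<in> ?F \<inter> {T. a \<notin> T}" using T aT by auto
    qed
    moreover have "finite ?F" using bd fin by (intro finite_subset[of ?F "Pow E"]) auto
    then have "(\<Sum>T\<in>?F. (-1::int) ^ card (T - S)) =
        (\<Sum>T\<in>?F \<inter> {T. a \<in> T}. (-1) ^ card (T - S)) + (\<Sum>T\<in>?F - {T. a \<in> T}. (-1) ^ card (T - S))"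
      by (rule sum.Int_Diff)
    moreover have "?F - {T. a \<in> T} = ?F \<inter> {T. a \<notin> T}" by blast
    ultimately have "(\<Sum>T\<in>?F. (-1::int) ^ card (T - S)) =
        (\<Sum>T\<in>?F1. (-1) ^ card (T - S)) + (\<Sum>T\<in>?F2. (-1) ^ card (T - S))" by simp
    also have "(\<Sum>T\<in>?F1. (-1::int) ^ card (T - S)) = (\<Sum>T\<in>?F1. - ((-1) ^ card (T - insert a S)))"
    proof (rule sum.cong)
      fix T assume T: "T \<in> ?F1"
      then have "insert a S \<subseteq> T" "T \<subseteq> E" using reachable_bounds[of A E "insert a S" T] a less.prems by auto
      then have "finite (T - S)" "a \<in> T - S" using a fin finite_subset by auto
      from card_Suc_Diff1[OF this] have "card (T - S) = Suc (card (T - insert a S))"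
        by (metis Diff_insert)
      then show "(-1::int) ^ card (T - S) = - ((-1) ^ card (T - insert a S))"
        by (simp only: power_Suc mult_minus1)
    qed simp
    also have "\<dots> = - (if insert a S = E then 1 else 0)"
      unfolding sum_negf
    proof (subst less.hyps)
      show "card (E - insert a S) < card (E - S)" using a fin by (intro psubset_card_mono) auto
    qed (use less.prems a in auto)
    also have "(\<Sum>T\<in>?F2. (-1::int) ^ card (T - S)) = (if S = E - {a} then 1 else 0)"
    proof (rule less.hyps)
      show "card (E - {a} - S) < card (E - S)" using a fin by (intro psubset_card_mono) auto
    qed (use less.prems a in auto)
    finally show ?thesis using a by auto
  qed
qed

lemma free_reachable: "\<lbrakk>S \<subseteq> D; D - S \<subseteq> A S\<rbrakk> \<Longrightarrow> reachable A D S D"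
proof (induction "card (D - S)" arbitrary: S)
  case 0
  then have "S = D" using finite_ground by auto
  then show ?case by (simp add: reachable.base)
next
  case (Suc n)
  then obtain a where a: "a \<in> D - S" by (metis card.empty equals0I nat.distinct(1))
  have "n = card (D - insert a S)"
    using Suc.hyps(2) a finite_ground card_Suc_Diff1[of "D - S" a] by (metis Diff_insert finite_Diff nat.inject)
  moreover have "D - insert a S \<subseteq> A (insert a S)"
    using Suc.prems a allowed_insert[of S a] by blast
  ultimately have "reachable A D (insert a S) D" using Suc.hyps(1) Suc.prems a by blast
  moreover have "reachable A D S (insert a S)" using a Suc.prems(2) by (auto intro: reachable.intros)
  ultimately show ?case by (rule reachable_trans)
qed

end

section \<open>Projections in a relative root system\<close>

locale relative_system = vector_space scale
  for scale :: "rat \<Rightarrow> 'v::ab_group_add \<Rightarrow> 'v" (infixr \<open>*s\<close> 75) +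
  fixes F :: "'v set" and D :: "('v \<Rightarrow> rat) set" and e :: "('v \<Rightarrow> rat) \<Rightarrow> 'v"
    and B :: "'v \<Rightarrow> 'v \<Rightarrow> rat" and P :: "('v \<Rightarrow> rat) set \<Rightarrow> 'v \<Rightarrow> 'v"
  assumes finite_D: "finite D"
    and F_add: "\<lbrakk>x \<in> F; y \<in> F\<rbrakk> \<Longrightarrow> x + y \<in> F"
    and F_scale: "x \<in> F \<Longrightarrow> a *s x \<in> F"
    and F_zero: "0 \<in> F"
    and D_add: "\<lbrakk>\<delta> \<in> D; x \<in> F; y \<in> F\<rbrakk> \<Longrightarrow> \<delta> (x + y) = \<delta> x + \<delta> y"
    and D_scale: "\<lbrakk>\<delta> \<in> D; x \<in> F\<rbrakk> \<Longrightarrow> \<delta> (a *s x) = a * \<delta> x"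
    and e_F: "\<delta> \<in> D \<Longrightarrow> e \<delta> \<in> F"
    and D_e: "\<lbrakk>\<delta> \<in> D; \<epsilon> \<in> D; \<epsilon> \<noteq> \<delta>\<rbrakk> \<Longrightarrow> \<epsilon> (e \<delta>) \<le> 0"
    and B_sym: "B x y = B y x"
    and B_add: "B (x + y) z = B x z + B y z"
    and B_scale: "B (a *s x) z = a * B x z"
    and B_null: "\<lbrakk>z \<in> F; B z z \<le> 0; \<delta> \<in> D\<rbrakk> \<Longrightarrow> \<delta> z = 0"
    and B_e: "\<delta> \<in> D \<Longrightarrow> \<exists>t>0. \<forall>y\<in>F. B (e \<delta>) y = t * \<delta> y"
    and regular: "\<exists>h\<in>F. \<forall>\<delta>\<in>D. 0 < \<delta> h"
    and e_indep: "\<lbrakk>S \<subseteq> D; \<And>\<delta>. \<delta> \<in> S \<Longrightarrow> \<delta> (\<Sum>\<epsilon>\<in>S. c \<epsilon> *s e \<epsilon>) = 0\<rbrakk> \<Longrightarrow> (\<Sum>\<epsilon>\<in>S. c \<epsilon> *s e \<epsilon>) = 0"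
    and P_F: "\<lbrakk>S \<subseteq> D; x \<in> F\<rbrakk> \<Longrightarrow> P S x \<in> F"
    and P_zero: "\<lbrakk>S \<subseteq> D; x \<in> F; \<delta> \<in> S\<rbrakk> \<Longrightarrow> \<delta> (P S x) = 0"
    and P_span: "\<lbrakk>S \<subseteq> D; x \<in> F\<rbrakk> \<Longrightarrow> \<exists>c. x - P S x = (\<Sum>\<epsilon>\<in>S. c \<epsilon> *s e \<epsilon>)"
begin

abbreviation combination :: "('v \<Rightarrow> rat) set \<Rightarrow> (('v \<Rightarrow> rat) \<Rightarrow> rat) \<Rightarrow> 'v" where
  "combination S c \<equiv> (\<Sum>\<epsilon>\<in>S. c \<epsilon> *s e \<epsilon>)"

lemma F_sum: "(\<And>i. i \<in> I \<Longrightarrow> f i \<in> F) \<Longrightarrow> (\<Sum>i\<in>I. f i) \<in> F"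
  by (induction I rule: infinite_finite_induct) (auto simp: F_zero F_add)

lemma combination_F: "S \<subseteq> D \<Longrightarrow> combination S c \<in> F"
  by (intro F_sum F_scale e_F) auto

lemma F_diff: "\<lbrakk>x \<in> F; y \<in> F\<rbrakk> \<Longrightarrow> x - y \<in> F"
  using F_add[of x "(-1) *s y"] F_scale[of y "-1"] by simp

lemma D_diff: "\<lbrakk>\<delta> \<in> D; x \<in> F; y \<in> F\<rbrakk> \<Longrightarrow> \<delta> (x - y) = \<delta> x - \<delta> y"
  using D_add[of \<delta> "x - y" y] F_diff[of x y] by simp

lemma D_zero: "\<delta> \<in> D \<Longrightarrow> \<delta> 0 = 0"
  using D_add[of \<delta> 0 0] F_zero by simp

lemma D_sum: "\<lbrakk>\<delta> \<in> D; \<And>i. i \<in> I \<Longrightarrow> f i \<in> F\<rbrakk> \<Longrightarrow> \<delta> (\<Sum>i\<in>I. f i) = (\<Sum>i\<in>I. \<delta> (f i))"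
  by (induction I rule: infinite_finite_induct) (auto simp: D_zero D_add F_sum)

lemma D_combination: "\<lbrakk>S \<subseteq> D; \<delta> \<in> D\<rbrakk> \<Longrightarrow> \<delta> (combination S c) = (\<Sum>\<epsilon>\<in>S. c \<epsilon> * \<delta> (e \<epsilon>))"
  by (subst D_sum) (auto simp: F_scale e_F D_scale subset_iff intro!: sum.cong)

lemma B_zero: "B 0 z = 0"
  using B_add[of 0 0 z] by simp

lemma B_diff_right: "B z (x - y) = B z x - B z y"
  using B_add[of "x - y" y z] B_sym[of z x] B_sym[of z y] B_sym[of z "x - y"] by simp

lemma B_sum: "B (\<Sum>i\<in>I. f i) z = (\<Sum>i\<in>I. B (f i) z)"
  by (induction I rule: infinite_finite_induct) (auto simp: B_zero B_add)

lemma combination_diff: "combination S c - combination S d = combination S (\<lambda>\<epsilon>. c \<epsilon> - d \<epsilon>)"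
  by (simp add: scale_left_diff_distrib sum_subtractf)

lemma combination_mono: "\<lbrakk>S \<subseteq> T; T \<subseteq> D\<rbrakk> \<Longrightarrow> combination S c = combination T (\<lambda>\<epsilon>. if \<epsilon> \<in> S then c \<epsilon> else 0)"
  using finite_D finite_subset by (intro sum.mono_neutral_cong_left) auto

lemma combination_nonpos:
  assumes "S \<subseteq> D" "\<delta> \<in> D - S" "\<And>\<epsilon>. \<epsilon> \<in> S \<Longrightarrow> 0 \<le> c \<epsilon>"
  shows "\<delta> (combination S c) \<le> 0"
  using assms D_e by (subst D_combination) (auto intro!: sum_nonpos mult_nonneg_nonpos)

text \<open>If \<open>z = u - v\<close> is the splitting by the signs of the coefficients, then \<open>B(z, v) \<ge> 0\<close> and
  \<open>B(u, v) \<le> 0\<close>, hence \<open>B(v, v) \<le> 0\<close>.\<close>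

lemma nonneg_combination:
  assumes S: "S \<subseteq> D" and nonneg: "\<And>\<delta>. \<delta> \<in> S \<Longrightarrow> 0 \<le> \<delta> (combination S c)"
  shows "\<exists>d. (\<forall>\<epsilon>\<in>S. 0 \<le> d \<epsilon>) \<and> combination S c = combination S d"
proof -
  define u v where "u = combination S (\<lambda>\<epsilon>. max 0 (c \<epsilon>))" and "v = combination S (\<lambda>\<epsilon>. max 0 (- c \<epsilon>))"
  have z: "combination S c = u - v"
    unfolding u_def v_def combination_diff by (intro sum.cong) (auto simp: max_def)
  have F: "u \<in> F" "v \<in> F" "combination S c \<in> F" using combination_F[OF S] by (auto simp: u_def v_def)
  have Be: "\<exists>t>0. B (e \<epsilon>) y = t * \<epsilon> y" if "\<epsilon> \<in> S" "y \<in> F" for \<epsilon> y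
    using B_e[of \<epsilon>] that S by blast
  have "0 \<le> B v (combination S c)"
    unfolding v_def B_sum B_scale
  proof (intro sum_nonneg mult_nonneg_nonneg)
    fix \<epsilon> assume \<epsilon>: "\<epsilon> \<in> S"
    obtain t where "t > 0" "B (e \<epsilon>) (combination S c) = t * \<epsilon> (combination S c)"
      using Be[OF \<epsilon> F(3)] by blast
    then show "0 \<le> B (e \<epsilon>) (combination S c)" using nonneg[OF \<epsilon>] by simp
  qed simp
  moreover have "B v u \<le> 0"
    unfolding v_def B_sum B_scale
  proof (intro sum_nonpos)
    fix \<epsilon> assume \<epsilon>: "\<epsilon> \<in> S"
    show "max 0 (- c \<epsilon>) * B (e \<epsilon>) u \<le> 0"
    proof (cases "c \<epsilon> < 0")
      case True
      have u0: "max 0 (c \<epsilon>) *s e \<epsilon> = 0" using True by simp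
      have "u = max 0 (c \<epsilon>) *s e \<epsilon> + combination (S - {\<epsilon>}) (\<lambda>\<epsilon>. max 0 (c \<epsilon>))"
        unfolding u_def by (rule sum.remove[OF finite_subset[OF S finite_D] \<epsilon>])
      then have u: "u = combination (S - {\<epsilon>}) (\<lambda>\<epsilon>. max 0 (c \<epsilon>))" by (simp only: u0 add_0_left)
      have "\<epsilon> u \<le> 0"
        unfolding u by (rule combination_nonpos) (use S \<epsilon> in auto)
      moreover obtain t where "t > 0" "B (e \<epsilon>) u = t * \<epsilon> u" using Be[OF \<epsilon> F(1)] by blast
      ultimately have "B (e \<epsilon>) u \<le> 0" by (simp add: mult_nonneg_nonpos)
      then show ?thesis by (intro mult_nonneg_nonpos) auto
    qed simp
  qed
  moreover have "B v (combination S c) = B v u - B v v"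
    unfolding z by (rule B_diff_right)
  ultimately have "B v v \<le> 0" by simp
  then have "\<delta> v = 0" if "\<delta> \<in> S" for \<delta> using B_null[OF F(2) _ subsetD[OF S that]] by blast
  then have "v = 0" unfolding v_def by (rule e_indep[OF S])
  then show ?thesis using z by (intro exI[of _ "\<lambda>\<epsilon>. max 0 (c \<epsilon>)"]) (auto simp: u_def)
qed

lemma P_unique:
  assumes "S \<subseteq> D" "x \<in> F" "y \<in> F" "\<And>\<delta>. \<delta> \<in> S \<Longrightarrow> \<delta> y = 0" "x - y = combination S c"
  shows "P S x = y"
proof -
  obtain d where d: "x - P S x = combination S d" using P_span[OF assms(1,2)] by blast
  have eq: "P S x - y = combination S (\<lambda>\<epsilon>. c \<epsilon> - d \<epsilon>)"
    unfolding combination_diff[symmetric] d[symmetric] assms(5)[symmetric] by simp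
  have "\<delta> (P S x - y) = 0" if "\<delta> \<in> S" for \<delta>
    using D_diff[of \<delta> "P S x" y] that assms P_F[OF assms(1,2)] P_zero[OF assms(1,2) that] by auto
  then have "combination S (\<lambda>\<epsilon>. c \<epsilon> - d \<epsilon>) = 0" by (intro e_indep[OF assms(1)]) (simp add: eq)
  then show ?thesis using eq by simp
qed

lemma P_shift:
  assumes "S \<subseteq> D" "x \<in> F" "y \<in> F" "x - y = combination S c"
  shows "P S x = P S y"
proof -
  obtain d where d: "y - P S y = combination S d" using P_span[OF assms(1,3)] by blast
  have "x - P S y = combination S (\<lambda>\<epsilon>. c \<epsilon> + d \<epsilon>)"
    using assms(4) d by (simp add: scale_left_distrib sum.distrib algebra_simps)
  then show ?thesis
    by (rule P_unique[OF assms(1,2) P_F[OF assms(1,3)], rotated]) (rule P_zero[OF assms(1,3)])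
qed

lemma P_P:
  assumes "S \<subseteq> T" "T \<subseteq> D" "x \<in> F" shows "P T (P S x) = P T x"
proof -
  have S: "S \<subseteq> D" using assms by blast
  obtain c where c: "x - P S x = combination S c" using P_span[OF S assms(3)] by blast
  then show ?thesis
    using P_shift[OF assms(2,3) P_F[OF S assms(3)]] combination_mono[OF assms(1,2), of c] by metis
qed

lemma P_step_span:
  assumes "S \<subseteq> T" "T \<subseteq> D" "x \<in> F" shows "\<exists>c. P S x - P T x = combination T c"
  using P_span[OF assms(2) P_F[of S x]] P_P[OF assms] assms by (metis dual_order.trans)

lemma nonneg_P:
  assumes "S \<subseteq> D" "x \<in> F" "\<And>\<delta>. \<delta> \<in> S \<Longrightarrow> 0 \<le> \<delta> x"
  shows "\<exists>c. (\<forall>\<epsilon>\<in>S. 0 \<le> c \<epsilon>) \<and> x - P S x = combination S c"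
proof -
  obtain c where c: "x - P S x = combination S c" using P_span[OF assms(1,2)] by blast
  have "\<delta> (x - P S x) = \<delta> x" if "\<delta> \<in> S" for \<delta>
    using D_diff[of \<delta> x "P S x"] P_zero[OF assms(1,2) that] P_F[OF assms(1,2)] that assms by auto
  then show ?thesis using nonneg_combination[OF assms(1), of c] assms(3) c by metis
qed

lemma P_insert_nonneg:
  assumes "insert \<alpha> S \<subseteq> D" "x \<in> F" "0 \<le> \<alpha> (P S x)"
  shows "\<exists>c. (\<forall>\<epsilon>\<in>insert \<alpha> S. 0 \<le> c \<epsilon>) \<and> P S x - P (insert \<alpha> S) x = combination (insert \<alpha> S) c"
proof -
  have S: "S \<subseteq> D" using assms by blast
  have "0 \<le> \<delta> (P S x)" if "\<delta> \<in> insert \<alpha> S" for \<delta>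
    using that assms(3) P_zero[OF S assms(2), of \<delta>] by (cases "\<delta> = \<alpha>") auto
  then have "\<exists>c. (\<forall>\<epsilon>\<in>insert \<alpha> S. 0 \<le> c \<epsilon>)
      \<and> P S x - P (insert \<alpha> S) (P S x) = combination (insert \<alpha> S) c"
    by (rule nonneg_P[OF assms(1) P_F[OF S assms(2)]])
  moreover have "P (insert \<alpha> S) (P S x) = P (insert \<alpha> S) x" by (rule P_P) (use assms in auto)
  ultimately show ?thesis by simp
qed

lemma allowed_mono:
  assumes "insert \<alpha> S \<subseteq> D" "x \<in> F" "0 \<le> \<alpha> (P S x)" "\<beta> \<in> D - insert \<alpha> S"
  shows "\<beta> (P S x) \<le> \<beta> (P (insert \<alpha> S) x)"
proof -
  obtain c where c: "\<forall>\<epsilon>\<in>insert \<alpha> S. 0 \<le> c \<epsilon>" "P S x - P (insert \<alpha> S) x = combination (insert \<alpha> S) c"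
    using P_insert_nonneg[OF assms(1-3)] by blast
  have "\<beta> (P S x) - \<beta> (P (insert \<alpha> S) x) = \<beta> (combination (insert \<alpha> S) c)"
    using D_diff[of \<beta> "P S x" "P (insert \<alpha> S) x"] assms P_F c(2) by auto
  also have "\<dots> \<le> 0" using combination_nonpos[OF assms(1,4)] c(1) by blast
  finally show ?thesis by simp
qed

lemma cone_antisym:
  assumes "\<And>\<epsilon>. \<epsilon> \<in> D \<Longrightarrow> 0 \<le> c \<epsilon>" "\<And>\<epsilon>. \<epsilon> \<in> D \<Longrightarrow> 0 \<le> d \<epsilon>" "combination D c = - combination D d"
  shows "combination D c = 0"
proof -
  obtain h where h: "h \<in> F" "\<forall>\<delta>\<in>D. 0 < \<delta> h" using regular by blast
  have Bh: "0 < B (e \<epsilon>) h" if \<epsilon>: "\<epsilon> \<in> D" for \<epsilon>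
  proof -
    obtain t where "t > 0" "B (e \<epsilon>) h = t * \<epsilon> h" using B_e[OF \<epsilon>] h(1) by blast
    then show ?thesis using bspec[OF h(2) \<epsilon>] by simp
  qed
  have nn: "0 \<le> c' \<epsilon> * B (e \<epsilon>) h" if "\<epsilon> \<in> D" "0 \<le> c' \<epsilon>" for c' :: "_ \<Rightarrow> rat" and \<epsilon>
    using Bh[OF that(1)] that(2) by simp
  have "B (combination D c) h + B (combination D d) h = 0"
    using assms(3) B_add[of "combination D c" "combination D d" h] B_zero by simp
  then have "(\<Sum>\<epsilon>\<in>D. c \<epsilon> * B (e \<epsilon>) h) + (\<Sum>\<epsilon>\<in>D. d \<epsilon> * B (e \<epsilon>) h) = 0"
    by (simp add: B_sum B_scale)
  moreover have "0 \<le> (\<Sum>\<epsilon>\<in>D. c \<epsilon> * B (e \<epsilon>) h)"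
    by (rule sum_nonneg) (rule nn, assumption, rule assms(1))
  moreover have "0 \<le> (\<Sum>\<epsilon>\<in>D. d \<epsilon> * B (e \<epsilon>) h)"
    by (rule sum_nonneg) (rule nn, assumption, rule assms(2))
  ultimately have "(\<Sum>\<epsilon>\<in>D. c \<epsilon> * B (e \<epsilon>) h) = 0" by simp
  then have null: "\<forall>\<epsilon>\<in>D. c \<epsilon> * B (e \<epsilon>) h = 0"
    by (subst (asm) sum_nonneg_eq_0_iff[OF finite_D]) (rule nn, assumption, rule assms(1))
  have "c \<epsilon> = 0" if "\<epsilon> \<in> D" for \<epsilon> using bspec[OF null that] Bh[OF that] by simp
  then show ?thesis by simp
qed

lemma step_iff:
  assumes "insert \<alpha> S \<subseteq> D" "\<alpha> \<notin> S" "x \<in> F"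
  shows "(\<exists>c. (\<forall>\<epsilon>\<in>D. 0 \<le> c \<epsilon>) \<and> P S x - P (insert \<alpha> S) x = combination D c) \<and> P (insert \<alpha> S) x \<noteq> P S x
    \<longleftrightarrow> 0 < \<alpha> (P S x)"
proof
  have S: "S \<subseteq> D" using assms by blast
  have \<alpha>: "\<alpha> \<in> D" using assms by blast
  let ?y = "P S x" and ?y' = "P (insert \<alpha> S) x"
  have F: "?y \<in> F" "?y' \<in> F" using P_F assms S by auto
  have \<alpha>': "\<alpha> ?y' = 0" using P_zero[OF assms(1,3)] by simp
  {
    assume pos: "0 < \<alpha> ?y"
    obtain c where c: "\<forall>\<epsilon>\<in>insert \<alpha> S. 0 \<le> c \<epsilon>" "?y - ?y' = combination (insert \<alpha> S) c"
      using P_insert_nonneg[OF assms(1,3)] pos by auto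
    then have "?y - ?y' = combination D (\<lambda>\<epsilon>. if \<epsilon> \<in> insert \<alpha> S then c \<epsilon> else 0)"
      using combination_mono[OF assms(1) order_refl, of c] by simp
    moreover have "?y' \<noteq> ?y" using pos \<alpha>' by auto
    ultimately show "(\<exists>c. (\<forall>\<epsilon>\<in>D. 0 \<le> c \<epsilon>) \<and> ?y - ?y' = combination D c) \<and> ?y' \<noteq> ?y"
      using c(1) by (intro conjI exI[of _ "\<lambda>\<epsilon>. if \<epsilon> \<in> insert \<alpha> S then c \<epsilon> else 0"]) auto
  next
    assume *: "(\<exists>c. (\<forall>\<epsilon>\<in>D. 0 \<le> c \<epsilon>) \<and> ?y - ?y' = combination D c) \<and> ?y' \<noteq> ?y"
    then obtain c where c: "\<And>\<epsilon>. \<epsilon> \<in> D \<Longrightarrow> 0 \<le> c \<epsilon>" "?y - ?y' = combination D c" by blast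
    show "0 < \<alpha> ?y"
    proof (rule ccontr)
      assume neg: "\<not> 0 < \<alpha> ?y"
      obtain d where d: "?y - ?y' = combination (insert \<alpha> S) d"
        using P_step_span[of S "insert \<alpha> S" x] assms by blast
      have "combination (insert \<alpha> S) (\<lambda>\<epsilon>. - d \<epsilon>) = - (?y - ?y')"
        using d by (simp add: sum_negf)
      moreover have "- (?y - ?y') = ?y' - ?y" by simp
      ultimately have d': "combination (insert \<alpha> S) (\<lambda>\<epsilon>. - d \<epsilon>) = ?y' - ?y" by simp
      have "0 \<le> \<delta> (combination (insert \<alpha> S) (\<lambda>\<epsilon>. - d \<epsilon>))" if "\<delta> \<in> insert \<alpha> S" for \<delta>
        using D_diff[of \<delta> ?y' ?y] F that assms(1) neg \<alpha>' P_zero[OF assms(1,3) that] P_zero[OF S assms(3), of \<delta>]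
        unfolding d' by auto
      then obtain f
        where f: "\<forall>\<epsilon>\<in>insert \<alpha> S. 0 \<le> f \<epsilon>" "?y' - ?y = combination (insert \<alpha> S) f"
        using nonneg_combination[where S = "insert \<alpha> S" and c = "\<lambda>\<epsilon>. - d \<epsilon>", OF assms(1)] unfolding d' by blast
      let ?f = "\<lambda>\<epsilon>. if \<epsilon> \<in> insert \<alpha> S then f \<epsilon> else 0"
      have "combination D c = - combination D ?f"
        using c(2) f(2) combination_mono[OF assms(1) order_refl, of f]
        by (metis minus_diff_eq)
      then have "combination D c = 0" using cone_antisym[of c ?f] c(1) f(1) by auto
      then show False using * c(2) by simp
    qed
  }
qed

end

section \<open>Relative roots of a quasisplit group\<close>

context based_root_datum
begin

abbreviation smul (infixr \<open>*s\<close> 75) where "c *s x \<equiv> scaleQ G c x"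

lemma vs: "vector_space (scaleQ G)"
  using cocharacter_space by (simp add: finite_dimensional_vector_space_def)

lemma abs_root_linear: "\<alpha> \<in> abs_roots G \<Longrightarrow> Vector_Spaces.linear (scaleQ G) (*) \<alpha>"
  using abs_roots_characters by (auto simp: characters_def)

lemma abs_root_add: "\<alpha> \<in> abs_roots G \<Longrightarrow> \<alpha> (x + y) = \<alpha> x + \<alpha> y"
  using module_hom.add[OF Vector_Spaces.linear.axioms(3)[OF abs_root_linear]] .

lemma abs_root_scale: "\<alpha> \<in> abs_roots G \<Longrightarrow> \<alpha> (a *s x) = a * \<alpha> x"
  using module_hom.scale[OF Vector_Spaces.linear.axioms(3)[OF abs_root_linear]] .

lemma abs_root_diff: "\<alpha> \<in> abs_roots G \<Longrightarrow> \<alpha> (x - y) = \<alpha> x - \<alpha> y"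
  using abs_root_add[of \<alpha> "x - y" y] by simp

lemma abs_root_integral: "\<lbrakk>\<alpha> \<in> abs_roots G; x \<in> cocharacters G\<rbrakk> \<Longrightarrow> \<alpha> x \<in> \<int>"
  using abs_roots_characters by (auto simp: characters_def)

text \<open>Two coroots \<open>c, d\<close> of a root \<open>\<gamma>\<close> give the map \<open>x \<mapsto> x + \<gamma>(x) (c - d)\<close> preserving the finite set of
  coroots, hence \<open>c = d\<close>.\<close>

lemma coroot_reflection:
  assumes \<alpha>: "\<alpha> \<in> abs_roots G" and \<beta>: "\<beta> \<in> abs_roots G"
  shows "coroot G (\<lambda>x. \<beta> x - \<beta> (coroot G \<alpha>) * \<alpha> x) = coroot G \<beta> - \<alpha> (coroot G \<beta>) *s coroot G \<alpha>"
proof -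
  interpret vector_space "scaleQ G" by (rule vs)
  define \<gamma> where "\<gamma> = (\<lambda>x. \<beta> x - \<beta> (coroot G \<alpha>) * \<alpha> x)"
  have \<gamma>: "\<gamma> \<in> abs_roots G" using reflection_root[OF assms] by (simp add: \<gamma>_def)
  define c d where "c = coroot G \<gamma>" and "d = coroot G \<beta> - \<alpha> (coroot G \<beta>) *s coroot G \<alpha>"
  let ?r = "abs_reflection G"
  have r: "?r \<delta> x \<in> coroot G ` abs_roots G" if "\<delta> \<in> abs_roots G" "x \<in> coroot G ` abs_roots G" for \<delta> x
    using reflection_coroot[OF that(1)] that(2) by auto
  have \<gamma>c: "\<gamma> c = 2" using root_coroot[OF \<gamma>] by (simp add: c_def)
  have \<gamma>d: "\<gamma> d = 2"
    using \<alpha> \<beta> by (simp add: \<gamma>_def d_def abs_root_diff abs_root_scale root_coroot algebra_simps)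
  have lin: "?r \<alpha> (y - b *s z) = ?r \<alpha> y - b *s ?r \<alpha> z" for b y z
    using \<alpha> by (simp add: abs_reflection_def abs_root_diff abs_root_scale
        scale_right_diff_distrib scale_left_diff_distrib)
  have inv: "?r \<alpha> (?r \<alpha> x) = x" for x
    using \<alpha> by (simp add: abs_reflection_def abs_root_diff abs_root_scale root_coroot scale_left_diff_distrib)
  have "\<beta> (?r \<alpha> x) = \<gamma> x" for x
    using \<beta> by (simp add: abs_reflection_def \<gamma>_def abs_root_diff abs_root_scale)
  then have "?r \<alpha> (?r \<beta> (?r \<alpha> x)) = ?r \<alpha> (?r \<alpha> x - \<gamma> x *s coroot G \<beta>)" for x
    by (simp add: abs_reflection_def[of G \<beta>])
  then have rrr: "?r \<alpha> (?r \<beta> (?r \<alpha> x)) = x - \<gamma> x *s d" for x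
    unfolding lin inv by (simp add: d_def abs_reflection_def)
  have t: "?r \<gamma> (?r \<alpha> (?r \<beta> (?r \<alpha> x))) = x + \<gamma> x *s (c - d)" for x
  proof -
    have "\<gamma> (x - \<gamma> x *s d) = - \<gamma> x" using \<gamma> \<gamma>d by (simp add: abs_root_diff abs_root_scale)
    then show ?thesis unfolding rrr
      by (simp add: abs_reflection_def[of G \<gamma>] c_def[symmetric] scale_right_diff_distrib)
  qed
  have "c + of_nat n *s (2 *s (c - d)) \<in> coroot G ` abs_roots G" for n
  proof (induction n)
    case 0
    show ?case using \<gamma> by (simp add: c_def)
  next
    case (Suc n)
    let ?x = "c + of_nat n *s (2 *s (c - d))"
    have "?x + \<gamma> ?x *s (c - d) \<in> coroot G ` abs_roots G" using r \<alpha> \<beta> \<gamma> Suc t[of ?x] by metis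
    moreover have "\<gamma> ?x = 2" using \<gamma> \<gamma>c \<gamma>d by (simp add: abs_root_add abs_root_scale abs_root_diff)
    ultimately show ?case by (simp add: scale_left_distrib algebra_simps)
  qed
  then have "2 *s (c - d) = 0" by (rule finite_progression[OF finite_imageI[OF finite_abs_roots] _ inj_of_nat])
  then have "c = d" by (simp add: scale_eq_0_iff)
  then show ?thesis by (simp add: c_def d_def \<gamma>_def)
qed

lemma abs_pos_roots_eq: "abs_pos_roots G = positive_roots (abs_roots G) (abs_simple_roots G)"
  by (simp add: abs_pos_roots_def positive_roots_def)

lemma root_base: "root_base (scaleQ G) (abs_roots G) (coroot G) (abs_simple_roots G)"
proof (rule root_base.intro[OF vs root_base_axioms.intro])
  show "c \<beta> = 0" if "\<And>x. (\<Sum>\<beta>\<in>abs_simple_roots G. c \<beta> * \<beta> x) = 0" "\<beta> \<in> abs_simple_roots G" for c \<beta>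
    using abs_simple_roots_independent[OF that] .
qed (use finite_abs_roots abs_root_add abs_root_scale abs_root_integral coroot_cocharacter root_coroot
      reflection_root coroot_reflection reduced abs_simple_roots abs_roots_pos_or_neg abs_pos_roots_eq in auto)

sublocale root_base "scaleQ G" "abs_roots G" "coroot G" "abs_simple_roots G"
  rewrites "positive_roots (abs_roots G) (abs_simple_roots G) = abs_pos_roots G"
  using root_base abs_pos_roots_eq by auto

lemma abs_reflection_eq: "abs_reflection G = refl"
  by (intro ext) (simp add: abs_reflection_def refl_def)

lemma abs_weyl_group_eq: "abs_weyl_group G = weyl"
  unfolding abs_weyl_group_def abs_reflection_eq by (rule generate_refl)

end

context quasisplit_root_datum
begin

definition gal :: "('v \<Rightarrow> 'v) set" where "gal = act G ` carrier (Gal G)"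

definition avg :: "'v \<Rightarrow> 'v" where "avg x = (1 / of_nat (card gal)) *s (\<Sum>h\<in>gal. h x)"

lemma finite_gal: "finite gal"
  using act_finite by (simp add: gal_def)

lemma gal_id: "id \<in> gal"
proof -
  have "act G \<one>\<^bsub>Gal G\<^esub> = id" using act_one by auto
  then show ?thesis unfolding gal_def
    using group.is_monoid[OF Gal_group] monoid.one_closed image_eqI by metis
qed

lemma card_gal: "card gal \<noteq> 0"
  using finite_gal gal_id by auto

lemma act_inv:
  assumes "\<gamma> \<in> carrier (Gal G)"
  shows "act G \<gamma> \<circ> act G (inv\<^bsub>Gal G\<^esub> \<gamma>) = id" "act G (inv\<^bsub>Gal G\<^esub> \<gamma>) \<circ> act G \<gamma> = id"
  using assms act_mult[of \<gamma> "inv\<^bsub>Gal G\<^esub> \<gamma>"] act_mult[of "inv\<^bsub>Gal G\<^esub> \<gamma>" \<gamma>] act_one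
    group.inv_closed[OF Gal_group assms] group.r_inv[OF Gal_group assms] group.l_inv[OF Gal_group assms]
  by auto

lemma gal_comp: "\<lbrakk>h \<in> gal; k \<in> gal\<rbrakk> \<Longrightarrow> h \<circ> k \<in> gal"
proof -
  assume "h \<in> gal" "k \<in> gal"
  then obtain \<gamma> \<delta> where g: "\<gamma> \<in> carrier (Gal G)" "\<delta> \<in> carrier (Gal G)" "h = act G \<gamma>" "k = act G \<delta>"
    by (auto simp: gal_def)
  then have "h \<circ> k = act G (\<gamma> \<otimes>\<^bsub>Gal G\<^esub> \<delta>)" using act_mult by auto
  then show ?thesis using g group.is_monoid[OF Gal_group] monoid.m_closed unfolding gal_def by fast
qed

lemma gal_inverse:
  assumes "h \<in> gal" obtains k where "k \<in> gal" "h \<circ> k = id" "k \<circ> h = id"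
  using assms act_inv group.inv_closed[OF Gal_group] unfolding gal_def by blast

lemma gal_linear: "h \<in> gal \<Longrightarrow> Vector_Spaces.linear (scaleQ G) (scaleQ G) h"
  using act_linear by (auto simp: gal_def)

lemma gal_add: "h \<in> gal \<Longrightarrow> h (x + y) = h x + h y"
  using module_hom.add[OF Vector_Spaces.linear.axioms(3)[OF gal_linear]] .

lemma gal_scale: "h \<in> gal \<Longrightarrow> h (a *s x) = a *s h x"
  using module_hom.scale[OF Vector_Spaces.linear.axioms(3)[OF gal_linear]] .

lemma gal_diff: "h \<in> gal \<Longrightarrow> h (x - y) = h x - h y"
  using gal_add[of h "x - y" y] by simp

lemma gal_zero: "h \<in> gal \<Longrightarrow> h 0 = 0"
  using gal_diff[of h 0 0] by simp

lemma gal_sum: "h \<in> gal \<Longrightarrow> h (\<Sum>i\<in>I. f i) = (\<Sum>i\<in>I. h (f i))"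
  by (induction I rule: infinite_finite_induct) (auto simp: gal_zero gal_add)

lemma frakA_iff: "x \<in> frakA G \<longleftrightarrow> (\<forall>h\<in>gal. h x = x)"
  by (auto simp: frakA_def gal_def)

lemma gal_fixes: "\<lbrakk>h \<in> gal; x \<in> frakA G\<rbrakk> \<Longrightarrow> h x = x"
  by (simp add: frakA_iff)

lemma gal_cocharacter: "\<lbrakk>h \<in> gal; x \<in> cocharacters G\<rbrakk> \<Longrightarrow> h x \<in> cocharacters G"
  using act_cocharacters by (auto simp: gal_def)

lemma gal_root: "\<lbrakk>h \<in> gal; \<alpha> \<in> abs_roots G\<rbrakk> \<Longrightarrow> \<alpha> \<circ> h \<in> abs_roots G"
  and gal_simple_root: "\<lbrakk>h \<in> gal; \<beta> \<in> abs_simple_roots G\<rbrakk> \<Longrightarrow> \<beta> \<circ> h \<in> abs_simple_roots G"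
  and gal_coroot: "\<lbrakk>h \<in> gal; \<alpha> \<in> abs_roots G\<rbrakk> \<Longrightarrow> h (coroot G (\<alpha> \<circ> h)) = coroot G \<alpha>"
proof -
  assume "h \<in> gal"
  then obtain \<gamma> where \<gamma>: "\<gamma> \<in> carrier (Gal G)" "h = act G \<gamma>" by (auto simp: gal_def)
  let ?i = "inv\<^bsub>Gal G\<^esub> \<gamma>"
  have i: "?i \<in> carrier (Gal G)" "inv\<^bsub>Gal G\<^esub> ?i = \<gamma>"
    using group.inv_closed[OF Gal_group \<gamma>(1)] group.inv_inv[OF Gal_group \<gamma>(1)] by auto
  show "\<alpha> \<circ> h \<in> abs_roots G" if "\<alpha> \<in> abs_roots G"
    using act_roots[OF i(1) that] i \<gamma> by simp
  show "\<beta> \<circ> h \<in> abs_simple_roots G" if "\<beta> \<in> abs_simple_roots G"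
    using act_simple_roots[OF i(1) that] i \<gamma> by simp
  show "h (coroot G (\<alpha> \<circ> h)) = coroot G \<alpha>" if "\<alpha> \<in> abs_roots G"
    using act_coroots[OF i(1) that] i \<gamma> fun_cong[OF act_inv(1)[OF \<gamma>(1)], of "coroot G \<alpha>"] by simp
qed

lemma gal_bij_roots: assumes "h \<in> gal" shows "bij_betw (\<lambda>\<alpha>. \<alpha> \<circ> h) (abs_roots G) (abs_roots G)"
proof -
  obtain k where k: "k \<in> gal" "h \<circ> k = id" "k \<circ> h = id" using gal_inverse[OF assms] .
  show ?thesis
    by (rule bij_betw_byWitness[where f' = "\<lambda>\<alpha>. \<alpha> \<circ> k"])
      (use k assms gal_root in \<open>auto simp: comp_assoc\<close>)
qed

lemma form_gal: "h \<in> gal \<Longrightarrow> form (h x) (h y) = form x y"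
  using sum.reindex_bij_betw[OF gal_bij_roots, of h "\<lambda>\<alpha>. \<alpha> x * \<alpha> y"] by (simp add: form_def)

lemma gal_shift: assumes "k \<in> gal" shows "bij_betw (\<lambda>h. h \<circ> k) gal gal" "bij_betw (\<lambda>h. k \<circ> h) gal gal"
proof -
  obtain l where l: "l \<in> gal" "k \<circ> l = id" "l \<circ> k = id" using gal_inverse[OF assms] .
  have "(h \<circ> k) \<circ> l = h" "(h \<circ> l) \<circ> k = h" "k \<circ> (l \<circ> h) = h" "l \<circ> (k \<circ> h) = h" for h :: "'v \<Rightarrow> 'v"
    using l by (simp_all only: comp_assoc comp_id) (simp_all only: comp_assoc[symmetric] id_comp l)
  note * = this
  show "bij_betw (\<lambda>h. h \<circ> k) gal gal"
    by (rule bij_betw_byWitness[where f' = "\<lambda>h. h \<circ> l"]) (simp_all only: *, use gal_comp l assms in auto)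
  show "bij_betw (\<lambda>h. k \<circ> h) gal gal"
    by (rule bij_betw_byWitness[where f' = "\<lambda>h. l \<circ> h"]) (simp_all only: *, use gal_comp l assms in auto)
qed

lemma avg_frakA: "avg x \<in> frakA G"
  unfolding frakA_iff
proof
  fix k assume k: "k \<in> gal"
  have "k (\<Sum>h\<in>gal. h x) = (\<Sum>h\<in>gal. (k \<circ> h) x)" using k by (simp add: gal_sum)
  also have "\<dots> = (\<Sum>h\<in>gal. h x)" by (rule sum.reindex_bij_betw[OF gal_shift(2)[OF k]])
  finally show "k (avg x) = avg x" using k by (simp add: avg_def gal_scale)
qed

lemma avg_gal: assumes k: "k \<in> gal" shows "avg (k x) = avg x"
proof -
  have "(\<Sum>h\<in>gal. (h \<circ> k) x) = (\<Sum>h\<in>gal. h x)" by (rule sum.reindex_bij_betw[OF gal_shift(1)[OF k]])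
  then show ?thesis by (simp add: avg_def)
qed

lemma sum_constant_scale: "finite I \<Longrightarrow> (\<Sum>i\<in>I. x) = of_nat (card I) *s x"
  by (induction I rule: finite_induct) (auto simp: scale_left_distrib)

lemma avg_id: "x \<in> frakA G \<Longrightarrow> avg x = x"
proof -
  assume "x \<in> frakA G"
  then have "(\<Sum>h\<in>gal. h x) = (\<Sum>h\<in>gal. x)" by (intro sum.cong) (auto simp: gal_fixes)
  then show ?thesis using card_gal finite_gal by (simp add: avg_def sum_constant_scale)
qed

lemma avg_add: "avg (x + y) = avg x + avg y"
  by (simp add: avg_def gal_add sum.distrib scale_right_distrib)

lemma avg_scale: "avg (a *s x) = a *s avg x"
  by (simp add: avg_def gal_scale scale_sum_right[symmetric] mult.commute)

lemma avg_diff: "avg (x - y) = avg x - avg y"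
  using avg_add[of "x - y" y] by simp

lemma avg_zero: "avg 0 = 0"
  using avg_diff[of 0 0] by simp

lemma avg_sum: "avg (\<Sum>i\<in>I. f i) = (\<Sum>i\<in>I. avg (f i))"
  by (induction I rule: infinite_finite_induct) (auto simp: avg_zero avg_add)

lemma Gal_average_eq: "Gal_average G x = avg x"
proof -
  define orbit where "orbit = (\<lambda>h. h x) ` gal"
  have orb: "(\<lambda>\<gamma>. act G \<gamma> x) ` carrier (Gal G) = orbit" by (auto simp: orbit_def gal_def)
  have fin: "finite orbit" "card orbit \<noteq> 0" using finite_gal gal_id by (auto simp: orbit_def)
  define y where "y = (1 / of_nat (card orbit)) *s (\<Sum>z\<in>orbit. z)"
  have "Gal_average G x = y" unfolding Gal_average_def orb y_def Let_def ..
  moreover have "y \<in> frakA G"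
    unfolding frakA_iff
  proof
    fix k assume k: "k \<in> gal"
    obtain l where l: "l \<in> gal" "k \<circ> l = id" "l \<circ> k = id" using gal_inverse[OF k] .
    have kl: "k (l z) = z" "l (k z) = z" for z using fun_cong[OF l(2), of z] fun_cong[OF l(3), of z] by auto
    have st: "m z \<in> orbit" if m: "m \<in> gal" and z: "z \<in> orbit" for m z
    proof -
      obtain h where "h \<in> gal" "z = h x" using z by (auto simp: orbit_def)
      then show ?thesis using gal_comp[OF m, of h] unfolding orbit_def
        by (intro image_eqI[of _ _ "m \<circ> h"]) auto
    qed
    have "bij_betw k orbit orbit"
      by (rule bij_betw_byWitness[where f' = l]) (use kl st k l in auto)
    from sum.reindex_bij_betw[OF this, of "\<lambda>z. z"] show "k y = y"
      using k by (simp add: y_def gal_scale gal_sum)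
  qed
  moreover have "avg y = avg x"
  proof -
    have "(\<Sum>z\<in>orbit. avg z) = (\<Sum>z\<in>orbit. avg x)"
      by (intro sum.cong) (auto simp: orbit_def avg_gal)
    then show ?thesis using fin by (simp add: y_def avg_scale avg_sum sum_constant_scale)
  qed
  ultimately show ?thesis using avg_id by simp
qed

lemma root_avg: "\<alpha> \<in> abs_roots G \<Longrightarrow> \<alpha> (avg x) = 1 / of_nat (card gal) * (\<Sum>h\<in>gal. \<alpha> (h x))"
  by (simp add: avg_def root_scale root_sum)

lemma frakA_subspace:
  "0 \<in> frakA G" "\<lbrakk>x \<in> frakA G; y \<in> frakA G\<rbrakk> \<Longrightarrow> x + y \<in> frakA G" "x \<in> frakA G \<Longrightarrow> a *s x \<in> frakA G"
  "\<lbrakk>x \<in> frakA G; y \<in> frakA G\<rbrakk> \<Longrightarrow> x - y \<in> frakA G"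
  by (auto simp: frakA_iff gal_add gal_scale gal_zero gal_diff)

subsection \<open>Simple relative roots and coroots\<close>

definition rel :: "('v \<Rightarrow> rat) \<Rightarrow> 'v \<Rightarrow> rat" where "rel \<beta> = restrict \<beta> (frakA G)"

definition over :: "('v \<Rightarrow> rat) set \<Rightarrow> ('v \<Rightarrow> rat) set" where
  "over S = {\<beta> \<in> abs_simple_roots G. rel \<beta> \<in> S}"

lemma rel_apply: "x \<in> frakA G \<Longrightarrow> rel \<beta> x = \<beta> x"
  by (simp add: rel_def)

lemma rel_gal: "h \<in> gal \<Longrightarrow> rel (\<beta> \<circ> h) = rel \<beta>"
  by (auto simp: rel_def restrict_def gal_fixes)

lemma prescribed_frakA:
  assumes "\<And>h \<beta>. \<lbrakk>h \<in> gal; \<beta> \<in> abs_simple_roots G\<rbrakk> \<Longrightarrow> f (\<beta> \<circ> h) = f \<beta>"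
  obtains x where "x \<in> frakA G" "\<And>\<beta>. \<beta> \<in> abs_simple_roots G \<Longrightarrow> \<beta> x = f \<beta>"
proof -
  obtain y where y: "\<forall>\<beta>\<in>abs_simple_roots G. \<beta> y = f \<beta>" using prescribed_values by blast
  have "\<beta> (avg y) = f \<beta>" if \<beta>: "\<beta> \<in> abs_simple_roots G" for \<beta>
  proof -
    have "(\<Sum>h\<in>gal. \<beta> (h y)) = (\<Sum>h\<in>gal. f \<beta>)"
    proof (rule sum.cong)
      fix h assume h: "h \<in> gal"
      show "\<beta> (h y) = f \<beta>"
        using bspec[OF y gal_simple_root[OF h \<beta>]] assms[OF h \<beta>] by simp
    qed simp
    then show ?thesis using card_gal by (simp add: root_avg[OF base_root[OF \<beta>]])
  qed
  then show ?thesis using that avg_frakA by blast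
qed

lemma rel_eq_iff:
  assumes "\<beta> \<in> abs_simple_roots G" "\<beta>' \<in> abs_simple_roots G"
  shows "rel \<beta> = rel \<beta>' \<longleftrightarrow> (\<exists>h\<in>gal. \<beta>' = \<beta> \<circ> h)"
proof
  assume eq: "rel \<beta> = rel \<beta>'"
  define f where "f = (\<lambda>\<gamma>. if \<exists>h\<in>gal. \<gamma> = \<beta> \<circ> h then 1 else (0::rat))"
  have "(\<exists>k\<in>gal. \<gamma> \<circ> h = \<beta> \<circ> k) \<longleftrightarrow> (\<exists>k\<in>gal. \<gamma> = \<beta> \<circ> k)" if h: "h \<in> gal" for h and \<gamma> :: "'v \<Rightarrow> rat"
  proof
    obtain l where l: "l \<in> gal" "h \<circ> l = id" "l \<circ> h = id" using gal_inverse[OF h] .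
    assume "\<exists>k\<in>gal. \<gamma> \<circ> h = \<beta> \<circ> k"
    then obtain k where k: "k \<in> gal" "\<gamma> \<circ> h = \<beta> \<circ> k" by blast
    have "\<gamma> = \<gamma> \<circ> (h \<circ> l)" by (simp only: l comp_id)
    also have "\<dots> = \<beta> \<circ> (k \<circ> l)" by (simp only: comp_assoc[symmetric] k)
    finally show "\<exists>k\<in>gal. \<gamma> = \<beta> \<circ> k" using gal_comp[OF k(1) l(1)] by blast
  next
    assume "\<exists>k\<in>gal. \<gamma> = \<beta> \<circ> k"
    then obtain k where k: "k \<in> gal" "\<gamma> = \<beta> \<circ> k" by blast
    have "\<gamma> \<circ> h = \<beta> \<circ> (k \<circ> h)" by (simp only: k comp_assoc)
    then show "\<exists>k\<in>gal. \<gamma> \<circ> h = \<beta> \<circ> k" using gal_comp[OF k(1) h] by blast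
  qed
  then have "f (\<gamma> \<circ> h) = f \<gamma>" if "h \<in> gal" for h \<gamma> using that by (simp only: f_def)
  then obtain x where x: "x \<in> frakA G" "\<And>\<gamma>. \<gamma> \<in> abs_simple_roots G \<Longrightarrow> \<gamma> x = f \<gamma>"
    using prescribed_frakA[of f] by blast
  have "\<exists>h\<in>gal. \<beta> = \<beta> \<circ> h" using gal_id by (intro bexI[of _ id]) simp_all
  then have "f \<beta> = 1" by (simp only: f_def if_True)
  then have "f \<beta>' = 1"
    using x(2)[OF assms(1)] x(2)[OF assms(2)] fun_cong[OF eq, of x] x(1) by (simp add: rel_apply)
  then show "\<exists>h\<in>gal. \<beta>' = \<beta> \<circ> h" unfolding f_def by (metis zero_neq_one)
qed (use rel_gal in auto)

lemma regular_frakA: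
  obtains x where "x \<in> frakA G" "\<forall>\<beta>\<in>abs_simple_roots G. \<beta> x = 1"
proof (rule prescribed_frakA[of "\<lambda>_. 1"])
  fix x assume "x \<in> frakA G" "\<And>\<beta>. \<beta> \<in> abs_simple_roots G \<Longrightarrow> \<beta> x = 1"
  then show thesis by (intro that ballI)
qed simp

lemma pos_root_regular:
  assumes "\<alpha> \<in> abs_pos_roots G" "\<forall>\<beta>\<in>abs_simple_roots G. \<beta> x = 1"
  shows "1 \<le> \<alpha> x"
proof -
  obtain n :: "_ \<Rightarrow> nat" where "\<alpha> = (\<lambda>x. \<Sum>\<beta>\<in>abs_simple_roots G. of_nat (n \<beta>) * \<beta> x)"
    using assms(1) by (auto simp: abs_pos_roots_def)
  then have "\<alpha> x = (\<Sum>\<beta>\<in>abs_simple_roots G. of_nat (n \<beta>) * \<beta> x)" by simp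
  also have "\<dots> = (\<Sum>\<beta>\<in>abs_simple_roots G. of_nat (n \<beta>))" using assms(2) by (intro sum.cong) auto
  finally have eq: "\<alpha> x = of_nat (\<Sum>\<beta>\<in>abs_simple_roots G. n \<beta>)" by simp
  have "0 < \<alpha> x" by (rule pos_strict[OF assms(1)]) (drule bspec[OF assms(2)], simp)
  then have "0 < (\<Sum>\<beta>\<in>abs_simple_roots G. n \<beta>)" unfolding eq by (simp only: of_nat_0_less_iff)
  then have "1 \<le> (\<Sum>\<beta>\<in>abs_simple_roots G. n \<beta>)" by simp
  then show ?thesis unfolding eq by (metis of_nat_1 of_nat_le_iff)
qed

lemma rel_pos_roots_eq: "rel_pos_roots G = rel ` abs_pos_roots G"
proof -
  obtain x where x: "x \<in> frakA G" "\<forall>\<beta>\<in>abs_simple_roots G. \<beta> x = 1" using regular_frakA by blast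
  have "\<exists>x\<in>frakA G. \<alpha> x \<noteq> 0" if "\<alpha> \<in> abs_pos_roots G" for \<alpha>
    using pos_root_regular[OF that x(2)] x(1) by force
  then show ?thesis by (auto simp: rel_pos_roots_def rel_def)
qed

lemma Delta_eq: "Delta G = rel ` abs_simple_roots G"
proof -
  obtain x where x: "x \<in> frakA G" "\<forall>\<beta>\<in>abs_simple_roots G. \<beta> x = 1" using regular_frakA by blast
  have "rel \<beta> \<in> Delta G" if \<beta>: "\<beta> \<in> abs_simple_roots G" for \<beta>
  proof -
    have "rel \<beta> \<noteq> (\<lambda>x\<in>frakA G. rel \<gamma> x + rel \<delta> x)"
      if "\<gamma> \<in> abs_pos_roots G" "\<delta> \<in> abs_pos_roots G" for \<gamma> \<delta>
    proof
      assume "rel \<beta> = (\<lambda>x\<in>frakA G. rel \<gamma> x + rel \<delta> x)"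
      from fun_cong[OF this, of x] have "\<beta> x = \<gamma> x + \<delta> x" using x(1) by (simp add: rel_apply)
      then show False using pos_root_regular[OF that(1) x(2)] pos_root_regular[OF that(2) x(2)] bspec[OF x(2) \<beta>] by simp
    qed
    then show ?thesis using base_pos[OF \<beta>] by (auto simp: Delta_def rel_pos_roots_eq)
  qed
  moreover have "\<alpha> \<in> rel ` abs_simple_roots G" if "\<alpha> \<in> Delta G" for \<alpha>
  proof -
    have "\<alpha> \<in> rel ` abs_pos_roots G" using that unfolding Delta_def rel_pos_roots_eq by blast
    then obtain \<gamma> where \<gamma>: "\<gamma> \<in> abs_pos_roots G" "\<alpha> = rel \<gamma>" by blast
    show ?thesis
    proof (cases "\<gamma> \<in> abs_simple_roots G")
      case False
      obtain \<beta> where \<beta>: "\<beta> \<in> abs_simple_roots G" "(\<lambda>x. \<gamma> x - \<beta> x) \<in> abs_pos_roots G"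
        using pos_minus_simple[OF \<gamma>(1) False] by blast
      have "\<alpha> = (\<lambda>x\<in>frakA G. rel \<beta> x + rel (\<lambda>x. \<gamma> x - \<beta> x) x)"
        unfolding \<gamma>(2) by (auto simp: rel_def restrict_def)
      then have "\<alpha> \<notin> Delta G" using base_pos[OF \<beta>(1)] \<beta>(2) unfolding Delta_def rel_pos_roots_eq by blast
      with that show ?thesis by blast
    qed (use \<gamma> in blast)
  qed
  ultimately show ?thesis by blast
qed

lemma finite_Delta: "finite (Delta G)"
  using finite_base by (simp add: Delta_eq)

lemma over_base: "over S \<subseteq> abs_simple_roots G"
  by (auto simp: over_def)

lemma over_gal: "\<lbrakk>h \<in> gal; \<beta> \<in> over S\<rbrakk> \<Longrightarrow> \<beta> \<circ> h \<in> over S"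
  using gal_simple_root rel_gal by (auto simp: over_def)

lemma Levi_roots_eq: assumes "S \<subseteq> Delta G" shows "Levi_roots G S = sub_roots (over S)"
proof (intro equalityI subsetI)
  fix \<alpha> assume "\<alpha> \<in> sub_roots (over S)"
  then have \<alpha>: "\<alpha> \<in> abs_roots G" "\<And>x. (\<forall>\<beta>\<in>over S. \<beta> x = 0) \<Longrightarrow> \<alpha> x = 0" by (auto simp: sub_roots_def)
  have "\<alpha> x = 0" if x: "x \<in> frakA G" "\<forall>\<beta>\<in>S. \<beta> x = 0" for x
  proof (rule \<alpha>(2), rule ballI)
    fix \<beta> assume "\<beta> \<in> over S"
    then have "rel \<beta> \<in> S" by (simp add: over_def)
    from bspec[OF x(2) this] show "\<beta> x = 0" using x(1) by (simp add: rel_apply)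
  qed
  then show "\<alpha> \<in> Levi_roots G S" using \<alpha>(1) by (simp add: Levi_roots_def)
next
  fix \<alpha> assume \<alpha>: "\<alpha> \<in> Levi_roots G S"
  have root: "\<alpha> \<in> abs_roots G" using \<alpha> by (simp add: Levi_roots_def)
  define f where "f = (\<lambda>\<beta>. if \<beta> \<in> over S then 0 else (1::rat))"
  have "f (\<beta> \<circ> h) = f \<beta>" if h: "h \<in> gal" "\<beta> \<in> abs_simple_roots G" for h \<beta>
    using gal_simple_root[OF h] rel_gal[OF h(1)] h(2) by (simp add: f_def over_def)
  then obtain x where x: "x \<in> frakA G" "\<And>\<beta>. \<beta> \<in> abs_simple_roots G \<Longrightarrow> \<beta> x = f \<beta>"
    using prescribed_frakA[of f] by blast
  have "\<beta> x = 0" if \<beta>S: "\<beta> \<in> S" for \<beta>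
  proof -
    obtain \<gamma> where \<gamma>: "\<gamma> \<in> abs_simple_roots G" "\<beta> = rel \<gamma>" using assms \<beta>S unfolding Delta_eq by blast
    then have "\<gamma> \<in> over S" using \<beta>S by (simp add: over_def)
    then show ?thesis using x(2)[OF \<gamma>(1)] \<gamma> x(1) by (simp add: rel_apply f_def)
  qed
  then have \<alpha>x: "\<alpha> x = 0" using \<alpha> x(1) by (simp add: Levi_roots_def)
  have *: "\<gamma> \<in> sub_roots (over S)" if \<gamma>: "\<gamma> \<in> abs_pos_roots G" "\<gamma> x = 0" for \<gamma>
  proof -
    obtain n :: "_ \<Rightarrow> nat" where n: "\<gamma> = (\<lambda>x. \<Sum>\<beta>\<in>abs_simple_roots G. of_nat (n \<beta>) * \<beta> x)"
      using \<gamma>(1) by (auto simp: abs_pos_roots_def)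
    have "(\<Sum>\<beta>\<in>abs_simple_roots G. of_nat (n \<beta>) * \<beta> x) = 0" using \<gamma>(2) fun_cong[OF n, of x] by simp
    moreover have "0 \<le> of_nat (n \<beta>) * \<beta> x" if "\<beta> \<in> abs_simple_roots G" for \<beta>
      using x(2)[OF that] by (simp add: f_def)
    ultimately have null: "\<forall>\<beta>\<in>abs_simple_roots G. of_nat (n \<beta>) * \<beta> x = 0"
      by (subst (asm) sum_nonneg_eq_0_iff[OF finite_base])
    have n0: "n \<beta> = 0" if "\<beta> \<in> abs_simple_roots G" "\<beta> \<notin> over S" for \<beta>
      using bspec[OF null that(1)] x(2)[OF that(1)] that(2) by (simp add: f_def)
    have "\<gamma> y = 0" if y: "\<forall>\<beta>\<in>over S. \<beta> y = 0" for y
    proof -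
      have "of_nat (n \<beta>) * \<beta> y = 0" if "\<beta> \<in> abs_simple_roots G" for \<beta>
        using n0[OF that] bspec[OF y, of \<beta>] by (cases "\<beta> \<in> over S") auto
      then show ?thesis unfolding n by (intro sum.neutral) blast
    qed
    then show ?thesis using pos_root[OF \<gamma>(1)] by (simp add: sub_roots_def)
  qed
  show "\<alpha> \<in> sub_roots (over S)"
  proof (cases "\<alpha> \<in> abs_pos_roots G")
    case True
    then show ?thesis using * \<alpha>x by blast
  next
    case False
    have "(\<lambda>x. - \<alpha> x) \<in> sub_roots (over S)" by (rule *[OF not_pos_neg[OF root False]]) (simp add: \<alpha>x)
    then show ?thesis using root by (auto simp: sub_roots_def)
  qed
qed

lemma sub_roots_gal: "\<lbrakk>h \<in> gal; \<alpha> \<in> sub_roots (over S)\<rbrakk> \<Longrightarrow> \<alpha> \<circ> h \<in> sub_roots (over S)"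
proof -
  assume h: "h \<in> gal" and \<alpha>: "\<alpha> \<in> sub_roots (over S)"
  have "\<alpha> (h x) = 0" if x: "\<forall>\<beta>\<in>over S. \<beta> x = 0" for x
  proof -
    have "\<beta> (h x) = 0" if "\<beta> \<in> over S" for \<beta> using bspec[OF x over_gal[OF h that]] by simp
    then show ?thesis using \<alpha> unfolding sub_roots_def by blast
  qed
  then show "\<alpha> \<circ> h \<in> sub_roots (over S)" using gal_root[OF h] \<alpha> by (simp add: sub_roots_def)
qed

text \<open>The reflection is the longest element of the Weyl group generated by the simple roots over the
  given relative root: by uniqueness, this element commutes with the Galois action.\<close>

lemma relative_reflection:
  assumes \<delta>: "\<delta> \<in> Delta G"
  obtains e \<kappa> u where "e \<in> frakA G" "\<delta> e = 2" "0 < \<kappa>" "\<forall>\<beta>\<in>over {\<delta>}. e = \<kappa> *s avg (coroot G \<beta>)"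
    and "u \<in> weyl" "\<forall>x\<in>frakA G. u x = x - \<delta> x *s e"
proof -
  define Q where "Q = over {\<delta>}"
  have Q: "Q \<subseteq> abs_simple_roots G" unfolding Q_def by (rule over_base)
  interpret Q: root_base "scaleQ G" "sub_roots Q" "coroot G" Q by (rule root_base_sub_roots[OF Q])
  have relQ: "rel \<beta> = \<delta>" if "\<beta> \<in> Q" for \<beta> using that by (simp add: Q_def over_def)
  have on_A: "\<beta> x = \<delta> x" if "\<beta> \<in> Q" "x \<in> frakA G" for \<beta> x
    using relQ[OF that(1)] that(2) rel_apply by metis
  obtain \<beta>0 where \<beta>0: "\<beta>0 \<in> Q" using \<delta> by (auto simp: Delta_eq Q_def over_def)
  have \<beta>0r: "\<beta>0 \<in> abs_roots G" using \<beta>0 Q base_root by blast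
  obtain x0 where x0: "x0 \<in> frakA G" "\<forall>\<beta>\<in>abs_simple_roots G. \<beta> x0 = 1" using regular_frakA by blast
  have x0Q: "0 < \<beta> x0" if "\<beta> \<in> Q" for \<beta> using bspec[OF x0(2) subsetD[OF Q that]] by simp
  have pos_x0: "\<alpha> \<in> Q.pos \<longleftrightarrow> 0 < \<alpha> x0" if "\<alpha> \<in> sub_roots Q" for \<alpha>
    by (rule Q.pos_iff[OF that]) (rule x0Q)
  obtain u where u: "u \<in> Q.weyl" "Q.dominant (u (- x0))" "u (- x0) - (- x0) \<in> Q.coroot_cone"
    using Q.dominant_conjugate[of "- x0"] by blast
  have um: "u (- x0) = - u x0" using Q.weyl_diff[OF u(1), of 0 x0] Q.weyl_zero[OF u(1)] by simp
  have flips_u: "Q.flips u"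
    unfolding Q.flips_def
  proof
    fix \<alpha> assume \<alpha>: "\<alpha> \<in> Q.pos"
    have "0 \<le> \<alpha> (u (- x0))" by (rule Q.pos_nonneg[OF \<alpha> u(2)])
    then have "(\<alpha> \<circ> u) x0 \<le> 0" using Q.root_minus[OF Q.pos_root[OF \<alpha>]] um by simp
    then show "\<alpha> \<circ> u \<notin> Q.pos" using pos_x0[OF Q.weyl_root[OF u(1) Q.pos_root[OF \<alpha>]]] by simp
  qed
  have uu: "u (u x) = x" for x using fun_cong[OF Q.flips_involution[OF u(1) flips_u], of x] by simp
  have commute: "h (u x) = u (h x)" if h: "h \<in> gal" for h x
  proof -
    obtain k where k: "k \<in> gal" "h \<circ> k = id" "k \<circ> h = id" using gal_inverse[OF h] .
    have pos_gal: "\<alpha> \<circ> g \<in> Q.pos" if g: "g \<in> gal" and \<alpha>: "\<alpha> \<in> Q.pos" for g \<alpha>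
    proof -
      have "\<alpha> \<circ> g \<in> sub_roots Q" using sub_roots_gal[OF g] Q.pos_root[OF \<alpha>] by (simp add: Q_def)
      moreover have "0 < (\<alpha> \<circ> g) x0"
        using pos_x0[OF Q.pos_root[OF \<alpha>]] \<alpha> gal_fixes[OF g x0(1)] by simp
      ultimately show ?thesis using pos_x0 by blast
    qed
    have "h \<circ> w \<circ> k \<in> Q.weyl" if "w \<in> Q.weyl" for w
      using that
    proof (induction rule: Q.weyl_induct)
      case id
      show ?case using Q.weyl_id k by (simp only: comp_id)
    next
      case (refl \<beta> w)
      have \<beta>: "\<beta> \<in> abs_roots G" "\<beta> \<circ> k \<in> Q"
        using refl(1) Q base_root over_gal[OF k(1)] by (auto simp: Q_def)
      have "h (coroot G \<beta>) = coroot G (\<beta> \<circ> k)"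
        using gal_coroot[OF k(1) \<beta>(1)] fun_cong[OF k(2), of "coroot G (\<beta> \<circ> k)"] by simp
      then have "h (Q.refl \<beta> (k x)) = Q.refl (\<beta> \<circ> k) x" for x
        using fun_cong[OF k(2), of x] by (simp add: Q.refl_def gal_diff[OF h] gal_scale[OF h])
      then have "h \<circ> (Q.refl \<beta> \<circ> w) \<circ> k = Q.refl (\<beta> \<circ> k) \<circ> (h \<circ> w \<circ> k)"
        using fun_cong[OF k(3)] fun_cong[OF k(2)] by (auto simp: fun_eq_iff) metis
      then show ?case using Q.weyl_comp[OF Q.weyl_simple[OF \<beta>(2)] refl(3)] by (simp only:)
    qed
    then have W: "h \<circ> u \<circ> k \<in> Q.weyl" using u(1) by blast
    moreover have "Q.flips (h \<circ> u \<circ> k)"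
      unfolding Q.flips_def
    proof
      fix \<alpha> assume \<alpha>: "\<alpha> \<in> Q.pos"
      have "(\<alpha> \<circ> h) \<circ> u \<notin> Q.pos" using flips_u pos_gal[OF h \<alpha>] unfolding Q.flips_def by blast
      moreover have "(\<alpha> \<circ> (h \<circ> u \<circ> k)) \<circ> h = (\<alpha> \<circ> h) \<circ> u"
        using fun_cong[OF k(3)] by auto
      ultimately show "\<alpha> \<circ> (h \<circ> u \<circ> k) \<notin> Q.pos" using pos_gal[OF h] by metis
    qed
    ultimately have "h \<circ> u \<circ> k = u" using Q.flips_unique[OF _ u(1) _ flips_u] by blast
    from fun_cong[OF this, of "h x"] show ?thesis using fun_cong[OF k(3), of x] by simp
  qed
  have uA: "u x \<in> frakA G" if "x \<in> frakA G" for x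
    unfolding frakA_iff
  proof
    fix h assume h: "h \<in> gal"
    show "h (u x) = u x" unfolding commute[OF h] gal_fixes[OF h that] ..
  qed
  define e where "e = x0 - u x0"
  have eA: "e \<in> frakA G" unfolding e_def by (intro frakA_subspace(4) x0 uA)
  have \<delta>add: "\<delta> (x - y) = \<delta> x - \<delta> y" if "x \<in> frakA G" "y \<in> frakA G" for x y
    using on_A[OF \<beta>0] that frakA_subspace root_diff[OF \<beta>0r] by metis
  have \<delta>scale: "\<delta> (a *s x) = a * \<delta> x" if "x \<in> frakA G" for a x
    using on_A[OF \<beta>0] that frakA_subspace root_scale[OF \<beta>0r] by metis
  have \<delta>x0: "\<delta> x0 = 1" using on_A[OF \<beta>0 x0(1)] bspec[OF x0(2) subsetD[OF Q \<beta>0]] by simp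
  have trivial: "u x = x" if x: "x \<in> frakA G" "\<delta> x = 0" for x
    using u(1)
  proof (induction rule: Q.weyl_induct)
    case (refl \<beta> w)
    then show ?case using on_A[OF refl(1) x(1)] x(2) by (simp add: Q.refl_def)
  qed simp
  have ux: "u x = x - \<delta> x *s e" if x: "x \<in> frakA G" for x
  proof -
    have "u (x - \<delta> x *s x0) = x - \<delta> x *s x0"
      by (rule trivial) (simp_all add: x x0 frakA_subspace \<delta>add \<delta>scale \<delta>x0)
    then show ?thesis
      by (simp add: Q.weyl_diff[OF u(1)] Q.weyl_scale[OF u(1)] e_def scale_right_diff_distrib algebra_simps)
  qed
  have "0 \<le> \<beta>0 (u (- x0))" using u(2) \<beta>0 by (simp add: Q.dominant_def)
  then have "\<beta>0 (u x0) \<le> 0" using root_minus[OF \<beta>0r] um by simp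
  then have \<delta>e1: "1 \<le> \<delta> e" using on_A[OF \<beta>0 uA[OF x0(1)]] \<delta>x0 \<delta>add[OF x0(1) uA[OF x0(1)]] by (simp add: e_def)
  have "x0 = u (u x0)" by (simp add: uu)
  also have "\<dots> = u x0 - \<delta> (u x0) *s e" by (rule ux[OF uA[OF x0(1)]])
  also have "\<delta> (u x0) = 1 - \<delta> e" using ux[OF x0(1)] \<delta>add[OF x0(1) eA] \<delta>x0 by simp
  finally have "e - (\<delta> e - 1) *s e = 0" by (simp add: e_def algebra_simps scale_left_diff_distrib)
  then have "(2 - \<delta> e) *s e = 0"
    by (simp only: scale_left_diff_distrib scale_one) (metis (no_types) one_add_one scale_left_distrib scale_one diff_add_eq diff_diff_eq2)
  moreover have "e \<noteq> 0" using \<delta>e1 \<delta>add[OF x0(1) x0(1)] by auto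
  ultimately have \<delta>e: "\<delta> e = 2" by (simp add: scale_eq_0_iff)
  have "e = u (- x0) - (- x0)" using um by (simp add: e_def)
  then obtain a where a: "\<And>\<beta>. \<beta> \<in> Q \<Longrightarrow> (0::rat) \<le> a \<beta>" "e = (\<Sum>\<beta>\<in>Q. a \<beta> *s coroot G \<beta>)"
    using u(3) by (auto simp: Q.coroot_cone_def)
  have avg_eq: "avg (coroot G \<beta>) = avg (coroot G \<beta>')" if \<beta>: "\<beta> \<in> Q" "\<beta>' \<in> Q" for \<beta> \<beta>'
  proof -
    obtain h where h: "h \<in> gal" "\<beta>' = \<beta> \<circ> h"
      using rel_eq_iff[of \<beta> \<beta>'] \<beta> Q relQ by auto
    have "h (coroot G \<beta>') = coroot G \<beta>" using gal_coroot[OF h(1), of \<beta>] \<beta> Q base_root h(2) by auto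
    then show ?thesis using avg_gal[OF h(1)] by metis
  qed
  define \<kappa> where "\<kappa> = (\<Sum>\<beta>\<in>Q. a \<beta>)"
  have e_avg: "e = \<kappa> *s avg (coroot G \<beta>)" if "\<beta> \<in> Q" for \<beta>
  proof -
    have "e = avg e" using avg_id[OF eA] by simp
    also have "\<dots> = (\<Sum>\<beta>'\<in>Q. a \<beta>' *s avg (coroot G \<beta>'))" by (simp add: a(2) avg_sum avg_scale)
    also have "\<dots> = (\<Sum>\<beta>'\<in>Q. a \<beta>' *s avg (coroot G \<beta>))"
      using avg_eq[OF _ that] by (intro sum.cong) auto
    finally show ?thesis by (simp add: \<kappa>_def scale_sum_left)
  qed
  have "0 \<le> \<kappa>" unfolding \<kappa>_def using a(1) by (intro sum_nonneg)
  moreover have "\<kappa> \<noteq> 0" using e_avg[OF \<beta>0] \<open>e \<noteq> 0\<close> by auto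
  ultimately have "0 < \<kappa>" by simp
  moreover have "u \<in> weyl" using u(1) Q unfolding Q.weyl_def weyl_def by (meson image_mono lists_mono subsetD)
  ultimately show ?thesis using that[of e \<kappa> u] eA \<delta>e e_avg ux unfolding Q_def by blast
qed

lemma Delta_linear:
  assumes "\<delta> \<in> Delta G"
  shows "\<lbrakk>x \<in> frakA G; y \<in> frakA G\<rbrakk> \<Longrightarrow> \<delta> (x + y) = \<delta> x + \<delta> y"
    and "x \<in> frakA G \<Longrightarrow> \<delta> (a *s x) = a * \<delta> x"
    and "\<lbrakk>x \<in> frakA G; y \<in> frakA G\<rbrakk> \<Longrightarrow> \<delta> (x - y) = \<delta> x - \<delta> y"
proof -
  obtain \<beta> where \<beta>: "\<beta> \<in> abs_roots G" "\<delta> = rel \<beta>" using assms base_root by (auto simp: Delta_eq)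
  show "\<lbrakk>x \<in> frakA G; y \<in> frakA G\<rbrakk> \<Longrightarrow> \<delta> (x + y) = \<delta> x + \<delta> y"
    and "x \<in> frakA G \<Longrightarrow> \<delta> (a *s x) = a * \<delta> x"
    and "\<lbrakk>x \<in> frakA G; y \<in> frakA G\<rbrakk> \<Longrightarrow> \<delta> (x - y) = \<delta> x - \<delta> y"
    using \<beta> by (simp_all add: rel_apply frakA_subspace root_add root_scale root_diff)
qed

lemma rel_coroot_eq:
  assumes \<delta>: "\<delta> \<in> Delta G" and e: "e \<in> frakA G" "\<delta> e = 2"
    and u: "u \<in> weyl" "\<And>x. x \<in> frakA G \<Longrightarrow> u x = x - \<delta> x *s e"
  shows "rel_coroot G \<delta> = e" "rel_reflection G \<delta> \<in> rel_weyl_group G"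
proof -
  note lin = Delta_linear[OF \<delta>]
  have A: "x - \<delta> x *s e \<in> frakA G" if "x \<in> frakA G" for x using that e by (simp add: frakA_subspace)
  have inv: "u (u x) = x" if x: "x \<in> frakA G" for x
  proof -
    have "\<delta> (x - \<delta> x *s e) = - \<delta> x" using x e by (simp add: lin frakA_subspace)
    then show ?thesis using u(2)[OF x] u(2)[OF A[OF x]] by simp
  qed
  have "u ` frakA G = frakA G"
  proof (intro equalityI subsetI)
    fix x assume "x \<in> frakA G"
    then show "x \<in> u ` frakA G" using inv[of x] u(2)[of x] A[of x] by (metis imageI)
  qed (use u(2) A in auto)
  moreover have "(\<lambda>x\<in>frakA G. x - \<delta> x *s e) = restrict u (frakA G)" using u(2) by auto
  ultimately have mem: "(\<lambda>x\<in>frakA G. x - \<delta> x *s e) \<in> rel_weyl_group G"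
    using u(1) unfolding rel_weyl_group_def abs_weyl_group_eq by blast
  have unique: "c = e" if c: "c \<in> frakA G" "\<delta> c = 2" "(\<lambda>x\<in>frakA G. x - \<delta> x *s c) \<in> rel_weyl_group G" for c
  proof -
    obtain w where w: "w \<in> weyl" "(\<lambda>x\<in>frakA G. x - \<delta> x *s c) = restrict w (frakA G)"
      using c(3) unfolding rel_weyl_group_def abs_weyl_group_eq by blast
    have wx: "w x = x - \<delta> x *s c" if "x \<in> frakA G" for x using fun_cong[OF w(2), of x] that by simp
    define d where "d = e - c"
    have d: "d \<in> frakA G" "\<delta> d = 0" using e c by (simp_all add: d_def frakA_subspace lin)
    have t: "u (w x) = x + \<delta> x *s d" if x: "x \<in> frakA G" for x
    proof -
      have y: "x - \<delta> x *s c \<in> frakA G" using x c by (simp add: frakA_subspace)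
      have "\<delta> (x - \<delta> x *s c) = - \<delta> x" using x c by (simp add: lin frakA_subspace)
      then show ?thesis using wx[OF x] u(2)[OF y] by (simp add: d_def scale_right_diff_distrib)
    qed
    have "\<exists>v\<in>weyl. v e = e + of_nat n *s (2 *s d)" for n
    proof (induction n)
      case 0
      show ?case using weyl_id by (intro bexI[of _ id]) auto
    next
      case (Suc n)
      then obtain v where v: "v \<in> weyl" "v e = e + of_nat n *s (2 *s d)" by blast
      let ?y = "e + of_nat n *s (2 *s d)"
      have "?y \<in> frakA G" "\<delta> ?y = 2" using e d by (simp_all add: frakA_subspace lin)
      then have "u (w (v e)) = ?y + 2 *s d" using t v(2) by simp
      then have "(u \<circ> w \<circ> v) e = e + of_nat (Suc n) *s (2 *s d)" by (simp add: scale_left_distrib algebra_simps)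
      then show ?case using weyl_comp[OF weyl_comp[OF u(1) w(1)] v(1)] by blast
    qed
    then have "e + of_nat n *s (2 *s d) \<in> (\<lambda>v. v e) ` weyl" for n by (metis imageI)
    then have "2 *s d = 0" by (rule finite_progression[OF finite_imageI[OF finite_weyl] _ inj_of_nat])
    then have "d = 0" by (simp add: scale_eq_0_iff)
    then show ?thesis by (simp add: d_def)
  qed
  show eq: "rel_coroot G \<delta> = e"
    unfolding rel_coroot_def
  proof (rule the_equality)
    show "e \<in> frakA G \<and> \<delta> e = 2 \<and> (\<lambda>x\<in>frakA G. x - \<delta> x *s e) \<in> rel_weyl_group G"
      using e mem by blast
  qed (rule unique; elim conjE; assumption)
  show "rel_reflection G \<delta> \<in> rel_weyl_group G" unfolding rel_reflection_def eq by (rule mem)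
qed

lemma
  assumes \<delta>: "\<delta> \<in> Delta G"
  shows rel_coroot_frakA: "rel_coroot G \<delta> \<in> frakA G"
    and rel_coroot_two: "\<delta> (rel_coroot G \<delta>) = 2"
    and rel_coroot_avg: "\<exists>\<kappa>>0. \<forall>\<beta>\<in>over {\<delta>}. rel_coroot G \<delta> = \<kappa> *s avg (coroot G \<beta>)"
    and rel_reflection_weyl: "\<exists>u\<in>weyl. \<forall>x\<in>frakA G. u x = rel_reflection G \<delta> x"
proof -
  obtain e \<kappa> u where *: "e \<in> frakA G" "\<delta> e = 2" "0 < \<kappa>" "\<forall>\<beta>\<in>over {\<delta>}. e = \<kappa> *s avg (coroot G \<beta>)"
    "u \<in> weyl" "\<forall>x\<in>frakA G. u x = x - \<delta> x *s e" using relative_reflection[OF \<delta>] by blast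
  have eq: "rel_coroot G \<delta> = e" using rel_coroot_eq(1)[OF \<delta> *(1,2,5)] *(6) by blast
  show "rel_coroot G \<delta> \<in> frakA G" "\<delta> (rel_coroot G \<delta>) = 2"
    "\<exists>\<kappa>>0. \<forall>\<beta>\<in>over {\<delta>}. rel_coroot G \<delta> = \<kappa> *s avg (coroot G \<beta>)"
    "\<exists>u\<in>weyl. \<forall>x\<in>frakA G. u x = rel_reflection G \<delta> x"
    using * unfolding eq rel_reflection_def by auto
qed

subsection \<open>Averages over relative Weyl groups\<close>

definition proj :: "('v \<Rightarrow> rat) set \<Rightarrow> 'v \<Rightarrow> 'v" where
  "proj S x = (1 / of_nat (card (rel_Levi_weyl_group G S))) *s (\<Sum>\<sigma>\<in>rel_Levi_weyl_group G S. \<sigma> x)"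

lemma theta_eq: "theta G S \<mu> = proj S (avg \<mu>)"
  by (simp add: theta_def proj_def Gal_average_eq)

lemma rel_reflection_apply: "x \<in> frakA G \<Longrightarrow> rel_reflection G \<delta> x = x - \<delta> x *s rel_coroot G \<delta>"
  by (simp add: rel_reflection_def)

lemma rel_reflection_frakA: "\<lbrakk>\<delta> \<in> Delta G; x \<in> frakA G\<rbrakk> \<Longrightarrow> rel_reflection G \<delta> x \<in> frakA G"
  using rel_coroot_frakA by (simp add: rel_reflection_apply frakA_subspace)

lemma rel_reflection_involution:
  assumes "\<delta> \<in> Delta G" "x \<in> frakA G" shows "rel_reflection G \<delta> (rel_reflection G \<delta> x) = x"
proof -
  have "\<delta> (x - \<delta> x *s rel_coroot G \<delta>) = - \<delta> x"
    using assms rel_coroot_two[OF assms(1)] rel_coroot_frakA[OF assms(1)]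
    by (simp add: Delta_linear[OF assms(1)] frakA_subspace)
  then show ?thesis
    using rel_reflection_apply[OF rel_reflection_frakA[OF assms]] assms(2)
    by (simp add: rel_reflection_apply)
qed

lemma rel_reflection_Bij: assumes "\<delta> \<in> Delta G" shows "rel_reflection G \<delta> \<in> Bij (frakA G)"
proof -
  have "bij_betw (rel_reflection G \<delta>) (frakA G) (frakA G)"
    by (rule bij_betw_byWitness[where f' = "rel_reflection G \<delta>"])
      (use assms rel_reflection_involution rel_reflection_frakA in auto)
  then show ?thesis by (simp add: Bij_def rel_reflection_def)
qed

lemma rel_reflection_compose:
  assumes "\<delta> \<in> Delta G"
  shows "compose (frakA G) (rel_reflection G \<delta>) (rel_reflection G \<delta>) = (\<lambda>x\<in>frakA G. x)"
  using rel_reflection_involution[OF assms] by (auto simp: compose_def)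

lemma rel_reflection_inv:
  assumes "\<delta> \<in> Delta G" shows "inv\<^bsub>BijGroup (frakA G)\<^esub> (rel_reflection G \<delta>) = rel_reflection G \<delta>"
  by (rule group.inv_equality[OF group_BijGroup])
    (use rel_reflection_Bij[OF assms] rel_reflection_compose[OF assms] in \<open>simp_all add: BijGroup_def\<close>)

lemma rel_Levi_Bij:
  assumes "S \<subseteq> Delta G" "\<sigma> \<in> rel_Levi_weyl_group G S" shows "\<sigma> \<in> Bij (frakA G)"
proof -
  have "rel_reflection G ` S \<subseteq> carrier (BijGroup (frakA G))"
    using rel_reflection_Bij assms(1) by (auto simp: BijGroup_def)
  then have "\<sigma> \<in> carrier (BijGroup (frakA G))"
    using assms(2) unfolding rel_Levi_weyl_group_def by (rule group.generate_in_carrier[OF group_BijGroup])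
  then show ?thesis by (simp add: BijGroup_def)
qed

lemma rel_Levi_comp:
  assumes "S \<subseteq> Delta G" "\<sigma> \<in> rel_Levi_weyl_group G S" "\<tau> \<in> rel_Levi_weyl_group G S"
  shows "compose (frakA G) \<sigma> \<tau> \<in> rel_Levi_weyl_group G S"
proof -
  have "\<sigma> \<otimes>\<^bsub>BijGroup (frakA G)\<^esub> \<tau> = compose (frakA G) \<sigma> \<tau>"
    using rel_Levi_Bij[OF assms(1,2)] rel_Levi_Bij[OF assms(1,3)] by (simp add: BijGroup_def)
  moreover have "\<sigma> \<otimes>\<^bsub>BijGroup (frakA G)\<^esub> \<tau> \<in> rel_Levi_weyl_group G S"
    using assms(2,3) unfolding rel_Levi_weyl_group_def by (rule generate.eng)
  ultimately show ?thesis by simp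
qed

lemma rel_Levi_refl: "\<delta> \<in> S \<Longrightarrow> rel_reflection G \<delta> \<in> rel_Levi_weyl_group G S"
  by (simp add: rel_Levi_weyl_group_def generate.incl)

lemma rel_Levi_induct [consumes 2, case_names one refl comp]:
  assumes "S \<subseteq> Delta G" "\<sigma> \<in> rel_Levi_weyl_group G S"
    and "P (\<lambda>x\<in>frakA G. x)" "\<And>\<delta>. \<delta> \<in> S \<Longrightarrow> P (rel_reflection G \<delta>)"
    and "\<And>\<sigma> \<tau>. \<lbrakk>\<sigma> \<in> Bij (frakA G); \<tau> \<in> Bij (frakA G); P \<sigma>; P \<tau>\<rbrakk> \<Longrightarrow> P (compose (frakA G) \<sigma> \<tau>)"
  shows "P \<sigma>"
  using assms(2) unfolding rel_Levi_weyl_group_def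
proof (induction rule: generate.induct)
  case one
  have "\<one>\<^bsub>BijGroup (frakA G)\<^esub> = (\<lambda>x\<in>frakA G. x)" by (simp add: BijGroup_def)
  then show ?case using assms(3) by (simp only:)
next
  case (incl h)
  then show ?case using assms(4) by auto
next
  case (inv h)
  then show ?case using assms(1,4) rel_reflection_inv by auto
next
  case (eng \<sigma> \<tau>)
  then have B: "\<sigma> \<in> Bij (frakA G)" "\<tau> \<in> Bij (frakA G)"
    using rel_Levi_Bij[OF assms(1)] by (simp_all add: rel_Levi_weyl_group_def)
  then show ?case using assms(5)[OF B eng(3,4)] by (simp add: BijGroup_def)
qed

lemma rel_Levi_weyl:
  assumes "S \<subseteq> Delta G" "\<sigma> \<in> rel_Levi_weyl_group G S"
  shows "\<exists>w\<in>weyl. \<forall>x\<in>frakA G. \<sigma> x = w x"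
  using assms
proof (induction rule: rel_Levi_induct)
  case one
  show ?case using weyl_id by (intro bexI[of _ id]) auto
next
  case (refl \<delta>)
  then obtain u where "u \<in> weyl" "\<forall>x\<in>frakA G. u x = rel_reflection G \<delta> x"
    using rel_reflection_weyl[of \<delta>] assms(1) by blast
  then show ?case by (intro bexI[of _ u]) auto
next
  case (comp \<sigma> \<tau>)
  then obtain v w where vw: "v \<in> weyl" "\<forall>x\<in>frakA G. \<sigma> x = v x" "w \<in> weyl" "\<forall>x\<in>frakA G. \<tau> x = w x" by blast
  have "\<tau> x \<in> frakA G" if "x \<in> frakA G" for x using Bij_imp_funcset[OF comp(2)] that by blast
  then have "compose (frakA G) \<sigma> \<tau> x = (v \<circ> w) x" if "x \<in> frakA G" for x
    using that vw by (simp add: compose_eq)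
  then show ?case using weyl_comp[OF vw(1,3)] by blast
qed

lemma rel_Levi_frakA:
  "\<lbrakk>S \<subseteq> Delta G; \<sigma> \<in> rel_Levi_weyl_group G S; x \<in> frakA G\<rbrakk> \<Longrightarrow> \<sigma> x \<in> frakA G"
  using Bij_imp_funcset[OF rel_Levi_Bij] by blast

lemma rel_Levi_fixes:
  assumes "S \<subseteq> Delta G" "\<sigma> \<in> rel_Levi_weyl_group G S" "x \<in> frakA G" "\<forall>\<delta>\<in>S. \<delta> x = 0"
  shows "\<sigma> x = x"
  using assms(1,2)
proof (induction rule: rel_Levi_induct)
  case (refl \<delta>)
  then show ?case using assms(3,4) by (simp add: rel_reflection_apply)
qed (use assms(3) in \<open>simp_all add: compose_eq\<close>)

lemma rel_Levi_span:
  assumes "S \<subseteq> Delta G" "\<sigma> \<in> rel_Levi_weyl_group G S" "x \<in> frakA G"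
  shows "\<exists>c. x - \<sigma> x = (\<Sum>\<delta>\<in>S. c \<delta> *s rel_coroot G \<delta>)"
proof -
  have fin: "finite S" using assms(1) finite_Delta finite_subset by blast
  have "\<forall>x\<in>frakA G. \<exists>c. x - \<sigma> x = (\<Sum>\<delta>\<in>S. c \<delta> *s rel_coroot G \<delta>)"
    using assms(1,2)
  proof (induction rule: rel_Levi_induct)
    case one
    show ?case by (intro ballI exI[of _ "\<lambda>_. 0"]) simp
  next
    case (refl \<delta>)
    have "(\<Sum>\<epsilon>\<in>S. (if \<epsilon> = \<delta> then \<delta> x else 0) *s rel_coroot G \<epsilon>) = \<delta> x *s rel_coroot G \<delta>" for x
    proof -
      have "(\<Sum>\<epsilon>\<in>S. (if \<epsilon> = \<delta> then \<delta> x else 0) *s rel_coroot G \<epsilon>)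
        = (\<Sum>\<epsilon>\<in>S. if \<epsilon> = \<delta> then \<delta> x *s rel_coroot G \<delta> else 0)" by (intro sum.cong) auto
      then show ?thesis using fin refl by simp
    qed
    then have "x - rel_reflection G \<delta> x = (\<Sum>\<epsilon>\<in>S. (if \<epsilon> = \<delta> then \<delta> x else 0) *s rel_coroot G \<epsilon>)"
      if "x \<in> frakA G" for x using that by (simp add: rel_reflection_apply)
    then show ?case by (intro ballI exI)
  next
    case (comp \<sigma> \<tau>)
    show ?case
    proof
      fix x assume x: "x \<in> frakA G"
      have \<tau>x: "\<tau> x \<in> frakA G" using Bij_imp_funcset[OF comp(2)] x by blast
      obtain c where c: "x - \<tau> x = (\<Sum>\<delta>\<in>S. c \<delta> *s rel_coroot G \<delta>)" using bspec[OF comp(4) x] by blast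
      obtain d where d: "\<tau> x - \<sigma> (\<tau> x) = (\<Sum>\<delta>\<in>S. d \<delta> *s rel_coroot G \<delta>)" using bspec[OF comp(3) \<tau>x] by blast
      have "x - compose (frakA G) \<sigma> \<tau> x = (x - \<tau> x) + (\<tau> x - \<sigma> (\<tau> x))" using x by (simp add: compose_eq)
      also have "\<dots> = (\<Sum>\<delta>\<in>S. (c \<delta> + d \<delta>) *s rel_coroot G \<delta>)"
        unfolding c d by (simp add: scale_left_distrib sum.distrib)
      finally show "\<exists>c. x - compose (frakA G) \<sigma> \<tau> x = (\<Sum>\<delta>\<in>S. c \<delta> *s rel_coroot G \<delta>)"
        by (rule exI[of _ "\<lambda>\<delta>. c \<delta> + d \<delta>"])
    qed
  qed
  then show ?thesis using assms(3) by blast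
qed

lemma rel_Levi_add:
  assumes "S \<subseteq> Delta G" "\<sigma> \<in> rel_Levi_weyl_group G S" "x \<in> frakA G" "y \<in> frakA G"
  shows "\<sigma> (x + y) = \<sigma> x + \<sigma> y"
proof -
  obtain w where "w \<in> weyl" "\<forall>x\<in>frakA G. \<sigma> x = w x" using rel_Levi_weyl[OF assms(1,2)] by blast
  then show ?thesis using assms(3,4) by (simp add: weyl_add frakA_subspace)
qed

lemma rel_Levi_scale:
  assumes "S \<subseteq> Delta G" "\<sigma> \<in> rel_Levi_weyl_group G S" "x \<in> frakA G"
  shows "\<sigma> (a *s x) = a *s \<sigma> x"
proof -
  obtain w where "w \<in> weyl" "\<forall>x\<in>frakA G. \<sigma> x = w x" using rel_Levi_weyl[OF assms(1,2)] by blast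
  then show ?thesis using assms(3) by (simp add: weyl_scale frakA_subspace)
qed

lemma finite_rel_Levi: assumes "S \<subseteq> Delta G" shows "finite (rel_Levi_weyl_group G S)"
proof (rule finite_subset)
  show "rel_Levi_weyl_group G S \<subseteq> (\<lambda>w. restrict w (frakA G)) ` weyl"
  proof
    fix \<sigma> assume \<sigma>: "\<sigma> \<in> rel_Levi_weyl_group G S"
    obtain w where w: "w \<in> weyl" "\<forall>x\<in>frakA G. \<sigma> x = w x" using rel_Levi_weyl[OF assms \<sigma>] by blast
    have "\<sigma> = restrict w (frakA G)"
      by (rule extensionalityI[OF Bij_imp_extensional[OF rel_Levi_Bij[OF assms \<sigma>]] restrict_extensional])
        (use w in simp)
    then show "\<sigma> \<in> (\<lambda>w. restrict w (frakA G)) ` weyl" using w(1) by blast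
  qed
  show "finite ((\<lambda>w. restrict w (frakA G)) ` weyl)" using finite_weyl by simp
qed

lemma card_rel_Levi: assumes "S \<subseteq> Delta G" shows "card (rel_Levi_weyl_group G S) \<noteq> 0"
  using finite_rel_Levi[OF assms] generate.one by (auto simp: rel_Levi_weyl_group_def)

lemma proj_frakA: assumes "S \<subseteq> Delta G" "x \<in> frakA G" shows "proj S x \<in> frakA G"
proof -
  have "(\<Sum>\<sigma>\<in>I. \<sigma> x) \<in> frakA G" if "I \<subseteq> rel_Levi_weyl_group G S" for I
    using that rel_Levi_frakA[OF assms(1) _ assms(2)]
    by (induction I rule: infinite_finite_induct) (auto intro: frakA_subspace)
  then show ?thesis unfolding proj_def by (intro frakA_subspace) auto
qed

lemma proj_add: "\<lbrakk>S \<subseteq> Delta G; x \<in> frakA G; y \<in> frakA G\<rbrakk> \<Longrightarrow> proj S (x + y) = proj S x + proj S y"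
  by (simp add: proj_def rel_Levi_add sum.distrib scale_right_distrib)

lemma proj_scale: "\<lbrakk>S \<subseteq> Delta G; x \<in> frakA G\<rbrakk> \<Longrightarrow> proj S (a *s x) = a *s proj S x"
  by (simp add: proj_def rel_Levi_scale scale_sum_right[symmetric] mult.commute)

lemma proj_fixes: assumes "S \<subseteq> Delta G" "x \<in> frakA G" "\<forall>\<delta>\<in>S. \<delta> x = 0" shows "proj S x = x"
proof -
  have "(\<Sum>\<sigma>\<in>rel_Levi_weyl_group G S. \<sigma> x) = (\<Sum>\<sigma>\<in>rel_Levi_weyl_group G S. x)"
    using rel_Levi_fixes[OF assms(1) _ assms(2,3)] by (intro sum.cong) auto
  then show ?thesis
    using card_rel_Levi[OF assms(1)] finite_rel_Levi[OF assms(1)] by (simp add: proj_def sum_constant_scale)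
qed

lemma proj_reflection:
  assumes S: "S \<subseteq> Delta G" and x: "x \<in> frakA G" and \<delta>: "\<delta> \<in> S"
  shows "proj S (rel_reflection G \<delta> x) = proj S x" "rel_reflection G \<delta> (proj S x) = proj S x"
proof -
  let ?A = "frakA G" and ?r = "rel_reflection G \<delta>" and ?W = "rel_Levi_weyl_group G S"
  have \<delta>D: "\<delta> \<in> Delta G" using S \<delta> by blast
  have r: "?r \<in> ?W" by (rule rel_Levi_refl[OF \<delta>])
  have ext: "\<sigma> \<in> extensional ?A" if "\<sigma> \<in> ?W" for \<sigma> using rel_Levi_Bij[OF S that] by (rule Bij_imp_extensional)
  have fs: "\<sigma> \<in> ?A \<rightarrow> ?A" if "\<sigma> \<in> ?W" for \<sigma> using rel_Levi_Bij[OF S that] by (rule Bij_imp_funcset)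
  have L: "compose ?A ?r (compose ?A ?r \<sigma>) = \<sigma>" if "\<sigma> \<in> ?W" for \<sigma>
    using compose_assoc[OF fs[OF that], of ?r ?r] rel_reflection_compose[OF \<delta>D] ext[OF that] fs[OF that] by simp
  have R: "compose ?A (compose ?A \<sigma> ?r) ?r = \<sigma>" if "\<sigma> \<in> ?W" for \<sigma>
    using compose_assoc[OF fs[OF r], of \<sigma> ?r] rel_reflection_compose[OF \<delta>D] ext[OF that] fs[OF that] by simp
  have bL: "bij_betw (\<lambda>\<sigma>. compose ?A ?r \<sigma>) ?W ?W"
    by (rule bij_betw_byWitness[where f' = "\<lambda>\<sigma>. compose ?A ?r \<sigma>"])
      (use L r rel_Levi_comp[OF S] in auto)
  have bR: "bij_betw (\<lambda>\<sigma>. compose ?A \<sigma> ?r) ?W ?W"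
    by (rule bij_betw_byWitness[where f' = "\<lambda>\<sigma>. compose ?A \<sigma> ?r"])
      (use R r rel_Levi_comp[OF S] in auto)
  have "(\<Sum>\<sigma>\<in>?W. \<sigma> (?r x)) = (\<Sum>\<sigma>\<in>?W. compose ?A \<sigma> ?r x)" using x by (simp add: compose_eq)
  also have "\<dots> = (\<Sum>\<sigma>\<in>?W. \<sigma> x)" by (rule sum.reindex_bij_betw[OF bR])
  finally show "proj S (?r x) = proj S x" by (simp add: proj_def)
  obtain w where w: "w \<in> weyl" "\<forall>x\<in>?A. ?r x = w x" using rel_Levi_weyl[OF S r] by blast
  have wsum: "w (\<Sum>i\<in>I. f i) = (\<Sum>i\<in>I. w (f i))" for I and f :: "('v \<Rightarrow> 'v) \<Rightarrow> 'v"
    by (induction I rule: infinite_finite_induct) (auto simp: weyl_zero[OF w(1)] weyl_add[OF w(1)])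
  have "?r (proj S x) = w (proj S x)" using w(2) proj_frakA[OF S x] by blast
  also have "\<dots> = (1 / of_nat (card ?W)) *s (\<Sum>\<sigma>\<in>?W. w (\<sigma> x))"
    by (simp add: proj_def weyl_scale[OF w(1)] wsum)
  also have "(\<Sum>\<sigma>\<in>?W. w (\<sigma> x)) = (\<Sum>\<sigma>\<in>?W. compose ?A ?r \<sigma> x)"
    using w(2) rel_Levi_frakA[OF S _ x] x by (intro sum.cong) (simp_all add: compose_eq)
  also have "\<dots> = (\<Sum>\<sigma>\<in>?W. \<sigma> x)" by (rule sum.reindex_bij_betw[OF bL])
  finally show "?r (proj S x) = proj S x" by (simp add: proj_def)
qed

lemma proj_zero:
  assumes "S \<subseteq> Delta G" "x \<in> frakA G" "\<delta> \<in> S" shows "\<delta> (proj S x) = 0"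
proof -
  have "\<delta> (proj S x) *s rel_coroot G \<delta> = 0"
    using proj_reflection(2)[OF assms] rel_reflection_apply[OF proj_frakA[OF assms(1,2)], of \<delta>] by simp
  moreover have "rel_coroot G \<delta> \<noteq> 0"
    using rel_coroot_two[of \<delta>] Delta_linear(2)[of \<delta> 0 0] frakA_subspace(1) assms by auto
  ultimately show ?thesis by (simp add: scale_eq_0_iff)
qed

lemma proj_coroot:
  assumes "S \<subseteq> Delta G" "\<delta> \<in> S" shows "proj S (rel_coroot G \<delta>) = 0"
proof -
  have \<delta>: "\<delta> \<in> Delta G" using assms by blast
  let ?e = "rel_coroot G \<delta>"
  have e: "?e \<in> frakA G" by (rule rel_coroot_frakA[OF \<delta>])
  have "rel_reflection G \<delta> ?e = (-1) *s ?e"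
    using scale_left_diff_distrib[of 1 2 ?e] by (simp add: rel_reflection_apply[OF e] rel_coroot_two[OF \<delta>])
  then have "proj S ?e = - proj S ?e"
    using proj_reflection(1)[OF assms(1) e assms(2)] proj_scale[OF assms(1) e, of "-1"] by simp
  then have "2 *s proj S ?e = 0" using scale_left_distrib[of 1 1 "proj S ?e"] by (simp add: eq_neg_iff_add_eq_0)
  then show ?thesis by (simp add: scale_eq_0_iff)
qed

lemma coroot_combination_frakA: "S \<subseteq> Delta G \<Longrightarrow> (\<Sum>\<delta>\<in>S. c \<delta> *s rel_coroot G \<delta>) \<in> frakA G"
  by (induction S rule: infinite_finite_induct) (auto intro!: frakA_subspace rel_coroot_frakA)

lemma proj_combination:
  assumes "S \<subseteq> Delta G" shows "proj S (\<Sum>\<delta>\<in>S. c \<delta> *s rel_coroot G \<delta>) = 0"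
proof -
  have "proj S (\<Sum>\<delta>\<in>I. c \<delta> *s rel_coroot G \<delta>) = 0" if "finite I" "I \<subseteq> S" for I
    using that
  proof (induction I rule: finite_induct)
    case empty
    then show ?case using proj_fixes[OF assms frakA_subspace(1)] Delta_linear(2)[of _ 0 0] frakA_subspace(1) assms by force
  next
    case (insert \<epsilon> I)
    then have \<epsilon>: "\<epsilon> \<in> Delta G" "\<epsilon> \<in> S" "I \<subseteq> Delta G" using assms by auto
    show ?case
      using insert coroot_combination_frakA[OF \<epsilon>(3), of c] rel_coroot_frakA[OF \<epsilon>(1)] proj_coroot[OF assms \<epsilon>(2)]
      by (simp add: proj_add[OF assms] proj_scale[OF assms] frakA_subspace)
  qed
  then show ?thesis using assms finite_Delta finite_subset by blast
qed

lemma proj_span: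
  assumes "S \<subseteq> Delta G" "x \<in> frakA G"
  shows "\<exists>c. x - proj S x = (\<Sum>\<delta>\<in>S. c \<delta> *s rel_coroot G \<delta>)"
proof -
  let ?W = "rel_Levi_weyl_group G S"
  have "\<forall>\<sigma>\<in>?W. \<exists>c. x - \<sigma> x = (\<Sum>\<delta>\<in>S. c \<delta> *s rel_coroot G \<delta>)" using rel_Levi_span[OF assms(1) _ assms(2)] by blast
  then obtain c where c: "\<And>\<sigma>. \<sigma> \<in> ?W \<Longrightarrow> x - \<sigma> x = (\<Sum>\<delta>\<in>S. c \<sigma> \<delta> *s rel_coroot G \<delta>)" by metis
  let ?n = "1 / of_nat (card ?W) :: rat"
  have "x - proj S x = ?n *s (\<Sum>\<sigma>\<in>?W. x) - proj S x"
    using card_rel_Levi[OF assms(1)] finite_rel_Levi[OF assms(1)] by (simp add: sum_constant_scale)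
  also have "\<dots> = ?n *s (\<Sum>\<sigma>\<in>?W. x - \<sigma> x)"
    by (simp add: proj_def scale_right_diff_distrib sum_subtractf)
  also have "(\<Sum>\<sigma>\<in>?W. x - \<sigma> x) = (\<Sum>\<sigma>\<in>?W. \<Sum>\<delta>\<in>S. c \<sigma> \<delta> *s rel_coroot G \<delta>)" using c by (intro sum.cong) auto
  also have "\<dots> = (\<Sum>\<delta>\<in>S. (\<Sum>\<sigma>\<in>?W. c \<sigma> \<delta>) *s rel_coroot G \<delta>)"
    by (subst sum.swap) (simp add: scale_sum_left)
  also have "?n *s \<dots> = (\<Sum>\<delta>\<in>S. (?n * (\<Sum>\<sigma>\<in>?W. c \<sigma> \<delta>)) *s rel_coroot G \<delta>)"
    by (simp add: scale_sum_right)
  finally show ?thesis by (rule exI[of _ "\<lambda>\<delta>. ?n * (\<Sum>\<sigma>\<in>?W. c \<sigma> \<delta>)"])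
qed

lemma form_avg: assumes "y \<in> frakA G" shows "form (avg x) y = form x y"
proof -
  have "(\<Sum>h\<in>gal. form (h x) y) = (\<Sum>h\<in>gal. form x y)"
  proof (rule sum.cong)
    fix h assume h: "h \<in> gal"
    show "form (h x) y = form x y" using form_gal[OF h, of x y] gal_fixes[OF h assms] by simp
  qed simp
  then show ?thesis using card_gal by (simp add: avg_def form_scale form_sum)
qed

lemma over_Delta: "\<delta> \<in> Delta G \<Longrightarrow> \<exists>\<beta>. \<beta> \<in> abs_simple_roots G \<and> \<beta> \<in> over {\<delta>} \<and> \<delta> = rel \<beta>"
  by (auto simp: Delta_eq over_def)

lemma form_rel_coroot:
  assumes "\<delta> \<in> Delta G" shows "\<exists>t>0. \<forall>y\<in>frakA G. form (rel_coroot G \<delta>) y = t * \<delta> y"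
proof -
  obtain \<beta> where \<beta>: "\<beta> \<in> abs_simple_roots G" "\<beta> \<in> over {\<delta>}" "\<delta> = rel \<beta>" using over_Delta[OF assms] by blast
  obtain \<kappa> where \<kappa>: "0 < \<kappa>" "rel_coroot G \<delta> = \<kappa> *s avg (coroot G \<beta>)" using rel_coroot_avg[OF assms] \<beta>(2) by blast
  let ?t = "\<kappa> * (form (coroot G \<beta>) (coroot G \<beta>) / 2)"
  have "form (rel_coroot G \<delta>) y = ?t * \<delta> y" if "y \<in> frakA G" for y
  proof -
    have "form (rel_coroot G \<delta>) y = \<kappa> * form (coroot G \<beta>) y"
      unfolding \<kappa>(2) form_scale form_avg[OF that] ..
    also have "\<dots> = ?t * \<beta> y" unfolding form_coroot'[OF base_root[OF \<beta>(1)], of y] by simp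
    also have "\<beta> y = \<delta> y" using that by (simp add: \<beta>(3) rel_apply)
    finally show ?thesis .
  qed
  moreover have "0 < ?t" using \<kappa>(1) form_coroot_pos[OF base_root[OF \<beta>(1)]] by simp
  ultimately show ?thesis by blast
qed

lemma rel_cartan_nonpos:
  assumes "\<delta> \<in> Delta G" "\<epsilon> \<in> Delta G" "\<epsilon> \<noteq> \<delta>" shows "\<epsilon> (rel_coroot G \<delta>) \<le> 0"
proof -
  obtain \<beta> where \<beta>: "\<beta> \<in> abs_simple_roots G" "\<beta> \<in> over {\<delta>}" "\<delta> = rel \<beta>" using over_Delta[OF assms(1)] by blast
  obtain \<gamma> where \<gamma>: "\<gamma> \<in> abs_simple_roots G" "\<epsilon> = rel \<gamma>" using over_Delta[OF assms(2)] by blast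
  obtain \<kappa> where \<kappa>: "0 < \<kappa>" "rel_coroot G \<delta> = \<kappa> *s avg (coroot G \<beta>)" using rel_coroot_avg[OF assms(1)] \<beta>(2) by blast
  have "\<gamma> (h (coroot G \<beta>)) \<le> 0" if h: "h \<in> gal" for h
  proof -
    obtain k where k: "k \<in> gal" "h \<circ> k = id" "k \<circ> h = id" using gal_inverse[OF h] .
    have "h (coroot G \<beta>) = coroot G (\<beta> \<circ> k)"
      using gal_coroot[OF k(1) base_root[OF \<beta>(1)]] fun_cong[OF k(2), of "coroot G (\<beta> \<circ> k)"] by simp
    moreover have "\<gamma> \<noteq> \<beta> \<circ> k" using assms(3) \<beta>(3) \<gamma>(2) rel_gal[OF k(1), of \<beta>] by auto
    ultimately show ?thesis using base_coroot_nonpos[OF gal_simple_root[OF k(1) \<beta>(1)] \<gamma>(1)] by simp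
  qed
  then have "(\<Sum>h\<in>gal. \<gamma> (h (coroot G \<beta>))) \<le> 0" by (rule sum_nonpos)
  then have "\<gamma> (avg (coroot G \<beta>)) \<le> 0"
    unfolding root_avg[OF base_root[OF \<gamma>(1)]] by (intro mult_nonneg_nonpos) auto
  then have "\<gamma> (rel_coroot G \<delta>) \<le> 0"
    unfolding \<kappa>(2) root_scale[OF base_root[OF \<gamma>(1)]] using \<kappa>(1) by (intro mult_nonneg_nonpos) auto
  then show ?thesis using rel_coroot_frakA[OF assms(1)] by (simp add: \<gamma>(2) rel_apply)
qed

sublocale relative_system "scaleQ G" "frakA G" "Delta G" "rel_coroot G" form proj
proof (rule relative_system.intro[OF vs relative_system_axioms.intro])
  show "\<delta> z = 0" if z: "z \<in> frakA G" "form z z \<le> 0" "\<delta> \<in> Delta G" for z \<delta>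
  proof -
    obtain \<beta> where \<beta>: "\<beta> \<in> abs_simple_roots G" "\<delta> = rel \<beta>" using over_Delta[OF z(3)] by blast
    show ?thesis using form_null[OF z(2) base_root[OF \<beta>(1)]] z(1) by (simp add: \<beta>(2) rel_apply)
  qed
  show "\<exists>h\<in>frakA G. \<forall>\<delta>\<in>Delta G. 0 < \<delta> h"
  proof -
    obtain x where x: "x \<in> frakA G" "\<forall>\<beta>\<in>abs_simple_roots G. \<beta> x = 1" using regular_frakA by blast
    then show ?thesis by (intro bexI[of _ x]) (auto simp: Delta_eq rel_apply)
  qed
  show "(\<Sum>\<epsilon>\<in>S. c \<epsilon> *s rel_coroot G \<epsilon>) = 0"
    if "S \<subseteq> Delta G" "\<And>\<delta>. \<delta> \<in> S \<Longrightarrow> \<delta> (\<Sum>\<epsilon>\<in>S. c \<epsilon> *s rel_coroot G \<epsilon>) = 0" for S c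
    using proj_fixes[OF that(1) coroot_combination_frakA[OF that(1)]] proj_combination[OF that(1)] that(2) by metis
qed (fact finite_Delta frakA_subspace Delta_linear rel_coroot_frakA rel_cartan_nonpos form_sym form_add form_scale
      form_rel_coroot proj_frakA proj_zero proj_span)+

end

section \<open>Cocharacter pairs\<close>

context quasisplit_root_datum
begin

subsection \<open>Conjugation in standard Levi subgroups\<close>

lemma levi_base: "root_base (scaleQ G) (sub_roots (over S)) (coroot G) (over S)"
  by (rule root_base_sub_roots[OF over_base])

abbreviation levi_weyl :: "('v \<Rightarrow> rat) set \<Rightarrow> ('v \<Rightarrow> 'v) set" where
  "levi_weyl S \<equiv> root_base.weyl (scaleQ G) (coroot G) (over S)"

abbreviation levi_dominant :: "('v \<Rightarrow> rat) set \<Rightarrow> 'v \<Rightarrow> bool" where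
  "levi_dominant S \<equiv> root_base.dominant (over S)"

lemma Levi_weyl_group_eq: "S \<subseteq> Delta G \<Longrightarrow> Levi_weyl_group G S = levi_weyl S"
  using root_base.generate_refl[OF levi_base, of S]
  by (simp add: Levi_weyl_group_def Levi_roots_eq abs_reflection_eq)

lemma over_mono: "S \<subseteq> T \<Longrightarrow> over S \<subseteq> over T"
  by (auto simp: over_def)

lemma levi_weyl_mono: "S \<subseteq> T \<Longrightarrow> levi_weyl S \<subseteq> levi_weyl T"
  unfolding root_base.weyl_def[OF levi_base] by (intro image_mono lists_mono over_mono)

lemma levi_weyl_weyl: "levi_weyl S \<subseteq> weyl"
  unfolding root_base.weyl_def[OF levi_base] weyl_def by (intro image_mono lists_mono over_base)

lemma Levi_conjugate_iff: "S \<subseteq> Delta G \<Longrightarrow> Levi_conjugate G S x y \<longleftrightarrow> (\<exists>w\<in>levi_weyl S. w x = y)"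
  by (simp add: Levi_conjugate_def Levi_weyl_group_eq)

lemma Levi_conjugate_refl: "S \<subseteq> Delta G \<Longrightarrow> Levi_conjugate G S x x"
  unfolding Levi_conjugate_iff using root_base.weyl_id[OF levi_base, of S] by (metis id_apply)

lemma Levi_conjugate_sym: "\<lbrakk>S \<subseteq> Delta G; Levi_conjugate G S x y\<rbrakk> \<Longrightarrow> Levi_conjugate G S y x"
  unfolding Levi_conjugate_iff using root_base.weyl_inverse[OF levi_base, of _ S] by (metis comp_apply id_apply)

lemma Levi_conjugate_trans:
  "\<lbrakk>S \<subseteq> Delta G; Levi_conjugate G S x y; Levi_conjugate G S y z\<rbrakk> \<Longrightarrow> Levi_conjugate G S x z"
  unfolding Levi_conjugate_iff using root_base.weyl_comp[OF levi_base, of _ S] by (metis comp_apply)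

lemma Levi_conjugate_mono:
  "\<lbrakk>S \<subseteq> T; T \<subseteq> Delta G; Levi_conjugate G S x y\<rbrakk> \<Longrightarrow> Levi_conjugate G T x y"
  using levi_weyl_mono[of S T] Levi_conjugate_iff[of S x y] Levi_conjugate_iff[of T x y] by blast

lemma Levi_conjugate_unique:
  "\<lbrakk>S \<subseteq> Delta G; levi_dominant S x; levi_dominant S y; Levi_conjugate G S x y\<rbrakk> \<Longrightarrow> x = y"
  unfolding Levi_conjugate_iff using root_base.weyl_dominant_unique[OF levi_base, of _ S x] by metis

lemma cocharacters_zero: "0 \<in> cocharacters G"
  unfolding cocharacters_def by (rule range_eqI[of _ _ "\<lambda>_. 0"]) simp

lemma cocharacters_add: assumes "x \<in> cocharacters G" "y \<in> cocharacters G" shows "x + y \<in> cocharacters G"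
proof -
  obtain c d where c: "x = (\<Sum>b\<in>zbasis G. of_int (c b) *s b)" "y = (\<Sum>b\<in>zbasis G. of_int (d b) *s b)"
    using assms by (auto simp: cocharacters_def)
  show ?thesis unfolding cocharacters_def
    by (rule range_eqI[of _ _ "\<lambda>b. c b + d b"]) (simp add: c scale_left_distrib sum.distrib)
qed

lemma cocharacters_int_scale: assumes "x \<in> cocharacters G" shows "of_int n *s x \<in> cocharacters G"
proof -
  obtain c where c: "x = (\<Sum>b\<in>zbasis G. of_int (c b) *s b)" using assms by (auto simp: cocharacters_def)
  show ?thesis unfolding cocharacters_def
    by (rule range_eqI[of _ _ "\<lambda>b. n * c b"]) (simp add: c scale_sum_right)
qed

lemma cocharacters_sum: "(\<And>i. i \<in> I \<Longrightarrow> f i \<in> cocharacters G) \<Longrightarrow> (\<Sum>i\<in>I. f i) \<in> cocharacters G"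
  by (induction I rule: infinite_finite_induct) (auto simp: cocharacters_zero cocharacters_add)

lemma refl_cocharacter:
  assumes "\<beta> \<in> abs_roots G" "x \<in> cocharacters G"
  obtains n :: int where "\<beta> x = of_int n" "refl \<beta> x = x + of_int (- n) *s coroot G \<beta>"
    "of_int (- n) *s coroot G \<beta> \<in> cocharacters G"
proof -
  obtain n where "\<beta> x = of_int n" using abs_root_integral[OF assms] Ints_cases by blast
  then show ?thesis using that[of n] cocharacters_int_scale[OF coroot_cocharacter[OF assms(1)], of "- n"]
    by (simp add: refl_def)
qed

lemma weyl_cocharacter:
  assumes "w \<in> weyl" "x \<in> cocharacters G" shows "w x \<in> cocharacters G"
  using assms(1)
proof (induction rule: weyl_induct)
  case (refl \<beta> w)
  obtain n :: int where "refl \<beta> (w x) = w x + of_int (- n) *s coroot G \<beta>"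
    "of_int (- n) *s coroot G \<beta> \<in> cocharacters G"
    using refl_cocharacter[OF base_root[OF refl(1)] refl(3)] by blast
  then show ?case using cocharacters_add[OF refl(3)] by (simp only: comp_apply)
qed (simp add: assms(2))

lemma cochar_pairs_iff:
  "(S, \<mu>) \<in> cochar_pairs G \<longleftrightarrow> S \<subseteq> Delta G \<and> \<mu> \<in> cocharacters G \<and> levi_dominant S \<mu>"
proof -
  have "(\<forall>\<alpha> \<in> Levi_roots G S \<inter> abs_pos_roots G. 0 \<le> \<alpha> \<mu>) \<longleftrightarrow> levi_dominant S \<mu>" if S: "S \<subseteq> Delta G"
  proof
    assume dom: "\<forall>\<alpha> \<in> Levi_roots G S \<inter> abs_pos_roots G. 0 \<le> \<alpha> \<mu>"
    have "\<beta> \<in> Levi_roots G S \<inter> abs_pos_roots G" if "\<beta> \<in> over S" for \<beta>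
      using that base_pos over_base[of S] root_base.base_root[OF levi_base that] by (auto simp: Levi_roots_eq[OF S])
    then show "levi_dominant S \<mu>" using dom unfolding root_base.dominant_def[OF levi_base] by blast
  next
    assume dom: "levi_dominant S \<mu>"
    show "\<forall>\<alpha> \<in> Levi_roots G S \<inter> abs_pos_roots G. 0 \<le> \<alpha> \<mu>"
    proof
      fix \<alpha> assume "\<alpha> \<in> Levi_roots G S \<inter> abs_pos_roots G"
      then have "\<alpha> \<in> positive_roots (sub_roots (over S)) (over S)"
        using pos_sub_roots[OF over_base] by (simp add: Levi_roots_eq[OF S])
      then show "0 \<le> \<alpha> \<mu>" by (rule root_base.pos_nonneg[OF levi_base _ dom])
    qed
  qed
  then show ?thesis by (auto simp: cochar_pairs_def)
qed

lemma cochar_pairsD: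
  assumes "(S, \<mu>) \<in> cochar_pairs G"
  shows "S \<subseteq> Delta G" "\<mu> \<in> cocharacters G" "levi_dominant S \<mu>"
  using assms unfolding cochar_pairs_iff by auto

lemma levi_dominant_conjugate:
  assumes "S \<subseteq> Delta G" "x \<in> cocharacters G"
  obtains y where "(S, y) \<in> cochar_pairs G" "Levi_conjugate G S x y"
proof -
  obtain w where w: "w \<in> levi_weyl S" "levi_dominant S (w x)"
    using root_base.dominant_conjugate[OF levi_base] by blast
  then show ?thesis
    using that[of "w x"] assms weyl_cocharacter levi_weyl_weyl cochar_pairs_iff Levi_conjugate_iff by blast
qed

lemma avg_combination:
  assumes "S \<subseteq> Delta G"
  obtains d where "avg (\<Sum>\<beta>\<in>over S. c \<beta> *s coroot G \<beta>) = combination S d"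
    "(\<And>\<beta>. \<beta> \<in> over S \<Longrightarrow> 0 \<le> c \<beta>) \<Longrightarrow> \<forall>\<delta>\<in>S. 0 \<le> d \<delta>"
proof -
  have "\<forall>\<beta>\<in>over S. \<exists>k>0. rel_coroot G (rel \<beta>) = k *s avg (coroot G \<beta>)"
  proof
    fix \<beta> assume \<beta>: "\<beta> \<in> over S"
    then have "rel \<beta> \<in> Delta G" "\<beta> \<in> over {rel \<beta>}" using assms by (auto simp: over_def)
    then show "\<exists>k>0. rel_coroot G (rel \<beta>) = k *s avg (coroot G \<beta>)" using rel_coroot_avg by blast
  qed
  then obtain k where k: "\<And>\<beta>. \<beta> \<in> over S \<Longrightarrow> (0::rat) < k \<beta>"
    "\<And>\<beta>. \<beta> \<in> over S \<Longrightarrow> rel_coroot G (rel \<beta>) = k \<beta> *s avg (coroot G \<beta>)" by metis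
  have avg_c: "avg (coroot G \<beta>) = (1 / k \<beta>) *s rel_coroot G (rel \<beta>)" if "\<beta> \<in> over S" for \<beta>
    using k[OF that] by simp
  define d where "d = (\<lambda>\<delta>. \<Sum>\<beta>\<in>{\<beta> \<in> over S. rel \<beta> = \<delta>}. c \<beta> / k \<beta>)"
  have fin: "finite (over S)" "finite S"
    using finite_base over_base finite_Delta assms by (meson finite_subset)+
  have "avg (\<Sum>\<beta>\<in>over S. c \<beta> *s coroot G \<beta>) = (\<Sum>\<beta>\<in>over S. (c \<beta> / k \<beta>) *s rel_coroot G (rel \<beta>))"
    by (simp add: avg_sum avg_scale avg_c)
  also have "\<dots> = (\<Sum>\<delta>\<in>S. \<Sum>\<beta>\<in>{\<beta> \<in> over S. rel \<beta> = \<delta>}. (c \<beta> / k \<beta>) *s rel_coroot G (rel \<beta>))"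
    by (rule sum.group[symmetric]) (use fin in \<open>auto simp: over_def\<close>)
  also have "\<dots> = combination S d"
    by (simp add: d_def scale_sum_left)
  finally have "avg (\<Sum>\<beta>\<in>over S. c \<beta> *s coroot G \<beta>) = combination S d" .
  moreover have "\<forall>\<delta>\<in>S. 0 \<le> d \<delta>" if "\<And>\<beta>. \<beta> \<in> over S \<Longrightarrow> 0 \<le> c \<beta>"
    using that k(1) by (auto simp: d_def less_imp_le intro!: sum_nonneg divide_nonneg_nonneg)
  ultimately show ?thesis using that by blast
qed

lemma proj_conjugate:
  assumes "S \<subseteq> Delta G" "Levi_conjugate G S x y" shows "proj S (avg x) = proj S (avg y)"
proof -
  obtain w where w: "w \<in> levi_weyl S" "w x = y" using assms Levi_conjugate_iff by blast
  obtain c where "x - y = (\<Sum>\<beta>\<in>over S. c \<beta> *s coroot G \<beta>)"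
    using root_base.coroot_cone_diff_weyl[OF levi_base w(1), of x] w(2) by blast
  then have "\<exists>d. avg x - avg y = combination S d"
    using avg_combination[OF assms(1), of c] by (metis avg_diff)
  then show ?thesis using P_shift[OF assms(1) avg_frakA avg_frakA] by blast
qed

subsection \<open>The order on cocharacter pairs\<close>

definition allowed :: "'v \<Rightarrow> ('v \<Rightarrow> rat) set \<Rightarrow> ('v \<Rightarrow> rat) set" where
  "allowed x S = {\<alpha> \<in> Delta G - S. 0 < \<alpha> (proj S x)}"

lemma locally_free_allowed: assumes "x \<in> frakA G" shows "locally_free (allowed x) (Delta G)"
proof
  show "finite (Delta G)" by (rule finite_Delta)
  fix S a b
  assume S: "S \<subseteq> Delta G" "a \<in> Delta G - S" "b \<in> Delta G - S" "a \<noteq> b" "a \<in> allowed x S" "b \<in> allowed x S"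
  have "b (proj S x) \<le> b (proj (insert a S) x)"
    by (rule allowed_mono[OF _ assms]) (use S in \<open>auto simp: allowed_def\<close>)
  moreover have "0 < b (proj S x)" using S(6) by (simp add: allowed_def)
  ultimately show "b \<in> allowed x (insert a S)" using S(3,4) by (simp add: allowed_def)
qed

lemma elementary_step_iff:
  assumes "(S, \<mu>) \<in> cochar_pairs G" "(insert \<alpha> S, \<mu>') \<in> cochar_pairs G" "\<alpha> \<notin> S"
    and conj: "Levi_conjugate G (insert \<alpha> S) \<mu> \<mu>'"
  shows "((S, \<mu>), (insert \<alpha> S, \<mu>')) \<in> elementary_step G \<longleftrightarrow> 0 < \<alpha> (proj S (avg \<mu>))"
proof -
  have S: "insert \<alpha> S \<subseteq> Delta G" by (rule cochar_pairsD(1)[OF assms(2)])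
  have "insert \<alpha> S - S = {\<alpha>}" using assms(3) by blast
  then have "((S, \<mu>), (insert \<alpha> S, \<mu>')) \<in> elementary_step G \<longleftrightarrow>
      prec G (proj (insert \<alpha> S) (avg \<mu>)) (proj S (avg \<mu>))"
    using assms proj_conjugate[OF S conj] by (auto simp: elementary_step_def theta_eq)
  also have "\<dots> \<longleftrightarrow> 0 < \<alpha> (proj S (avg \<mu>))"
    unfolding prec_def prec_eq_def by (rule step_iff[OF S assms(3) avg_frakA])
  finally show ?thesis .
qed

lemma cochar_le_iff:
  assumes p: "(S, \<mu>) \<in> cochar_pairs G"
  shows "cochar_le G (S, \<mu>) (T, \<mu>') \<longleftrightarrow> (T, \<mu>') \<in> cochar_pairs G \<and>
    reachable (allowed (avg \<mu>)) (Delta G) S T \<and> Levi_conjugate G T \<mu> \<mu>'"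
proof
  have S: "S \<subseteq> Delta G" "\<mu> \<in> cocharacters G" using cochar_pairsD[OF p] by auto
  {
    assume "cochar_le G (S, \<mu>) (T, \<mu>')"
    then have "((S, \<mu>), (T, \<mu>')) \<in> (elementary_step G)\<^sup>*" "(T, \<mu>') \<in> cochar_pairs G"
      by (auto simp: cochar_le_def)
    then show "(T, \<mu>') \<in> cochar_pairs G \<and>
        reachable (allowed (avg \<mu>)) (Delta G) S T \<and> Levi_conjugate G T \<mu> \<mu>'"
    proof (induction rule: rtrancl_induct2)
      case refl
      then show ?case using reachable.base Levi_conjugate_refl[OF S(1)] by blast
    next
      case (step T \<mu>' U \<mu>'')
      have CP: "(T, \<mu>') \<in> cochar_pairs G" "(U, \<mu>'') \<in> cochar_pairs G" "T \<subseteq> U" "card (U - T) = 1"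
        and conj': "Levi_conjugate G U \<mu>' \<mu>''"
        using step(2) by (auto simp: elementary_step_def)
      then have IH: "reachable (allowed (avg \<mu>)) (Delta G) S T" "Levi_conjugate G T \<mu> \<mu>'" using step by auto
      have U: "U \<subseteq> Delta G" by (rule cochar_pairsD(1)[OF CP(2)])
      obtain \<alpha> where "U - T = {\<alpha>}" using CP(4) by (rule card_1_singletonE)
      then have \<alpha>: "\<alpha> \<notin> T" "U = insert \<alpha> T" using CP(3) by auto
      have "0 < \<alpha> (proj T (avg \<mu>'))"
        using elementary_step_iff[OF CP(1) CP(2)[unfolded \<alpha>(2)] \<alpha>(1)] conj' step(2) \<alpha>(2) by blast
      moreover have "proj T (avg \<mu>') = proj T (avg \<mu>)"
        using proj_conjugate[OF _ IH(2)] CP(3) U by auto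
      ultimately have "\<alpha> \<in> allowed (avg \<mu>) T" using \<alpha> U by (auto simp: allowed_def)
      then have "reachable (allowed (avg \<mu>)) (Delta G) S U"
        using reachable.step[OF IH(1), of \<alpha>] \<alpha> U by auto
      moreover have "Levi_conjugate G U \<mu> \<mu>''"
        using Levi_conjugate_trans[OF U Levi_conjugate_mono[OF CP(3) U IH(2)] conj'] .
      ultimately show ?case using CP(2) by blast
    qed
  next
    assume "(T, \<mu>') \<in> cochar_pairs G \<and>
        reachable (allowed (avg \<mu>)) (Delta G) S T \<and> Levi_conjugate G T \<mu> \<mu>'"
    then have "reachable (allowed (avg \<mu>)) (Delta G) S T" "(T, \<mu>') \<in> cochar_pairs G" "Levi_conjugate G T \<mu> \<mu>'"
      by auto
    then have "((S, \<mu>), (T, \<mu>')) \<in> (elementary_step G)\<^sup>*"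
    proof (induction arbitrary: \<mu>' rule: reachable.induct)
      case base
      then have "\<mu> = \<mu>'" using cochar_pairsD(3) p by (intro Levi_conjugate_unique[OF S(1)]) auto
      then show ?case by simp
    next
      case (step T \<alpha>)
      have U: "insert \<alpha> T \<subseteq> Delta G" by (rule cochar_pairsD(1)[OF step.prems(1)])
      then have T: "T \<subseteq> Delta G" by blast
      obtain \<nu> where \<nu>: "(T, \<nu>) \<in> cochar_pairs G" "Levi_conjugate G T \<mu> \<nu>"
        using levi_dominant_conjugate[OF T S(2)] .
      have "Levi_conjugate G (insert \<alpha> T) \<nu> \<mu>'"
        using Levi_conjugate_trans[OF U Levi_conjugate_sym[OF U Levi_conjugate_mono[OF subset_insertI U \<nu>(2)]] step.prems(2)] .
      moreover have "0 < \<alpha> (proj T (avg \<nu>))"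
        using step.hyps(4) proj_conjugate[OF T \<nu>(2)] by (simp add: allowed_def)
      ultimately have "((T, \<nu>), (insert \<alpha> T, \<mu>')) \<in> elementary_step G"
        using elementary_step_iff[OF \<nu>(1) step.prems(1) step.hyps(3)] by blast
      then show ?case using step.IH[OF \<nu>] by (rule rtrancl_into_rtrancl[rotated])
    qed
    then show "cochar_le G (S, \<mu>) (T, \<mu>')" using p \<open>(T, \<mu>') \<in> cochar_pairs G \<and> _\<close> by (simp add: cochar_le_def)
  }
qed

lemma cochar_le_trans: "\<lbrakk>cochar_le G p q; cochar_le G q r\<rbrakk> \<Longrightarrow> cochar_le G p r"
  by (auto simp: cochar_le_def)

lemma strictly_decreasing_iff:
  assumes "(T, \<nu>) \<in> cochar_pairs G"
  shows "strictly_decreasing G (T, \<nu>) \<longleftrightarrow> Delta G - T \<subseteq> allowed (avg \<nu>) T"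
proof -
  have T: "T \<subseteq> Delta G" by (rule cochar_pairsD(1)[OF assms])
  have "\<alpha> (proj T (avg \<nu>)) = 0" if "\<alpha> \<in> T" for \<alpha> by (rule proj_zero[OF T avg_frakA that])
  then show ?thesis
    using assms proj_frakA[OF T avg_frakA, of \<nu>]
    by (auto simp: strictly_decreasing_def frakA_Levi_pos_def theta_eq allowed_def)
qed

lemma SD_I:
  assumes "strictly_decreasing G (T, \<nu>)" "(Delta G, \<mu>) \<in> cochar_pairs G" "Levi_conjugate G (Delta G) \<nu> \<mu>"
  shows "(T, \<nu>) \<in> SD G \<mu>"
proof -
  have CP: "(T, \<nu>) \<in> cochar_pairs G" using assms(1) by (simp add: strictly_decreasing_def)
  have T: "T \<subseteq> Delta G" by (rule cochar_pairsD(1)[OF CP])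
  have "reachable (allowed (avg \<nu>)) (Delta G) T (Delta G)"
    using locally_free.free_reachable[OF locally_free_allowed[OF avg_frakA] T] strictly_decreasing_iff[OF CP] assms(1)
    by blast
  then show ?thesis using cochar_le_iff[OF CP] assms by (simp add: SD_def)
qed

lemma SD_sum:
  assumes \<mu>: "(Delta G, \<mu>) \<in> cochar_pairs G" and p: "(S, \<nu>) \<in> cochar_pairs G"
  shows "(\<Sum>q | q \<in> SD G \<mu> \<and> cochar_le G (S, \<nu>) q. (-1) ^ card (fst q - S)) = (if (S, \<nu>) = (Delta G, \<mu>) then 1 else 0 :: int)"
proof (cases "Levi_conjugate G (Delta G) \<nu> \<mu>")
  case False
  have "\<not> cochar_le G (S, \<nu>) q" if "q \<in> SD G \<mu>" for q
  proof
    assume "cochar_le G (S, \<nu>) q"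
    then have "cochar_le G (S, \<nu>) (Delta G, \<mu>)" using that cochar_le_trans by (auto simp: SD_def)
    then show False using cochar_le_iff[OF p] False by blast
  qed
  then have none: "{q. q \<in> SD G \<mu> \<and> cochar_le G (S, \<nu>) q} = {}" by blast
  have "(S, \<nu>) \<noteq> (Delta G, \<mu>)" using False Levi_conjugate_refl[OF order_refl, of \<mu>] by auto
  then show ?thesis unfolding none by simp
next
  case True
  have S: "S \<subseteq> Delta G" "\<nu> \<in> cocharacters G" using cochar_pairsD[OF p] by auto
  let ?A = "allowed (avg \<nu>)"
  let ?Q = "{q. q \<in> SD G \<mu> \<and> cochar_le G (S, \<nu>) q}"
  let ?F = "{T. reachable ?A (Delta G) S T \<and> Delta G - T \<subseteq> ?A T}"
  have allowed_eq: "allowed (avg \<nu>') T = ?A T" if "T \<subseteq> Delta G" "Levi_conjugate G T \<nu> \<nu>'" for T \<nu>'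
    using proj_conjugate[OF that] by (simp add: allowed_def)
  have Q: "T \<subseteq> Delta G \<and> T \<in> ?F \<and> (T, \<nu>') \<in> cochar_pairs G \<and> Levi_conjugate G T \<nu> \<nu>'" if "(T, \<nu>') \<in> ?Q" for T \<nu>'
  proof -
    have le: "(T, \<nu>') \<in> cochar_pairs G" "reachable ?A (Delta G) S T" "Levi_conjugate G T \<nu> \<nu>'"
      using that cochar_le_iff[OF p] by auto
    have T: "T \<subseteq> Delta G" by (rule cochar_pairsD(1)[OF le(1)])
    have "Delta G - T \<subseteq> ?A T"
      using that strictly_decreasing_iff[OF le(1)] allowed_eq[OF T le(3)] by (simp add: SD_def)
    then show ?thesis using le T by blast
  qed
  have "bij_betw fst ?Q ?F"
    unfolding bij_betw_def
  proof
    show "inj_on fst ?Q"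
    proof (rule inj_onI)
      fix q q' assume "q \<in> ?Q" "q' \<in> ?Q" and eq: "fst q = fst q'"
      then obtain T \<nu>1 \<nu>2 where q: "q = (T, \<nu>1)" "q' = (T, \<nu>2)" "(T, \<nu>1) \<in> ?Q" "(T, \<nu>2) \<in> ?Q"
        by (metis prod.collapse)
      note Q1 = Q[OF q(3)] and Q2 = Q[OF q(4)]
      have T: "T \<subseteq> Delta G" using Q1 by blast
      have "Levi_conjugate G T \<nu>1 \<nu>2"
        using Levi_conjugate_trans[OF T Levi_conjugate_sym[OF T]] Q1 Q2 by blast
      then show "q = q'" using Levi_conjugate_unique[OF T] cochar_pairsD(3) Q1 Q2 q(1,2) by blast
    qed
    show "fst ` ?Q = ?F"
    proof (intro equalityI subsetI)
      fix T assume "T \<in> fst ` ?Q"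
      then show "T \<in> ?F" using Q by force
    next
      fix T assume T: "T \<in> ?F"
      then have TD: "T \<subseteq> Delta G" using reachable_bounds[of ?A "Delta G" S T] S by blast
      obtain \<nu>' where \<nu>': "(T, \<nu>') \<in> cochar_pairs G" "Levi_conjugate G T \<nu> \<nu>'"
        using levi_dominant_conjugate[OF TD S(2)] .
      have "strictly_decreasing G (T, \<nu>')"
        using strictly_decreasing_iff[OF \<nu>'(1)] allowed_eq[OF TD \<nu>'(2)] T by simp
      moreover have "Levi_conjugate G (Delta G) \<nu>' \<mu>"
        using Levi_conjugate_trans[OF order_refl Levi_conjugate_sym[OF order_refl Levi_conjugate_mono[OF TD order_refl \<nu>'(2)]] True] .
      ultimately have "(T, \<nu>') \<in> SD G \<mu>" using SD_I \<mu> by blast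
      moreover have "cochar_le G (S, \<nu>) (T, \<nu>')" using cochar_le_iff[OF p] \<nu>' T by blast
      ultimately show "T \<in> fst ` ?Q" by (intro image_eqI[of _ _ "(T, \<nu>')"]) auto
    qed
  qed
  from sum.reindex_bij_betw[OF this, of "\<lambda>T. (-1::int) ^ card (T - S)"]
  have "(\<Sum>q\<in>?Q. (-1::int) ^ card (fst q - S)) = (\<Sum>T\<in>?F. (-1) ^ card (T - S))" .
  also have "\<dots> = (if S = Delta G then 1 else 0)"
    by (rule locally_free.free_sum[OF locally_free_allowed[OF avg_frakA] order_refl S(1)])
  also have "S = Delta G \<longleftrightarrow> (S, \<nu>) = (Delta G, \<mu>)"
    using Levi_conjugate_unique[OF order_refl _ _ True] cochar_pairsD(3)[OF p] cochar_pairsD(3)[OF \<mu>] by auto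
  finally show ?thesis .
qed

subsection \<open>Finiteness\<close>

lemma dual_center_coroot:
  assumes t: "t \<in> dual_center_inv G" and \<alpha>: "\<alpha> \<in> abs_roots G"
  shows "t (of_int n *s coroot G \<alpha>) = 1"
proof -
  let ?c = "coroot G \<alpha>"
  have c: "of_int m *s ?c \<in> cocharacters G" for m
    by (rule cocharacters_int_scale[OF coroot_cocharacter[OF \<alpha>]])
  have hom: "t (x + y) = t x * t y" "t x \<noteq> 0" if "x \<in> cocharacters G" "y \<in> cocharacters G" for x y
    using t that by (auto simp: dual_center_inv_def dual_torus_def)
  have c1: "t ?c = 1" using t \<alpha> by (simp add: dual_center_inv_def)
  have suc: "t (of_int (m + 1) *s ?c) = t (of_int m *s ?c)" for m
    using hom(1)[OF c[of m] c[of 1]] c1 by (simp add: scale_left_distrib)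
  show ?thesis
  proof (induction n rule: int_induct[of _ 0])
    case base
    show ?case using hom[OF c[of 0] c[of 0]] by simp
  next
    case (step1 i)
    then show ?case using suc[of i] by simp
  next
    case (step2 i)
    then show ?case using suc[of "i - 1"] by simp
  qed
qed

lemma dual_restrict_weyl:
  assumes "w \<in> weyl" "x \<in> cocharacters G" shows "dual_restrict G (w x) = dual_restrict G x"
proof -
  have "t (w x) = t x" if t: "t \<in> dual_center_inv G" for t
    using assms(1)
  proof (induction rule: weyl_induct)
    case (refl \<beta> w)
    have wx: "w x \<in> cocharacters G" by (rule weyl_cocharacter[OF refl(2) assms(2)])
    obtain n :: int where n: "refl \<beta> (w x) = w x + of_int (- n) *s coroot G \<beta>"
      "of_int (- n) *s coroot G \<beta> \<in> cocharacters G"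
      using refl_cocharacter[OF base_root[OF refl(1)] wx] by blast
    have "t (w x + of_int (- n) *s coroot G \<beta>) = t (w x) * t (of_int (- n) *s coroot G \<beta>)"
      using t wx n(2) unfolding dual_center_inv_def dual_torus_def by blast
    then show ?case using n(1) refl(3) dual_center_coroot[OF t base_root[OF refl(1)]] by (simp only: comp_apply mult_1_right)
  qed simp
  then show ?thesis unfolding dual_restrict_def by (intro restrict_ext)
qed

lemma theta_integral:
  assumes "S \<subseteq> Delta G" "\<mu> \<in> cocharacters G" "\<delta> \<in> Delta G"
  shows "of_nat (card (rel_Levi_weyl_group G S) * card gal) * \<delta> (theta G S \<mu>) \<in> \<int>"
proof -
  let ?W = "rel_Levi_weyl_group G S"
  define y where "y = (\<Sum>h\<in>gal. h \<mu>)"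
  have y: "y = of_nat (card gal) *s avg \<mu>" using card_gal by (simp add: y_def avg_def)
  have y_coch: "y \<in> cocharacters G"
    unfolding y_def
  proof (rule cocharacters_sum)
    fix h assume "h \<in> gal"
    then show "h \<mu> \<in> cocharacters G" by (rule gal_cocharacter[OF _ assms(2)])
  qed
  have yA: "y \<in> frakA G" unfolding y by (intro frakA_subspace(3) avg_frakA)
  have "\<sigma> y \<in> cocharacters G" if "\<sigma> \<in> ?W" for \<sigma>
    using rel_Levi_weyl[OF assms(1) that] yA weyl_cocharacter[OF _ y_coch] by metis
  then have "(\<Sum>\<sigma>\<in>?W. \<sigma> y) \<in> cocharacters G" by (rule cocharacters_sum)
  moreover have "(\<Sum>\<sigma>\<in>?W. \<sigma> y) = of_nat (card ?W * card gal) *s theta G S \<mu>"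
  proof -
    have "of_nat (card ?W) *s proj S y = (\<Sum>\<sigma>\<in>?W. \<sigma> y)"
      using card_rel_Levi[OF assms(1)] by (simp add: proj_def)
    moreover have "proj S y = of_nat (card gal) *s theta G S \<mu>"
      by (simp add: y theta_eq proj_scale[OF assms(1) avg_frakA])
    ultimately show ?thesis by simp
  qed
  ultimately have coch: "of_nat (card ?W * card gal) *s theta G S \<mu> \<in> cocharacters G" by simp
  obtain \<beta> where \<beta>: "\<beta> \<in> abs_simple_roots G" "\<delta> = rel \<beta>" using over_Delta[OF assms(3)] by blast
  have "\<beta> (of_nat (card ?W * card gal) *s theta G S \<mu>) \<in> \<int>"
    by (rule abs_root_integral[OF base_root[OF \<beta>(1)] coch])
  moreover have "theta G S \<mu> \<in> frakA G" unfolding theta_eq by (rule proj_frakA[OF assms(1) avg_frakA])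
  ultimately show ?thesis using \<beta>(2) by (simp add: rel_apply root_scale[OF base_root[OF \<beta>(1)]])
qed

lemma prec_eq_form_le:
  assumes "x \<in> frakA G" "y \<in> frakA G" "prec_eq G x y" "\<forall>\<delta>\<in>Delta G. 0 \<le> \<delta> x"
  shows "form x x \<le> form y y"
proof -
  obtain c where c: "\<forall>\<delta>\<in>Delta G. 0 \<le> c \<delta>" "y - x = combination (Delta G) c"
    using assms(3) by (auto simp: prec_eq_def)
  let ?z = "combination (Delta G) c"
  have y: "y = x + ?z" using c(2) by (simp add: algebra_simps)
  have "form ?z x = (\<Sum>\<delta>\<in>Delta G. c \<delta> * form (rel_coroot G \<delta>) x)" by (simp add: form_sum form_scale)
  also have "0 \<le> \<dots>"
  proof (intro sum_nonneg mult_nonneg_nonneg)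
    fix \<delta> assume \<delta>: "\<delta> \<in> Delta G"
    obtain t where "0 < t" "form (rel_coroot G \<delta>) x = t * \<delta> x" using form_rel_coroot[OF \<delta>] assms(1) by blast
    then show "0 \<le> form (rel_coroot G \<delta>) x" using bspec[OF assms(4) \<delta>] by simp
  qed (use c(1) in blast)
  finally have "0 \<le> form ?z x" .
  moreover have "form y y = form x x + 2 * form ?z x + form ?z ?z"
    unfolding y by (simp add: form_add form_add_right form_sym[of x ?z])
  ultimately show ?thesis using form_nonneg[of ?z] by simp
qed

lemma finite_bounded_integral:
  assumes "0 < n" shows "finite {r :: rat. of_nat n * r \<in> \<int> \<and> r * r \<le> K}"
proof (rule finite_subset)
  define m where "m = \<lceil>of_nat n * of_nat n * K\<rceil>"
  show "finite ((\<lambda>k. of_int k / of_nat n :: rat) ` {- m..m})" by simp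
  show "{r. of_nat n * r \<in> \<int> \<and> r * r \<le> K} \<subseteq> (\<lambda>k. of_int k / of_nat n) ` {- m..m}"
  proof
    fix r assume "r \<in> {r. of_nat n * r \<in> \<int> \<and> r * r \<le> K}"
    then obtain k where k: "of_nat n * r = of_int k" and le: "r * r \<le> K" by (auto elim: Ints_cases)
    have "of_int (k * k) = (of_nat n * of_nat n) * (r * r)" using k by (metis mult.commute mult.left_commute of_int_mult)
    also have "\<dots> \<le> (of_nat n * of_nat n) * K" using le by (intro mult_left_mono) auto
    also have "\<dots> \<le> of_int m" by (simp add: m_def)
    finally have km: "k * k \<le> m" by (simp only: of_int_le_iff)
    have "\<bar>k\<bar> \<le> k * k"
    proof (cases "k = 0")
      case False
      then have "\<bar>k\<bar> * 1 \<le> \<bar>k\<bar> * \<bar>k\<bar>" by (intro mult_left_mono) auto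
      then show ?thesis by (simp add: abs_mult_self_eq)
    qed simp
    then have "k \<in> {- m..m}" using km by auto
    moreover have "r = of_int k / of_nat n" using k assms by (simp add: field_simps)
    ultimately show "r \<in> (\<lambda>k. of_int k / of_nat n) ` {- m..m}" by blast
  qed
qed

lemma finite_bounded_lattice:
  assumes "0 < n"
  shows "finite {x \<in> frakA G. (\<exists>c. y - x = combination (Delta G) c) \<and>
    (\<forall>\<delta>\<in>Delta G. of_nat n * \<delta> x \<in> \<int> \<and> \<delta> x * \<delta> x \<le> K)}" (is "finite ?X")
proof (rule inj_on_finite)
  let ?f = "\<lambda>x. \<lambda>\<delta>\<in>Delta G. \<delta> x"
  let ?R = "{r :: rat. of_nat n * r \<in> \<int> \<and> r * r \<le> K}"
  show "?f ` ?X \<subseteq> (Delta G \<rightarrow>\<^sub>E ?R)" by auto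
  show "finite (Delta G \<rightarrow>\<^sub>E ?R)" using finite_bounded_integral[OF assms] finite_Delta by (intro finite_PiE)
  show "inj_on ?f ?X"
  proof (rule inj_onI)
    fix x x' assume x: "x \<in> ?X" and x': "x' \<in> ?X" and eq: "?f x = ?f x'"
    obtain c where c: "y - x = combination (Delta G) c" using x by blast
    obtain c' where c': "y - x' = combination (Delta G) c'" using x' by blast
    have diff: "x - x' = combination (Delta G) (\<lambda>\<epsilon>. c' \<epsilon> - c \<epsilon>)"
      unfolding combination_diff[symmetric] c[symmetric] c'[symmetric] by simp
    have "\<delta> (x - x') = 0" if "\<delta> \<in> Delta G" for \<delta>
      using fun_cong[OF eq, of \<delta>] that x x' by (simp add: Delta_linear)
    then have "combination (Delta G) (\<lambda>\<epsilon>. c' \<epsilon> - c \<epsilon>) = 0"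
      unfolding diff by (rule e_indep[OF order_refl])
    then show "x = x'" using diff by simp
  qed
qed

lemma finite_orbit:
  "finite {p \<in> cochar_pairs G. Levi_conjugate G (Delta G) (snd p) \<mu>}" (is "finite ?X")
proof (rule finite_subset)
  show "finite (Pow (Delta G) \<times> (\<lambda>w. w \<mu>) ` weyl)" using finite_Delta finite_weyl by simp
  show "?X \<subseteq> Pow (Delta G) \<times> (\<lambda>w. w \<mu>) ` weyl"
  proof
    fix p assume p: "p \<in> ?X"
    obtain w where "w \<in> levi_weyl (Delta G)" "w \<mu> = snd p"
      using Levi_conjugate_sym[OF order_refl, of "snd p" \<mu>] p Levi_conjugate_iff[OF order_refl, of \<mu> "snd p"] by blast
    moreover have "fst p \<subseteq> Delta G" using cochar_pairsD(1)[of "fst p" "snd p"] p by simp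
    ultimately show "p \<in> Pow (Delta G) \<times> (\<lambda>w. w \<mu>) ` weyl"
      using levi_weyl_weyl unfolding mem_Times_iff by (metis PowI image_eqI subsetD)
  qed
qed

lemma theta_prec_eq:
  assumes p: "(S, \<nu>) \<in> cochar_pairs G" and \<mu>: "(Delta G, \<mu>) \<in> cochar_pairs G"
    and conj: "Levi_conjugate G (Delta G) \<nu> \<mu>"
  shows "prec_eq G (theta G S \<nu>) (Gal_average G \<mu>)"
proof -
  have S: "S \<subseteq> Delta G" by (rule cochar_pairsD(1)[OF p])
  obtain w where w: "w \<in> levi_weyl (Delta G)" "w \<mu> = \<nu>"
    using Levi_conjugate_sym[OF order_refl conj] Levi_conjugate_iff[OF order_refl] by blast
  have "\<mu> - \<nu> \<in> root_base.coroot_cone (scaleQ G) (coroot G) (over (Delta G))"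
    using root_base.dominant_weyl_le[OF levi_base cochar_pairsD(3)[OF \<mu>] w(1)] w(2) by simp
  then obtain c where c: "\<forall>\<beta>\<in>over (Delta G). 0 \<le> c \<beta>" "\<mu> - \<nu> = (\<Sum>\<beta>\<in>over (Delta G). c \<beta> *s coroot G \<beta>)"
    unfolding root_base.coroot_cone_def[OF levi_base] by blast
  obtain d where d: "avg \<mu> - avg \<nu> = combination (Delta G) d" "\<forall>\<delta>\<in>Delta G. 0 \<le> d \<delta>"
    using avg_combination[OF order_refl, of c] c by (metis avg_diff)
  have "0 \<le> \<delta> (avg \<nu>)" if \<delta>: "\<delta> \<in> S" for \<delta>
  proof -
    obtain \<beta> where \<beta>: "\<beta> \<in> abs_simple_roots G" "\<delta> = rel \<beta>" using over_Delta S \<delta> by blast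
    have "0 \<le> \<beta> (h \<nu>)" if h: "h \<in> gal" for h
    proof -
      have "\<beta> \<circ> h \<in> over S" using over_gal[OF h] \<beta> \<delta> by (simp add: over_def)
      then show ?thesis using cochar_pairsD(3)[OF p] unfolding root_base.dominant_def[OF levi_base] by fastforce
    qed
    then have "0 \<le> (\<Sum>h\<in>gal. \<beta> (h \<nu>))" by (rule sum_nonneg)
    then have "0 \<le> \<beta> (avg \<nu>)"
      unfolding root_avg[OF base_root[OF \<beta>(1)]] by (intro mult_nonneg_nonneg) auto
    then show ?thesis using avg_frakA by (simp add: \<beta>(2) rel_apply)
  qed
  then obtain f where f: "\<forall>\<epsilon>\<in>S. 0 \<le> f \<epsilon>" "avg \<nu> - proj S (avg \<nu>) = combination S f"
    using nonneg_P[OF S avg_frakA] by blast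
  let ?f = "\<lambda>\<epsilon>. if \<epsilon> \<in> S then f \<epsilon> else 0"
  have "avg \<mu> - proj S (avg \<nu>) = (avg \<mu> - avg \<nu>) + (avg \<nu> - proj S (avg \<nu>))" by simp
  also have "\<dots> = combination (Delta G) (\<lambda>\<epsilon>. d \<epsilon> + ?f \<epsilon>)"
    unfolding d(1) f(2) combination_mono[OF S order_refl] by (simp only: scale_left_distrib sum.distrib)
  finally show ?thesis
    unfolding prec_eq_def theta_eq Gal_average_eq using d(2) f(1)
    by (intro exI[of _ "\<lambda>\<epsilon>. d \<epsilon> + ?f \<epsilon>"]) auto
qed

end

context quasisplit_group
begin

lemma Tmap_facts:
  assumes "strictly_decreasing G (S, \<nu>)"
  shows "Tmap G (S, \<nu>) \<in> Kottwitz_set G" "kottwitz G (Tmap G (S, \<nu>)) = dual_restrict G \<nu>"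
    "newton G (Tmap G (S, \<nu>)) = theta G S \<nu>" "Levi_of G (Tmap G (S, \<nu>)) = S"
proof -
  obtain b where b: "b \<in> Kottwitz_set G" "newton G b = theta G S \<nu>" "kottwitz G b = dual_restrict G \<nu>"
    using newton_kottwitz_exists[OF assms] by blast
  have eq: "Tmap G (S, \<nu>) = b"
    unfolding Tmap_def by (rule the_equality) (use b newton_kottwitz_inj in auto)
  show "Tmap G (S, \<nu>) \<in> Kottwitz_set G" "kottwitz G (Tmap G (S, \<nu>)) = dual_restrict G \<nu>"
    "newton G (Tmap G (S, \<nu>)) = theta G S \<nu>"
    using b eq by auto
  have S: "S \<subseteq> Delta G" using assms cochar_pairsD(1)[of S \<nu>] by (simp add: strictly_decreasing_def)
  have pos: "theta G S \<nu> \<in> frakA G" "\<forall>\<alpha>\<in>S. \<alpha> (theta G S \<nu>) = 0" "\<forall>\<alpha>\<in>Delta G - S. \<alpha> (theta G S \<nu>) > 0"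
    using assms by (auto simp: strictly_decreasing_def frakA_Levi_pos_def)
  show "Levi_of G (Tmap G (S, \<nu>)) = S"
    unfolding Levi_of_def eq b(2)
  proof (rule the_equality)
    have "\<alpha> (theta G S \<nu>) \<noteq> 0" if "\<alpha> \<in> Delta G - S" for \<alpha> using bspec[OF pos(3) that] by simp
    then show "S \<subseteq> Delta G \<and> theta G S \<nu> \<in> frakA_Levi G S"
      unfolding frakA_Levi_def using S pos(1,2) by blast
    fix T assume T: "T \<subseteq> Delta G \<and> theta G S \<nu> \<in> frakA_Levi G T"
    have "\<alpha> \<in> T \<longleftrightarrow> \<alpha> \<in> S" if "\<alpha> \<in> Delta G" for \<alpha>
      using that T bspec[OF pos(2), of \<alpha>] bspec[OF pos(3), of \<alpha>] unfolding frakA_Levi_def by force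
    then show "T = S" using T S by blast
  qed
qed

lemma finite_BGmu: "finite (BGmu G \<mu>)"
proof (rule inj_on_finite)
  show "inj_on (newton G) (BGmu G \<mu>)"
    by (rule inj_onI, rule newton_kottwitz_inj) (auto simp: BGmu_def)
  let ?n = "\<lambda>S. card (rel_Levi_weyl_group G S) * card gal"
  let ?X = "\<lambda>S. {x \<in> frakA G. (\<exists>c. avg \<mu> - x = combination (Delta G) c) \<and>
    (\<forall>\<delta>\<in>Delta G. of_nat (?n S) * \<delta> x \<in> \<int> \<and> \<delta> x * \<delta> x \<le> form (avg \<mu>) (avg \<mu>))}"
  show "newton G ` BGmu G \<mu> \<subseteq> (\<Union>S\<in>Pow (Delta G). ?X S)"
  proof
    fix x assume "x \<in> newton G ` BGmu G \<mu>"
    then obtain b where b: "b \<in> Kottwitz_set G" "prec_eq G x (avg \<mu>)" "x = newton G b"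
      by (auto simp: BGmu_def Gal_average_eq)
    obtain S \<nu> where S: "strictly_decreasing G (S, \<nu>)" "x = theta G S \<nu>"
      using newton_kottwitz_image[OF b(1)] b(3) by blast
    have CP: "(S, \<nu>) \<in> cochar_pairs G" using S(1) by (simp add: strictly_decreasing_def)
    have dom: "x \<in> frakA G" "\<forall>\<delta>\<in>Delta G. 0 \<le> \<delta> x" using newton_dominant[OF b(1)] b(3) by auto
    have le: "form x x \<le> form (avg \<mu>) (avg \<mu>)" by (rule prec_eq_form_le[OF dom(1) avg_frakA b(2) dom(2)])
    have "\<delta> x * \<delta> x \<le> form (avg \<mu>) (avg \<mu>)" if \<delta>: "\<delta> \<in> Delta G" for \<delta>
    proof -
      obtain \<beta> where \<beta>: "\<beta> \<in> abs_simple_roots G" "\<delta> = rel \<beta>" using over_Delta[OF \<delta>] by blast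
      have "\<beta> x * \<beta> x \<le> form x x"
        unfolding form_def using finite_roots base_root[OF \<beta>(1)] by (intro member_le_sum) auto
      then show ?thesis using le dom(1) by (simp add: \<beta>(2) rel_apply)
    qed
    moreover have "of_nat (?n S) * \<delta> x \<in> \<int>" if "\<delta> \<in> Delta G" for \<delta>
      unfolding S(2) by (rule theta_integral[OF cochar_pairsD(1,2)[OF CP] that])
    moreover have "\<exists>c. avg \<mu> - x = combination (Delta G) c" using b(2) unfolding prec_eq_def by blast
    ultimately have "x \<in> ?X S" using dom(1) by blast
    then show "x \<in> (\<Union>S\<in>Pow (Delta G). ?X S)" using cochar_pairsD(1)[OF CP] by blast
  qed
  have "finite (?X S)" if "S \<in> Pow (Delta G)" for S
    by (rule finite_bounded_lattice) (use card_rel_Levi[of S] card_gal that in simp)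
  then show "finite (\<Union>S\<in>Pow (Delta G). ?X S)" using finite_Delta by simp
qed

lemma SD_D:
  assumes "(S, \<nu>) \<in> SD G \<mu>"
  shows "strictly_decreasing G (S, \<nu>)" "(S, \<nu>) \<in> cochar_pairs G" "Levi_conjugate G (Delta G) \<nu> \<mu>"
  using assms cochar_le_iff[of S \<nu> "Delta G" \<mu>] by (auto simp: SD_def strictly_decreasing_def)

lemma Tmap_BGmu:
  assumes "(Delta G, \<mu>) \<in> cochar_pairs G" "(S, \<nu>) \<in> SD G \<mu>" shows "Tmap G (S, \<nu>) \<in> BGmu G \<mu>"
proof -
  note q = SD_D[OF assms(2)]
  obtain w where "w \<in> weyl" "w \<nu> = \<mu>"
    using q(3) Levi_conjugate_iff[OF order_refl] levi_weyl_weyl[of "Delta G"] by blast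
  then have "dual_restrict G \<nu> = dual_restrict G \<mu>"
    using dual_restrict_weyl[of w \<nu>] cochar_pairsD(2)[OF q(2)] by simp
  then show ?thesis
    using Tmap_facts[OF q(1)] theta_prec_eq[OF q(2) assms(1) q(3)] by (simp add: BGmu_def)
qed

lemma coefficient_sum:
  assumes \<mu>: "(Delta G, \<mu>) \<in> cochar_pairs G" and p: "(S, \<nu>) \<in> cochar_pairs G"
  shows "(\<Sum>b | b \<in> BGmu G \<mu> \<and> (S, \<nu>) \<in> Rset G b \<mu>. (-1) ^ card (Levi_of G b - S))
    = (if (S, \<nu>) = (Delta G, \<mu>) then 1 else 0 :: int)"
proof -
  let ?Q = "{q. q \<in> SD G \<mu> \<and> cochar_le G (S, \<nu>) q}"
  let ?B = "{b. b \<in> BGmu G \<mu> \<and> (S, \<nu>) \<in> Rset G b \<mu>}"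
  have Levi: "Levi_of G (Tmap G q) = fst q" if "q \<in> ?Q" for q
    using that Tmap_facts(4)[OF SD_D(1)] by (cases q) auto
  have "bij_betw (Tmap G) ?Q ?B"
    unfolding bij_betw_def
  proof
    show "inj_on (Tmap G) ?Q"
    proof (rule inj_onI)
      fix q q' assume q: "q \<in> ?Q" and q': "q' \<in> ?Q" and eq: "Tmap G q = Tmap G q'"
      obtain T \<nu>1 \<nu>2 where T: "q = (T, \<nu>1)" "q' = (T, \<nu>2)"
        using Levi[OF q] Levi[OF q'] eq by (metis prod.collapse)
      have le: "(T, \<nu>1) \<in> cochar_pairs G" "(T, \<nu>2) \<in> cochar_pairs G" "Levi_conjugate G T \<nu> \<nu>1" "Levi_conjugate G T \<nu> \<nu>2"
        using q q' cochar_le_iff[OF p] T by auto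
      have TD: "T \<subseteq> Delta G" by (rule cochar_pairsD(1)[OF le(1)])
      have "Levi_conjugate G T \<nu>1 \<nu>2"
        using Levi_conjugate_trans[OF TD Levi_conjugate_sym[OF TD le(3)] le(4)] .
      then show "q = q'"
        using Levi_conjugate_unique[OF TD cochar_pairsD(3)[OF le(1)] cochar_pairsD(3)[OF le(2)]] T by simp
    qed
    show "Tmap G ` ?Q = ?B"
    proof (intro equalityI subsetI)
      fix b assume "b \<in> Tmap G ` ?Q"
      then obtain T \<nu>' where q: "(T, \<nu>') \<in> ?Q" "b = Tmap G (T, \<nu>')" by auto
      then show "b \<in> ?B" using Tmap_BGmu[OF \<mu>] p by (auto simp: Rset_def Tset_def)
    next
      fix b assume "b \<in> ?B"
      then show "b \<in> Tmap G ` ?Q" by (auto simp: Rset_def Tset_def)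
    qed
  qed
  from sum.reindex_bij_betw[OF this, of "\<lambda>b. (-1::int) ^ card (Levi_of G b - S)"]
  have "(\<Sum>b\<in>?B. (-1::int) ^ card (Levi_of G b - S)) = (\<Sum>q\<in>?Q. (-1) ^ card (Levi_of G (Tmap G q) - S))" by simp
  also have "\<dots> = (\<Sum>q\<in>?Q. (-1) ^ card (fst q - S))" using Levi by (intro sum.cong) auto
  finally show ?thesis using SD_sum[OF \<mu> p] by simp
qed

lemma Rset_orbit:
  assumes "p \<in> Rset G b \<mu>" shows "p \<in> cochar_pairs G" "Levi_conjugate G (Delta G) (snd p) \<mu>"
proof -
  obtain S \<nu> where p: "p = (S, \<nu>)" by (cases p)
  obtain q where q: "q \<in> SD G \<mu>" "cochar_le G p q" using assms by (auto simp: Rset_def Tset_def)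
  show CP: "p \<in> cochar_pairs G" using assms by (simp add: Rset_def)
  have "cochar_le G (S, \<nu>) (Delta G, \<mu>)" using cochar_le_trans[OF q(2)] q(1) p by (auto simp: SD_def)
  then show "Levi_conjugate G (Delta G) (snd p) \<mu>" using cochar_le_iff CP p by simp
qed

end

lemma frag_cmul_sum_left: "frag_cmul (\<Sum>i\<in>I. f i) x = (\<Sum>i\<in>I. frag_cmul (f i) x)"
  by (induction I rule: infinite_finite_induct) (auto simp: frag_cmul_distrib)

theorem theorem2p32:
  fixes G :: "('v::ab_group_add, 'g, 'l) reductive_data"
    and \<mu> :: 'v
  assumes "quasisplit_group G"
    and "(Delta G, \<mu>) \<in> cochar_pairs G"
  shows "(\<Sum>b\<in>BGmu G \<mu>. Msum G b \<mu>) = frag_of (Delta G, \<mu>)"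
proof -
  interpret quasisplit_group G by (rule assms(1))
  define P where "P = {p \<in> cochar_pairs G. Levi_conjugate G (Delta G) (snd p) \<mu>}"
  have finP: "finite P" unfolding P_def by (rule finite_orbit)
  let ?c = "\<lambda>b p. (-1::int) ^ card (Levi_of G b - fst p)"
  have "Msum G b \<mu> = (\<Sum>p\<in>P. if p \<in> Rset G b \<mu> then frag_cmul (?c b p) (frag_of p) else 0)" for b
  proof -
    have "Msum G b \<mu> = (\<Sum>p\<in>Rset G b \<mu>. frag_cmul (?c b p) (frag_of p))"
      unfolding Msum_def by (intro sum.cong) auto
    also have "\<dots> = (\<Sum>p\<in>P. if p \<in> Rset G b \<mu> then frag_cmul (?c b p) (frag_of p) else 0)"
      using finP Rset_orbit by (intro sum.mono_neutral_cong_left) (auto simp: P_def)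
    finally show ?thesis .
  qed
  then have "(\<Sum>b\<in>BGmu G \<mu>. Msum G b \<mu>)
      = (\<Sum>p\<in>P. \<Sum>b\<in>BGmu G \<mu>. if p \<in> Rset G b \<mu> then frag_cmul (?c b p) (frag_of p) else 0)"
    by (simp add: sum.swap[of _ "BGmu G \<mu>"])
  also have "\<dots> = (\<Sum>p\<in>P. if p = (Delta G, \<mu>) then frag_of p else 0)"
  proof (rule sum.cong)
    fix p assume "p \<in> P"
    then obtain S \<nu> where p: "p = (S, \<nu>)" "(S, \<nu>) \<in> cochar_pairs G" by (cases p) (auto simp: P_def)
    have "(\<Sum>b\<in>BGmu G \<mu>. if p \<in> Rset G b \<mu> then frag_cmul (?c b p) (frag_of p) else 0)
        = (\<Sum>b | b \<in> BGmu G \<mu> \<and> p \<in> Rset G b \<mu>. frag_cmul (?c b p) (frag_of p))"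
      using finite_BGmu[of \<mu>] by (intro sum.mono_neutral_cong_right) auto
    also have "\<dots> = frag_cmul (\<Sum>b | b \<in> BGmu G \<mu> \<and> p \<in> Rset G b \<mu>. ?c b p) (frag_of p)"
      by (simp add: frag_cmul_sum_left)
    also have "(\<Sum>b | b \<in> BGmu G \<mu> \<and> p \<in> Rset G b \<mu>. ?c b p) = (if p = (Delta G, \<mu>) then 1 else 0)"
      using coefficient_sum[OF assms(2) p(2)] by (simp add: p(1))
    finally show "(\<Sum>b\<in>BGmu G \<mu>. if p \<in> Rset G b \<mu> then frag_cmul (?c b p) (frag_of p) else 0)
        = (if p = (Delta G, \<mu>) then frag_of p else 0)" by simp
  qed simp
  also have "\<dots> = frag_of (Delta G, \<mu>)"
    using finP assms(2) Levi_conjugate_refl[OF order_refl, of \<mu>] by (simp add: P_def)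
  finally show ?thesis .
qed

end
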